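(* Let $n\ge 2$. There is an open and dense set $C\subset\mathfrak{sl}(n,\mathbb{H})^2=\mathfrak{sl}(n,\mathbb{H})\times\mathfrak{sl}(n,\mathbb{H})$ such that for every pair $(A,B)\in C$ the invariant control system $\dot g=Ag+uBg$ on $\mathrm{Sl}(n,\mathbb{H})$ with unrestricted controls $u\in\mathbb{R}$ is controllable.
   Context: $\mathbb{H}$ denotes the real quaternions. $\mathrm{Sl}(n,\mathbb{H})$ is the Lie group of $n\times n$ quaternionic matrices $g$ with $|\det g|=1$ (equivalently, $g$ is invertible and the real-linear map it induces on $\mathbb{H}^n\cong\mathbb{R}^{4n}$ has determinant $1$). Its Lie algebra $\mathfrak{sl}(n,\mathbb{H})$ consists of the $n\times n$ quaternionic matrices whose trace has zero real part; it carries its usual topology as a finite-dimensional real vector space. The control semigroup $S_{A,B}$ of the system $\dot g=Ag+uBg$, $u\in\mathbb{R}$, is the subsemigroup of $\mathrm{Sl}(n,\mathbb{H})$ generated by all $e^{t(A+uB)}$ with $t\ge 0$ and $u\in\mathbb{R}$. The system is controllable if $S_{A,B}=\mathrm{Sl}(n,\mathbb{H})$. *)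

theory Defs
  imports "HOL-Analysis.Analysis"
begin

section \<open>The real quaternions\<close>

codatatype quat = Quat (qRe: real) (qI: real) (qJ: real) (qK: real)

lemma quat_eq_iff:
  "x = y \<longleftrightarrow> qRe x = qRe y \<and> qI x = qI y \<and> qJ x = qJ y \<and> qK x = qK y"
  by (cases x; cases y) simp

instantiation quat :: ab_group_add
begin

primcorec zero_quat where
  "qRe 0 = 0" | "qI 0 = 0" | "qJ 0 = 0" | "qK 0 = 0"

primcorec plus_quat where
  "qRe (x + y) = qRe x + qRe y"
| "qI (x + y) = qI x + qI y"
| "qJ (x + y) = qJ x + qJ y"
| "qK (x + y) = qK x + qK y"

primcorec uminus_quat where
  "qRe (- x) = - qRe x"
| "qI (- x) = - qI x"
| "qJ (- x) = - qJ x"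
| "qK (- x) = - qK x"

primcorec minus_quat where
  "qRe (x - y) = qRe x - qRe y"
| "qI (x - y) = qI x - qI y"
| "qJ (x - y) = qJ x - qJ y"
| "qK (x - y) = qK x - qK y"

instance
  by standard (simp_all add: quat_eq_iff)

end

instantiation quat :: ring_1
begin

primcorec one_quat where
  "qRe 1 = 1" | "qI 1 = 0" | "qJ 1 = 0" | "qK 1 = 0"

primcorec times_quat where
  "qRe (x * y) = qRe x * qRe y - qI x * qI y - qJ x * qJ y - qK x * qK y"
| "qI (x * y) = qRe x * qI y + qI x * qRe y + qJ x * qK y - qK x * qJ y"
| "qJ (x * y) = qRe x * qJ y - qI x * qK y + qJ x * qRe y + qK x * qI y"
| "qK (x * y) = qRe x * qK y + qI x * qJ y - qJ x * qI y + qK x * qRe y"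

instance
  by standard (simp_all add: quat_eq_iff algebra_simps)

end

lemma quat_sum_squares_eq_0_iff:
  "(qRe x)\<^sup>2 + (qI x)\<^sup>2 + (qJ x)\<^sup>2 + (qK x)\<^sup>2 = 0 \<longleftrightarrow> x = 0"
  by (simp add: quat_eq_iff add_nonneg_eq_0_iff)

instantiation quat :: real_algebra_1
begin

primcorec scaleR_quat where
  "qRe (r *\<^sub>R x) = r * qRe x"
| "qI (r *\<^sub>R x) = r * qI x"
| "qJ (r *\<^sub>R x) = r * qJ x"
| "qK (r *\<^sub>R x) = r * qK x"

instance
  by standard (simp_all add: quat_eq_iff algebra_simps)

end

instantiation quat :: real_div_algebra
begin

primcorec inverse_quat where
  "qRe (inverse x) = qRe x / ((qRe x)\<^sup>2 + (qI x)\<^sup>2 + (qJ x)\<^sup>2 + (qK x)\<^sup>2)"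
| "qI (inverse x) = - qI x / ((qRe x)\<^sup>2 + (qI x)\<^sup>2 + (qJ x)\<^sup>2 + (qK x)\<^sup>2)"
| "qJ (inverse x) = - qJ x / ((qRe x)\<^sup>2 + (qI x)\<^sup>2 + (qJ x)\<^sup>2 + (qK x)\<^sup>2)"
| "qK (inverse x) = - qK x / ((qRe x)\<^sup>2 + (qI x)\<^sup>2 + (qJ x)\<^sup>2 + (qK x)\<^sup>2)"

definition "x div y = x * inverse y" for x y :: quat

instance
proof
  fix x y :: quat
  show "x div y = x * inverse y"
    by (rule divide_quat_def)
  show "inverse (0::quat) = 0"
    by (simp add: quat_eq_iff)
  assume "x \<noteq> 0"
  define N where "N = (qRe x)\<^sup>2 + (qI x)\<^sup>2 + (qJ x)\<^sup>2 + (qK x)\<^sup>2"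
  have "N \<noteq> 0"
    using \<open>x \<noteq> 0\<close> by (simp add: N_def quat_sum_squares_eq_0_iff)
  then have "qRe x * qRe x / N + qI x * qI x / N + qJ x * qJ x / N + qK x * qK x / N = 1"
    by (simp add: add_divide_distrib [symmetric]) (simp add: N_def power2_eq_square)
  then show "inverse x * x = 1" "x * inverse x = 1"
    by (simp_all add: quat_eq_iff N_def [symmetric] mult.commute)
qed

end

instantiation quat :: real_normed_div_algebra
begin

definition "norm x = sqrt ((qRe x)\<^sup>2 + (qI x)\<^sup>2 + (qJ x)\<^sup>2 + (qK x)\<^sup>2)" for x :: quat

definition "sgn x = x /\<^sub>R norm x" for x :: quat

definition "dist x y = norm (x - y)" for x y :: quat

definition uniformity_quat :: "(quat \<times> quat) filter" where
  "uniformity_quat = (INF e\<in>{0 <..}. principal {(x, y). dist x y < e})"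

definition open_quat :: "quat set \<Rightarrow> bool" where
  "open_quat U \<longleftrightarrow> (\<forall>x\<in>U. eventually (\<lambda>(x', y). x' = x \<longrightarrow> y \<in> U) uniformity)"

lemma norm_quat_L2: "norm x = L2_set (\<lambda>i. [qRe x, qI x, qJ x, qK x] ! i) {..<4}" for x :: quat
  by (simp add: norm_quat_def L2_set_def eval_nat_numeral)

instance
proof
  fix r :: real and x y :: quat and U :: "quat set"
  show "dist x y = norm (x - y)" by (rule dist_quat_def)
  show "sgn x = x /\<^sub>R norm x" by (rule sgn_quat_def)
  show "(uniformity :: (quat \<times> quat) filter)
      = (INF e\<in>{0 <..}. principal {(x, y). dist x y < e})"
    by (rule uniformity_quat_def)
  show "open U \<longleftrightarrow> (\<forall>x\<in>U. eventually (\<lambda>(x', y). x' = x \<longrightarrow> y \<in> U) uniformity)"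
    by (rule open_quat_def)
  show "norm x = 0 \<longleftrightarrow> x = 0"
    by (simp add: norm_quat_def quat_sum_squares_eq_0_iff)
  have "norm (x + y) = L2_set (\<lambda>i. [qRe x, qI x, qJ x, qK x] ! i
      + [qRe y, qI y, qJ y, qK y] ! i) {..<4}"
    by (simp add: norm_quat_def L2_set_def eval_nat_numeral)
  also have "\<dots> \<le> norm x + norm y"
    unfolding norm_quat_L2 by (rule L2_set_triangle_ineq)
  finally show "norm (x + y) \<le> norm x + norm y" .
  have "norm (r *\<^sub>R x) = sqrt (r\<^sup>2 * ((qRe x)\<^sup>2 + (qI x)\<^sup>2 + (qJ x)\<^sup>2 + (qK x)\<^sup>2))"
    by (simp add: norm_quat_def power_mult_distrib algebra_simps)
  then show "norm (r *\<^sub>R x) = \<bar>r\<bar> * norm x"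
    by (simp add: norm_quat_def real_sqrt_mult)
  show "norm (x * y) = norm x * norm y"
    unfolding norm_quat_def real_sqrt_mult [symmetric]
    by (simp add: power2_eq_square algebra_simps)
qed

end

instantiation quat :: euclidean_space
begin

definition "inner x y = qRe x * qRe y + qI x * qI y + qJ x * qJ y + qK x * qK y" for x y :: quat

definition "Basis = {Quat 1 0 0 0, Quat 0 1 0 0, Quat 0 0 1 0, Quat 0 0 0 1}"

instance
proof
  fix x y z :: quat and r :: real
  show "inner x y = inner y x" "inner (x + y) z = inner x z + inner y z"
    "inner (r *\<^sub>R x) y = r * inner x y" "0 \<le> inner x x"
    by (simp_all add: inner_quat_def algebra_simps)
  show "inner x x = 0 \<longleftrightarrow> x = 0"
    using quat_sum_squares_eq_0_iff [of x] by (simp add: inner_quat_def power2_eq_square)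
  show "norm x = sqrt (inner x x)"
    by (simp add: inner_quat_def norm_quat_def power2_eq_square)
  show "(Basis :: quat set) \<noteq> {}" "finite (Basis :: quat set)"
    by (simp_all add: Basis_quat_def)
  show "(\<forall>u\<in>Basis. inner x u = 0) \<longleftrightarrow> x = 0"
    by (simp add: Basis_quat_def inner_quat_def) (simp add: quat_eq_iff)
next
  fix u v :: quat
  assume "u \<in> Basis" "v \<in> Basis"
  then show "inner u v = (if u = v then 1 else 0)"
    unfolding Basis_quat_def
    by (elim insertE emptyE; hypsubst) (simp_all add: inner_quat_def)
qed

end


section \<open>The special linear group and its Lie algebra\<close>

text \<open>The identification of the quaternionic column space with real Euclidean space of four times
  the dimension: the pair \<open>(i, a)\<close> indexes the \<open>a\<close>-th real coordinate of the \<open>i\<close>-th entry,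
  where \<open>1, 2, 3, 4\<close> stand for the real, i-, j- and k-part.\<close>

definition real_coords :: "quat ^ 'n \<Rightarrow> real ^ ('n \<times> 4)" where
  "real_coords x = (\<chi> p. vector [qRe (x $ fst p), qI (x $ fst p), qJ (x $ fst p), qK (x $ fst p)]
                       $ snd p)"

definition of_real_coords :: "real ^ ('n \<times> 4) \<Rightarrow> quat ^ 'n" where
  "of_real_coords v = (\<chi> i. Quat (v $ (i, 1)) (v $ (i, 2)) (v $ (i, 3)) (v $ (i, 4)))"

lemma real_coords_nth [simp]:
  "real_coords x $ (i, 1) = qRe (x $ i)" "real_coords x $ (i, 2) = qI (x $ i)"
  "real_coords x $ (i, 3) = qJ (x $ i)" "real_coords x $ (i, 4) = qK (x $ i)"
  by (simp_all add: real_coords_def vector_def)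

lemma of_real_coords_real_coords [simp]: "of_real_coords (real_coords x) = x"
  by (simp add: of_real_coords_def vec_eq_iff)

lemma real_coords_of_real_coords [simp]: "real_coords (of_real_coords v) = v"
  by (simp add: vec_eq_iff split_paired_All forall_4) (simp add: of_real_coords_def)

lemma linear_real_coords: "linear real_coords"
  by (rule linearI) (simp_all add: vec_eq_iff split_paired_All forall_4)

lemma linear_of_real_coords: "linear of_real_coords"
  by (rule linearI) (simp_all add: vec_eq_iff of_real_coords_def quat_eq_iff)

text \<open>The determinant of the real-linear map \<open>x \<mapsto> g x\<close>. For invertible \<open>g\<close> it is positive,
  namely a fixed positive power of \<open>|det g|\<close> (\<open>det\<close> itself is not available over the
  noncommutative ring of quaternions).\<close>

definition real_det :: "quat ^ 'n ^ 'n \<Rightarrow> real" where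
  "real_det g = det (matrix (real_coords \<circ> (\<lambda>x. g *v x) \<circ> of_real_coords))"

lemma linear_real_action:
  "linear (real_coords \<circ> (\<lambda>x. g *v x) \<circ> of_real_coords)" for g :: "quat ^ 'n ^ 'n"
proof -
  have "linear (\<lambda>x. g *v x)"
    by (rule linearI)
      (simp_all add: vec_eq_iff matrix_vector_mult_def distrib_left sum.distrib scaleR_right.sum)
  then show ?thesis
    by (intro linear_compose linear_real_coords linear_of_real_coords)
qed

lemma real_det_mat_1: "real_det (mat 1 :: quat ^ 'n ^ 'n) = 1"
proof -
  have "real_coords \<circ> (\<lambda>x. (mat 1 :: quat ^ 'n ^ 'n) *v x) \<circ> of_real_coords = id"
    by (rule ext) simp
  then show ?thesis
    by (simp add: real_det_def matrix_id_mat_1)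
qed

lemma real_det_mult: "real_det (g ** h) = real_det g * real_det h"
proof -
  have "real_coords \<circ> (\<lambda>x. (g ** h) *v x) \<circ> of_real_coords
      = (real_coords \<circ> (\<lambda>x. g *v x) \<circ> of_real_coords)
        \<circ> (real_coords \<circ> (\<lambda>x. h *v x) \<circ> of_real_coords)"
    by (rule ext) (simp add: matrix_vector_mul_assoc)
  then show ?thesis
    by (simp add: real_det_def matrix_compose [OF linear_real_action linear_real_action] det_mul)
qed

definition SL_H :: "(quat ^ 'n ^ 'n) set" where
  "SL_H = {g. invertible g \<and> real_det g = 1}"

definition sl_H :: "(quat ^ 'n ^ 'n) set" where
  "sl_H = {A. qRe (trace A) = 0}"


section \<open>The control system\<close>

primrec matrix_power :: "'a::semiring_1 ^ 'n ^ 'n \<Rightarrow> nat \<Rightarrow> 'a ^ 'n ^ 'n" where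
  "matrix_power A 0 = mat 1"
| "matrix_power A (Suc k) = A ** matrix_power A k"

definition matrix_exp :: "'a::real_normed_algebra_1 ^ 'n ^ 'n \<Rightarrow> 'a ^ 'n ^ 'n" where
  "matrix_exp A = (\<Sum>k. matrix_power A k /\<^sub>R fact k)"

inductive_set control_semigroup :: "quat ^ 'n ^ 'n \<Rightarrow> quat ^ 'n ^ 'n \<Rightarrow> (quat ^ 'n ^ 'n) set"
  for A B :: "quat ^ 'n ^ 'n" where
  generator: "0 \<le> t \<Longrightarrow> matrix_exp (t *\<^sub>R (A + u *\<^sub>R B)) \<in> control_semigroup A B"
| mult: "\<lbrakk>g \<in> control_semigroup A B; h \<in> control_semigroup A B\<rbrakk>
    \<Longrightarrow> g ** h \<in> control_semigroup A B"

definition controllable :: "quat ^ 'n ^ 'n \<Rightarrow> quat ^ 'n ^ 'n \<Rightarrow> bool" where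
  "controllable A B \<longleftrightarrow> control_semigroup A B = SL_H"

end

theory Submission
  imports Defs "HOL-Real_Asymp.Real_Asymp" "HOL-Computational_Algebra.Fundamental_Theorem_Algebra"
begin

text \<open>
  Adjoin the positive scalars to the control semigroup and let \<open>\<Sigma>\<close> be the closure of the resulting
  semigroup. The set of all \<open>X\<close> with \<open>e\<^sup>t\<^sup>X \<in> \<Sigma>\<close> for \<open>t \<ge> 0\<close> is a closed convex cone (Trotter) whose
  edge is a Lie algebra; it contains \<open>A\<close> and \<open>\<plusminus>B\<close>.

  Suppose that \<open>B\<close> is diagonal with complex entries of distinct real parts, the extreme ones sitting
  at \<open>p\<close> and \<open>q\<close>. Rescaling \<open>e\<^sup>s\<^sup>B A e\<^sup>-\<^sup>s\<^sup>B\<close> as \<open>s \<rightarrow> \<plusminus>\<infinity>\<close> isolates the \<open>(p, q)\<close> and \<open>(q, p)\<close> entries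
  of \<open>A\<close>, multiplied by phases. Because the root spaces are copies of the quaternions, these phases
  can be arranged to reach both signs, so both root vectors lie in the edge. Brackets with \<open>B\<close> then produce the full root spaces, and further brackets everything,
  hence \<open>\<Sigma>\<close> contains all invertible matrices.

  Density is upgraded to equality, and at the same time shown to be stable under perturbation of
  \<open>(A, B)\<close>, by choosing a product of exponentials that is a submersion in the switching times:
  Brouwer's theorem makes it cover a neighbourhood of the identity uniformly in \<open>(A, B)\<close>. So
  controllable pairs contain an open neighbourhood of every pair as above, and these are dense
  because quaternionic matrices can be diagonalized after an arbitrarily small perturbation.
\<close>

section \<open>Lie wedges in Banach algebras\<close>

text \<open>The decisive choice is to give \<open>p\<close> and \<open>q\<close> imaginary parts
  that are an odd and an even multiple of one number \<open>\<beta>\<close>. At time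
  \<open>pi / \<beta>\<close> the exponential of \<open>B\<close> then has real entries of opposite
  sign at \<open>p\<close> and \<open>q\<close>, so the corner entry of the drift comes back with
  alternating sign instead of staying on one side of a cone. This commensurability is dense but not
  open, so the pairs treated directly form no open set; all openness has to come from stability. A
  statement about a closure is by itself not stable either. What survives a perturbation is a word
  of value \<open>mat 1\<close> whose derivative in the durations is onto. Finding one uses the
  density result: it makes a maximal tangent space invariant under conjugation by every invertible
  matrix, and such a space is full as soon as it contains \<open>mat 1\<close> and one matrix with a
  nonzero off-diagonal entry. The adjoined scalars cost nothing in the end: a positive scalar
  relating two matrices of real determinant 1 equals 1.\<close>

lemma exp_scaleR_unique:
  fixes X :: "'a :: {real_normed_algebra_1, banach}"
  assumes deriv: "\<And>s. (Z has_vector_derivative X * Z s) (at s)" and init: "Z 0 = 1"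
  shows "exp (s *\<^sub>R X) = Z s"
proof -
  have E: "((\<lambda>s. exp (s *\<^sub>R (- X))) has_vector_derivative exp (s *\<^sub>R (- X)) * (- X)) (at s)" for s
    by (rule exp_scaleR_has_vector_derivative_right)
  \<comment> \<open>A solution of the equation is compared with the exponential through this
    product, which is constant. The closed forms of exponentials below (conjugates, diagonal
    matrices, shears) are all obtained by exhibiting such a \<open>Z\<close>.\<close>
  have "((\<lambda>s. exp (s *\<^sub>R (- X)) * Z s) has_vector_derivative 0) (at s)" for s
    using has_vector_derivative_mult[OF E deriv, of s] by (simp add: algebra_simps)
  then obtain c where c: "exp (s *\<^sub>R (- X)) * Z s = c" for s
    using has_vector_derivative_zero_constant[of UNIV "\<lambda>s. exp (s *\<^sub>R (- X)) * Z s"] by auto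
  have "c = 1"
    using c[of 0] init by simp
  then have "exp (s *\<^sub>R X) * (exp (s *\<^sub>R (- X)) * Z s) = exp (s *\<^sub>R X)"
    using c by simp
  then show ?thesis
    by (simp add: mult.assoc[symmetric] exp_minus_inverse)
qed

lemma norm_power_diff_le:
  fixes a b :: "'a :: real_normed_algebra_1"
  assumes "norm a \<le> K" "norm b \<le> K" "1 \<le> K"
  shows "norm (a ^ m - b ^ m) \<le> real m * norm (a - b) * K ^ m"
proof (induction m)
  case (Suc m)
  have K0: "0 \<le> K" using assms by linarith
  have "a ^ Suc m - b ^ Suc m = a * (a ^ m - b ^ m) + (a - b) * b ^ m"
    by (simp add: algebra_simps)
  then have "norm (a ^ Suc m - b ^ Suc m) \<le> norm a * norm (a ^ m - b ^ m) + norm (a - b) * norm (b ^ m)"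
    by (metis norm_triangle_mono norm_mult_ineq)
  also have "\<dots> \<le> K * (real m * norm (a - b) * K ^ m) + norm (a - b) * K ^ m"
    using assms K0 Suc by (intro add_mono mult_mono) (auto intro: order_trans[OF norm_power_ineq power_mono])
  also have "\<dots> \<le> K * (real m * norm (a - b) * K ^ m) + norm (a - b) * K ^ Suc m"
    using assms K0 by (intro add_left_mono mult_left_mono power_increasing) auto
  also have "\<dots> = real (Suc m) * norm (a - b) * K ^ Suc m"
    by (simp add: algebra_simps)
  finally show ?case .
qed simp

lemma exp_scaleR_power: "exp X ^ m = exp (real m *\<^sub>R X)" for X :: "'a :: {real_normed_algebra_1, banach}"
proof (induction m)
  case (Suc m)
  have "exp (X + real m *\<^sub>R X) = exp X * exp (real m *\<^sub>R X)"
    by (rule exp_add_commuting) simp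
  then show ?case
    by (simp add: Suc algebra_simps)
qed simp

lemma continuous_on_exp_algebra:
  fixes f :: "'b :: topological_space \<Rightarrow> 'a :: {real_normed_algebra_1, banach}"
  assumes "continuous_on A f"
  shows "continuous_on A (\<lambda>x. exp (f x))"
proof -
  have ball: "continuous_on (ball 0 r) (exp :: 'a \<Rightarrow> 'a)" for r
  proof -
    have "uniform_limit (ball 0 r) (\<lambda>n x. \<Sum>i<n. x ^ i /\<^sub>R fact i) (\<lambda>x. \<Sum>i. (x :: 'a) ^ i /\<^sub>R fact i) sequentially"
    proof (rule Weierstrass_m_test)
      show "norm (x ^ n /\<^sub>R fact n) \<le> r ^ n /\<^sub>R fact n" if "x \<in> ball 0 r" for n and x :: 'a
      proof -
        have "norm x ^ n \<le> r ^ n"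
          using that by (intro power_mono) auto
        then show ?thesis
          using norm_power_ineq[of x n] by (simp add: mult_left_mono)
      qed
      show "summable (\<lambda>n. r ^ n /\<^sub>R fact n)"
        by (rule summable_exp_generic)
    qed
    then have "continuous_on (ball 0 r) (\<lambda>x. \<Sum>i. (x :: 'a) ^ i /\<^sub>R fact i)"
      by (rule uniform_limit_theorem[rotated]) (auto intro!: always_eventually continuous_intros)
    then show ?thesis
      by (simp add: exp_def[abs_def])
  qed
  have "isCont (exp :: 'a \<Rightarrow> 'a) x" for x
    using ball[of "norm x + 1"] by (simp add: continuous_on_eq_continuous_at)
  then have "continuous_on UNIV (exp :: 'a \<Rightarrow> 'a)"
    by (simp add: continuous_on_eq_continuous_at)
  then show ?thesis
    using continuous_on_compose2[OF _ assms] by blast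
qed

text \<open>One step errs by \<open>f (1 / real (Suc m))\<close>. Since \<open>f\<close> has value
  and derivative zero at 0, this is of smaller order than the step; passing to the power
  \<open>Suc m\<close> multiplies it by the number of steps and by the constant
  \<open>C\<close>.\<close>

lemma trotter:
  fixes X Y :: "'a :: {real_normed_algebra_1, banach}"
  shows "(\<lambda>m. (exp (X /\<^sub>R real (Suc m)) * exp (Y /\<^sub>R real (Suc m))) ^ Suc m) \<longlonglongrightarrow> exp (X + Y)"
proof -
  define f where "f s = exp (s *\<^sub>R (X + Y)) - exp (s *\<^sub>R X) * exp (s *\<^sub>R Y)" for s
  have "(f has_vector_derivative 0) (at 0)"
    unfolding f_def
    using has_vector_derivative_diff[OF exp_scaleR_has_vector_derivative_left[of "X + Y" 0]
        has_vector_derivative_mult[OF exp_scaleR_has_vector_derivative_left[of X 0] exp_scaleR_has_vector_derivative_left[of Y 0]]]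
    by (simp add: algebra_simps)
  then have "(f has_derivative (\<lambda>_. 0)) (at 0)"
    by (simp add: has_vector_derivative_def)
  then have "((\<lambda>h. norm (f h) / norm h) \<longlongrightarrow> 0) (at 0)"
    by (simp add: has_derivative_at f_def)
  moreover have "filterlim (\<lambda>m. 1 / real (Suc m)) (at 0) sequentially"
    by real_asymp
  ultimately have lim0: "(\<lambda>m. norm (f (1 / real (Suc m))) / norm (1 / real (Suc m))) \<longlonglongrightarrow> 0"
    by (rule filterlim_compose)
  define C where "C = exp (norm X + norm Y)"
  have bound: "norm (exp (X + Y) - (exp (X /\<^sub>R real (Suc m)) * exp (Y /\<^sub>R real (Suc m))) ^ Suc m)
     \<le> norm (f (1 / real (Suc m))) / norm (1 / real (Suc m)) * C" for m
  proof -
    define K where "K = exp ((norm X + norm Y) / real (Suc m))"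
    define a where "a = exp ((X + Y) /\<^sub>R real (Suc m))"
    define b where "b = exp (X /\<^sub>R real (Suc m)) * exp (Y /\<^sub>R real (Suc m))"
    have m0: "0 < real (Suc m)" by simp
    have "norm a \<le> exp (norm ((X + Y) /\<^sub>R real (Suc m)))"
      unfolding a_def by (rule norm_exp)
    also have "\<dots> \<le> K"
      unfolding K_def using norm_triangle_ineq[of X Y]
      by (simp add: divide_inverse mult.commute mult_left_mono del: of_nat_Suc)
    finally have a: "norm a \<le> K" .
    have "norm b \<le> exp (norm (X /\<^sub>R real (Suc m))) * exp (norm (Y /\<^sub>R real (Suc m)))"
      unfolding b_def by (intro order_trans[OF norm_mult_ineq] mult_mono norm_exp) auto
    also have "\<dots> = K"
      unfolding K_def by (simp add: exp_add[symmetric] divide_inverse algebra_simps del: of_nat_Suc)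
    finally have b: "norm b \<le> K" .
    have "1 \<le> K"
      unfolding K_def by simp
    have pow: "exp (inverse (real (Suc m)) *\<^sub>R Z) ^ Suc m = exp Z" for Z :: 'a
      unfolding exp_scaleR_power by (simp del: of_nat_Suc)
    have aS: "a ^ Suc m = exp (X + Y)"
      unfolding a_def by (rule pow)
    have "K ^ Suc m = C"
      unfolding K_def C_def using exp_of_nat_mult[of "Suc m" "(norm X + norm Y) / real (Suc m)"] m0 by simp
    then have "norm (exp (X + Y) - b ^ Suc m) \<le> real (Suc m) * norm (a - b) * C"
      using norm_power_diff_le[OF a b \<open>1 \<le> K\<close>, of "Suc m"] unfolding aS by metis
    also have "a - b = f (1 / real (Suc m))"
      unfolding a_def b_def f_def by (simp add: divide_inverse del: of_nat_Suc)
    also have "real (Suc m) * norm (f (1 / real (Suc m))) = norm (f (1 / real (Suc m))) / norm (1 / real (Suc m))"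
      by simp
    finally show ?thesis unfolding b_def .
  qed
  have "(\<lambda>m. exp (X + Y) - (exp (X /\<^sub>R real (Suc m)) * exp (Y /\<^sub>R real (Suc m))) ^ Suc m) \<longlonglongrightarrow> 0"
    using tendsto_mult_right[OF lim0, of C]
    by (intro Lim_null_comparison[OF always_eventually[rule_format, OF bound]]) simp
  then show ?thesis
    using tendsto_diff[OF tendsto_const[of "exp (X + Y)"]] by fastforce
qed

text \<open>The identity \<open>h m - b = h m * (a - g m) * b\<close> first bounds
  \<open>norm (h m)\<close> by \<open>2 * norm b\<close> once \<open>g m\<close> is close to
  \<open>a\<close>, and then gives the convergence. It turns words approximating a matrix into
  inverse words approximating its inverse.\<close>

lemma tendsto_two_sided_inverse:
  fixes g h :: "nat \<Rightarrow> 'a :: real_normed_algebra_1"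
  assumes lim: "g \<longlonglongrightarrow> a" and inv: "\<And>m. h m * g m = 1" and inva: "a * b = 1"
  shows "h \<longlonglongrightarrow> b"
proof -
  have eq: "h m - b = h m * (a - g m) * b" for m
  proof -
    have "h m * (a - g m) * b = h m * (a * b) - (h m * g m) * b"
      by (simp add: algebra_simps)
    then show ?thesis by (simp add: inv inva)
  qed
  have z: "(\<lambda>m. norm (a - g m) * norm b) \<longlonglongrightarrow> 0"
    using tendsto_mult_left_zero[OF tendsto_norm_zero[OF LIM_zero[OF lim]], of "norm b"]
    by (simp add: norm_minus_commute)
  have "\<forall>\<^sub>F m in sequentially. norm (a - g m) * norm b < 1/2"
    by (rule order_tendstoD(2)[OF z]) simp
  then have ev: "\<forall>\<^sub>F m in sequentially. norm (h m - b) \<le> (2 * norm b) * (norm (a - g m) * norm b)"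
  proof eventually_elim
    case m: (elim m)
    have 1: "norm (h m - b) \<le> norm (h m) * (norm (a - g m) * norm b)"
    proof -
      have "norm (h m * ((a - g m) * b)) \<le> norm (h m) * norm ((a - g m) * b)"
        by (rule norm_mult_ineq)
      also have "\<dots> \<le> norm (h m) * (norm (a - g m) * norm b)"
        by (intro mult_left_mono norm_mult_ineq) simp
      finally show ?thesis
        unfolding eq[of m] mult.assoc .
    qed
    also have "\<dots> \<le> norm (h m) * (1/2)"
      using m by (intro mult_left_mono) auto
    finally have "norm (h m) \<le> 2 * norm b"
      using norm_triangle_ineq2[of "h m" b] by linarith
    then show "norm (h m - b) \<le> (2 * norm b) * (norm (a - g m) * norm b)"
      using 1 by (rule_tac order_trans[OF 1 mult_right_mono]) auto
  qed
  have "(\<lambda>m. (2 * norm b) * (norm (a - g m) * norm b)) \<longlonglongrightarrow> 0"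
    using tendsto_mult_left[OF z, of "2 * norm b"] by (simp only: mult_zero_right)
  with ev have "(\<lambda>m. h m - b) \<longlonglongrightarrow> 0"
    by (rule Lim_null_comparison)
  then show ?thesis
    by (rule LIM_zero_cancel)
qed

definition lie_wedge :: "'a :: {real_normed_algebra_1, banach} set \<Rightarrow> 'a set" where
  "lie_wedge S = {X. \<forall>t\<ge>0. exp (t *\<^sub>R X) \<in> S}"

definition wedge_edge :: "'a :: {real_normed_algebra_1, banach} set \<Rightarrow> 'a set" where
  "wedge_edge S = {X. X \<in> lie_wedge S \<and> - X \<in> lie_wedge S}"

locale closed_semigroup =
  fixes S :: "'a :: {real_normed_algebra_1, banach} set"
  assumes closed: "closed S"
    and mult: "\<lbrakk>x \<in> S; y \<in> S\<rbrakk> \<Longrightarrow> x * y \<in> S"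
    and one: "1 \<in> S"
begin

lemma power_mem: "x \<in> S \<Longrightarrow> x ^ m \<in> S"
  by (induction m) (auto simp: one mult)

lemma wedge_exp: "X \<in> lie_wedge S \<Longrightarrow> 0 \<le> t \<Longrightarrow> exp (t *\<^sub>R X) \<in> S"
  by (simp add: lie_wedge_def)

lemma wedge_zero: "0 \<in> lie_wedge S"
  by (simp add: lie_wedge_def one)

lemma wedge_scaleR: "X \<in> lie_wedge S \<Longrightarrow> 0 \<le> c \<Longrightarrow> c *\<^sub>R X \<in> lie_wedge S"
  by (simp add: lie_wedge_def)

lemma wedge_add:
  assumes "X \<in> lie_wedge S" "Y \<in> lie_wedge S"
  shows "X + Y \<in> lie_wedge S"
  unfolding lie_wedge_def
proof (intro CollectI allI impI)
  fix t :: real assume t: "0 \<le> t"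
  have "(exp ((t *\<^sub>R X) /\<^sub>R real (Suc m)) * exp ((t *\<^sub>R Y) /\<^sub>R real (Suc m))) ^ Suc m \<in> S" for m
    using wedge_exp[OF assms(1), of "inverse (real (Suc m)) * t"] wedge_exp[OF assms(2), of "inverse (real (Suc m)) * t"] t
    by (intro power_mem mult) auto
  then show "exp (t *\<^sub>R (X + Y)) \<in> S"
    using closed_sequentially[OF closed _ trotter[of "t *\<^sub>R X" "t *\<^sub>R Y"]] by (simp add: scaleR_add_right)
qed

lemma wedge_closed: "closed (lie_wedge S)"
proof -
  have "lie_wedge S = (\<Inter>t\<in>{0..}. (\<lambda>X. exp (t *\<^sub>R X)) -` S)"
    by (auto simp: lie_wedge_def)
  moreover have "closed ((\<lambda>X. exp (t *\<^sub>R X)) -` S)" for t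
    by (intro closed_vimage closed continuous_on_exp_algebra continuous_intros)
  ultimately show ?thesis by auto
qed

lemma wedge_Ad:
  assumes "g \<in> S" "h \<in> S" "h * g = 1" "g * h = 1" "X \<in> lie_wedge S"
  shows "g * X * h \<in> lie_wedge S"
  unfolding lie_wedge_def
proof (intro CollectI allI impI)
  fix t :: real assume t: "0 \<le> t"
  have "((\<lambda>s. g * exp (s *\<^sub>R X) * h) has_vector_derivative g * X * h * (g * exp (s *\<^sub>R X) * h)) (at s)" for s
  proof -
    have "g * X * h * (g * exp (s *\<^sub>R X) * h) = g * X * (h * g) * exp (s *\<^sub>R X) * h"
      by (simp only: mult.assoc)
    then have "g * X * h * (g * exp (s *\<^sub>R X) * h) = g * (X * exp (s *\<^sub>R X)) * h"
      using assms by (simp add: mult.assoc)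
    then show ?thesis
      using has_vector_derivative_mult_left[OF has_vector_derivative_mult_right[OF exp_scaleR_has_vector_derivative_left[of X s], of g], of h]
      by simp
  qed
  then have "exp (t *\<^sub>R (g * X * h)) = g * exp (t *\<^sub>R X) * h"
    using assms by (intro exp_scaleR_unique) auto
  then show "exp (t *\<^sub>R (g * X * h)) \<in> S"
    using assms wedge_exp[OF assms(5) t] by (simp add: mult)
qed

lemma edge_exp: "X \<in> wedge_edge S \<Longrightarrow> exp (t *\<^sub>R X) \<in> S"
  using wedge_exp[of X t] wedge_exp[of "- X" "- t"] by (cases "0 \<le> t") (auto simp: wedge_edge_def)

lemma edge_subspace: "subspace (wedge_edge S)"
proof (rule subspaceI)
  show "0 \<in> wedge_edge S"
    by (simp add: wedge_edge_def wedge_zero)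
  show "X + Y \<in> wedge_edge S" if "X \<in> wedge_edge S" "Y \<in> wedge_edge S" for X Y
    using that wedge_add[of X Y] wedge_add[of "- X" "- Y"] by (auto simp: wedge_edge_def)
  show "c *\<^sub>R X \<in> wedge_edge S" if "X \<in> wedge_edge S" for c X
    using that wedge_scaleR[of X c] wedge_scaleR[of "- X" c] wedge_scaleR[of X "- c"] wedge_scaleR[of "- X" "- c"]
    by (cases "0 \<le> c") (auto simp: wedge_edge_def)
qed

lemma edge_closed: "closed (wedge_edge S)"
proof -
  have "wedge_edge S = lie_wedge S \<inter> uminus -` lie_wedge S"
    by (auto simp: wedge_edge_def)
  then show ?thesis
    using wedge_closed by (auto intro!: closed_Int closed_vimage continuous_intros)
qed

lemma wedge_exp_Ad:
  assumes "X \<in> wedge_edge S" "Y \<in> lie_wedge S"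
  shows "exp X * Y * exp (- X) \<in> lie_wedge S"
  using edge_exp[OF assms(1), of 1] edge_exp[OF assms(1), of "-1"] assms(2)
    exp_minus_inverse[of X] exp_minus_inverse[of "- X"]
  by (intro wedge_Ad) simp_all

lemma edge_exp_Ad:
  assumes "X \<in> wedge_edge S" "Y \<in> wedge_edge S"
  shows "exp X * Y * exp (- X) \<in> wedge_edge S"
  using wedge_exp_Ad[OF assms(1), of Y] wedge_exp_Ad[OF assms(1), of "- Y"] assms(2)
  by (auto simp: wedge_edge_def)

text \<open>The curve \<open>f\<close> of conjugates of \<open>Y\<close> stays in the edge, hence so
  do its difference quotients at 0, because the edge is a subspace. Their limit is the bracket, and
  the edge is closed.\<close>

lemma edge_bracket:
  assumes X: "X \<in> wedge_edge S" and Y: "Y \<in> wedge_edge S"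
  shows "X * Y - Y * X \<in> wedge_edge S"
proof -
  define f where "f s = exp (s *\<^sub>R X) * Y * exp (s *\<^sub>R (- X))" for s
  have sX: "s *\<^sub>R X \<in> wedge_edge S" for s
    using edge_subspace X by (rule subspace_scale)
  have f: "f s \<in> wedge_edge S" for s
    unfolding f_def using edge_exp_Ad[OF sX Y, of s] by simp
  have "(f has_vector_derivative X * Y - Y * X) (at 0)"
    unfolding f_def
    using has_vector_derivative_mult[OF has_vector_derivative_mult_left[OF exp_scaleR_has_vector_derivative_left[of X 0], of Y]
        exp_scaleR_has_vector_derivative_left[of "- X" 0]]
    by (simp add: algebra_simps)
  then have lim0: "((\<lambda>h. norm (f h - f 0 - h *\<^sub>R (X * Y - Y * X)) / norm h) \<longlongrightarrow> 0) (at 0)"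
    by (simp add: has_vector_derivative_def has_derivative_iff_norm)
  have "\<forall>\<^sub>F h in at 0. norm (f h - f 0 - h *\<^sub>R (X * Y - Y * X)) / norm h
      = norm ((f h - f 0) /\<^sub>R h - (X * Y - Y * X))"
  proof (rule eventually_at_filter[THEN iffD2], intro always_eventually allI impI)
    fix h :: real assume "h \<noteq> 0"
    then have "(f h - f 0) /\<^sub>R h - (X * Y - Y * X) = (f h - f 0 - h *\<^sub>R (X * Y - Y * X)) /\<^sub>R h"
      by (simp add: scaleR_diff_right)
    then show "norm (f h - f 0 - h *\<^sub>R (X * Y - Y * X)) / norm h = norm ((f h - f 0) /\<^sub>R h - (X * Y - Y * X))"
      by (simp add: divide_inverse mult.commute)
  qed
  then have "((\<lambda>h. norm ((f h - f 0) /\<^sub>R h - (X * Y - Y * X))) \<longlongrightarrow> 0) (at 0)"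
    by (rule Lim_transform_eventually[OF lim0])
  then have lim: "((\<lambda>h. (f h - f 0) /\<^sub>R h) \<longlongrightarrow> X * Y - Y * X) (at 0)"
    by (rule LIM_zero_cancel[OF tendsto_norm_zero_cancel])
  have "\<forall>\<^sub>F h in at 0. (f h - f 0) /\<^sub>R h \<in> wedge_edge S"
    by (auto intro!: always_eventually subspace_scale[OF edge_subspace] subspace_diff[OF edge_subspace] f)
  then show ?thesis
    by (rule Lim_in_closed_set[OF edge_closed _ trivial_limit_at lim])
qed

end

section \<open>Matrices as operators\<close>

text \<open>A unital normed algebra needs a norm with \<open>norm 1 = 1\<close>, which the Euclidean norm on matrices violates;
  exponentials of matrices are therefore studied through the operator norm.\<close>

typedef (overloaded) 'a endo = "UNIV :: ('a::real_normed_vector \<Rightarrow>\<^sub>L 'a) set"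
  morphisms endo_map Endo ..

lemma endo_eq_iff: "x = y \<longleftrightarrow> endo_map x = endo_map y"
  by (simp add: endo_map_inject)

lemma endo_map_Endo [simp]: "endo_map (Endo f) = f"
  by (simp add: Endo_inverse)

instantiation endo :: (euclidean_space) real_algebra_1
begin

definition "0 = Endo 0"
definition "1 = Endo id_blinfun"
definition "x + y = Endo (endo_map x + endo_map y)"
definition "x - y = Endo (endo_map x - endo_map y)"
definition "- x = Endo (- endo_map x)"
definition "x * y = Endo (endo_map x o\<^sub>L endo_map y)"
definition "r *\<^sub>R x = Endo (r *\<^sub>R endo_map x)"

lemmas endo_defs = zero_endo_def one_endo_def plus_endo_def minus_endo_def uminus_endo_def
  times_endo_def scaleR_endo_def

instance
proof
  have "norm (id_blinfun :: 'a \<Rightarrow>\<^sub>L 'a) = 1"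
    by (rule norm_blinfun_id)
  then show "(0 :: 'a endo) \<noteq> 1"
    by (metis endo_eq_iff endo_map_Endo norm_zero one_endo_def zero_endo_def zero_neq_one)
qed (auto simp: endo_eq_iff endo_defs scaleR_add_right scaleR_add_left
    intro!: blinfun_eqI simp: blinfun.bilinear_simps)

end

instantiation endo :: (euclidean_space) real_normed_algebra_1
begin

definition "norm x = norm (endo_map x)"
definition "sgn x = x /\<^sub>R norm x" for x :: "'a endo"
definition "dist x y = norm (x - y)" for x y :: "'a endo"
definition uniformity_endo :: "('a endo \<times> 'a endo) filter" where
  "uniformity_endo = (INF e\<in>{0 <..}. principal {(x, y). dist x y < e})"
definition open_endo :: "'a endo set \<Rightarrow> bool" where
  "open_endo U \<longleftrightarrow> (\<forall>x\<in>U. eventually (\<lambda>(x', y). x' = x \<longrightarrow> y \<in> U) uniformity)"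

instance
proof
  fix x y :: "'a endo" and r :: real and U :: "'a endo set"
  show "dist x y = norm (x - y)" "sgn x = x /\<^sub>R norm x"
    by (simp_all add: dist_endo_def sgn_endo_def)
  show "(uniformity :: ('a endo \<times> 'a endo) filter) = (INF e\<in>{0 <..}. principal {(x, y). dist x y < e})"
    by (rule uniformity_endo_def)
  show "open U \<longleftrightarrow> (\<forall>x\<in>U. eventually (\<lambda>(x', y). x' = x \<longrightarrow> y \<in> U) uniformity)"
    by (rule open_endo_def)
  show "norm x = 0 \<longleftrightarrow> x = 0" "norm (x + y) \<le> norm x + norm y" "norm (r *\<^sub>R x) = \<bar>r\<bar> * norm x"
    "norm (x * y) \<le> norm x * norm y" "norm (1 :: 'a endo) = 1"
    by (simp_all add: endo_eq_iff endo_defs norm_endo_def norm_triangle_ineq norm_blinfun_compose)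
qed

end

instance endo :: (euclidean_space) banach
proof
  fix X :: "nat \<Rightarrow> 'a endo" assume "Cauchy X"
  then have "Cauchy (\<lambda>n. endo_map (X n))"
    by (simp add: Cauchy_def dist_norm norm_endo_def minus_endo_def)
  then obtain L where "(\<lambda>n. endo_map (X n)) \<longlonglongrightarrow> L"
    by (auto simp: Cauchy_convergent_iff convergent_def)
  then have "X \<longlonglongrightarrow> Endo L"
    by (simp add: LIMSEQ_iff dist_norm norm_endo_def minus_endo_def)
  then show "convergent X"
    by (auto simp: convergent_def)
qed

definition mat_op :: "quat ^ 'n ^ 'n \<Rightarrow> (quat ^ 'n) endo" where
  "mat_op A = Endo (Blinfun (\<lambda>x. A *v x))"

text \<open>Only a left inverse of \<open>mat_op\<close>: a real-linear endomorphism need not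
  commute with right multiplication by quaternions.\<close>

definition op_mat :: "(quat ^ 'n) endo \<Rightarrow> quat ^ 'n ^ 'n" where
  "op_mat T = (\<chi> i j. endo_map T (axis j 1) $ i)"

lemma mat_op_apply: "blinfun_apply (endo_map (mat_op A)) x = A *v x"
proof -
  have "bounded_linear (\<lambda>x. A *v x)"
    by (simp add: linear_conv_bounded_linear[symmetric])
  then show ?thesis
    by (simp add: mat_op_def bounded_linear_Blinfun_apply)
qed

lemma mat_op_eqI: "(\<And>x. blinfun_apply (endo_map T) x = A *v x) \<Longrightarrow> mat_op A = T"
  by (simp add: endo_eq_iff mat_op_apply blinfun_eqI)

lemma matrix_vector_axis: "(A *v axis j x) $ i = A $ i $ j * x" for A :: "quat ^ 'n ^ 'm"
  by (simp add: matrix_vector_mult_def axis_def if_distrib[of "(*) _"] sum.delta cong: if_cong)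

lemma op_mat_op [simp]: "op_mat (mat_op A) = A"
  by (simp add: op_mat_def mat_op_apply matrix_vector_axis vec_eq_iff)

lemma mat_op_mult: "mat_op (A ** B) = mat_op A * mat_op B"
  by (rule mat_op_eqI) (simp add: times_endo_def mat_op_apply matrix_vector_mul_assoc)

lemma mat_op_1: "mat_op (mat 1) = 1"
  by (rule mat_op_eqI) (simp add: one_endo_def)

lemma matrix_vector_scaleR: "(r *\<^sub>R A) *v x = r *\<^sub>R (A *v x)" for A :: "quat ^ 'n ^ 'm"
  by (simp add: matrix_vector_mult_def vec_eq_iff scaleR_sum_right)

lemma bounded_linear_mat_op: "bounded_linear mat_op"
  unfolding linear_conv_bounded_linear[symmetric]
  by (rule linearI; rule mat_op_eqI)
    (simp_all add: plus_endo_def scaleR_endo_def blinfun.bilinear_simps mat_op_apply algebra_simps matrix_vector_scaleR)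

lemma norm_axis_quat: "norm (axis i x) = norm x" for x :: quat
  by (simp add: norm_eq_sqrt_inner inner_axis_axis)

lemma bounded_linear_op_mat: "bounded_linear op_mat"
proof (rule bounded_linear_intro)
  fix T U :: "(quat ^ 'n) endo" and r :: real
  show "op_mat (T + U) = op_mat T + op_mat U" "op_mat (r *\<^sub>R T) = r *\<^sub>R op_mat T"
    by (simp_all add: op_mat_def vec_eq_iff plus_endo_def scaleR_endo_def blinfun.bilinear_simps)
  have "norm (op_mat T) \<le> (\<Sum>i\<in>UNIV. norm (op_mat T $ i))"
    unfolding norm_vec_def[of "op_mat T"] by (rule L2_set_le_sum) simp
  also have "\<dots> \<le> (\<Sum>i\<in>(UNIV::'n set). \<Sum>j\<in>(UNIV::'n set). norm T)"
  proof (rule sum_mono)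
    fix i :: 'n
    have "norm (op_mat T $ i) \<le> (\<Sum>j\<in>UNIV. norm (op_mat T $ i $ j))"
      unfolding norm_vec_def[of "op_mat T $ i"] by (rule L2_set_le_sum) simp
    also have "\<dots> \<le> (\<Sum>j\<in>(UNIV::'n set). norm T)"
    proof (rule sum_mono)
      fix j :: 'n
      have "norm (op_mat T $ i $ j) \<le> norm (endo_map T (axis j 1))"
        by (simp add: op_mat_def Finite_Cartesian_Product.norm_nth_le)
      also have "\<dots> \<le> norm (endo_map T) * norm (axis j (1::quat))"
        by (rule norm_blinfun)
      finally show "norm (op_mat T $ i $ j) \<le> norm T"
        by (simp add: norm_endo_def norm_axis_quat)
    qed
    finally show "norm (op_mat T $ i) \<le> (\<Sum>j\<in>(UNIV::'n set). norm T)" .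
  qed
  finally show "norm (op_mat T) \<le> norm T * (real CARD('n) * real CARD('n))"
    by (simp add: ac_simps)
qed

lemma matrix_bilinear: "bounded_bilinear ((**) :: quat ^ 'n ^ 'n \<Rightarrow> quat ^ 'n ^ 'n \<Rightarrow> quat ^ 'n ^ 'n)"
  unfolding bilinear_conv_bounded_bilinear[symmetric] bilinear_def
  by (intro allI conjI linearI)
    (simp_all add: matrix_matrix_mult_def vec_eq_iff algebra_simps sum.distrib scaleR_sum_right)

interpretation mm: bounded_bilinear "(**) :: quat ^ 'n ^ 'n \<Rightarrow> quat ^ 'n ^ 'n \<Rightarrow> quat ^ 'n ^ 'n"
  by (rule matrix_bilinear)

lemmas linear_mat_op = bounded_linear.linear[OF bounded_linear_mat_op]
lemmas mop_zero = linear_0[OF linear_mat_op]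
lemmas mop_add = linear_add[OF linear_mat_op]
lemmas mop_scaleR = linear_scale[OF linear_mat_op]
lemmas mop_minus = linear_neg[OF linear_mat_op]
lemmas mop_diff = linear_diff[OF linear_mat_op]
lemmas mop_sums = bounded_linear.sums[OF bounded_linear_mat_op]
lemmas mop_tendsto = bounded_linear.tendsto[OF bounded_linear_mat_op]
lemmas mop_continuous_on = bounded_linear.continuous_on[OF bounded_linear_mat_op]
lemmas mop_has_vector_derivative = bounded_linear.has_vector_derivative[OF bounded_linear_mat_op]

lemma mat_op_inject: "mat_op A = mat_op B \<longleftrightarrow> A = B"
  by (metis op_mat_op)

lemma mat_op_power: "mat_op (matrix_power A k) = mat_op A ^ k"
  by (induction k) (simp_all add: mat_op_1 mat_op_mult)

lemma matrix_exp_eq: "matrix_exp A = op_mat (exp (mat_op A))" 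
  and mat_op_exp: "mat_op (matrix_exp A) = exp (mat_op A)" for A :: "quat ^ 'n ^ 'n"
proof -
  have step: "mat_op (matrix_power A k /\<^sub>R fact k) = mat_op A ^ k /\<^sub>R fact k" for k
    by (simp add: mop_scaleR mat_op_power)
  have sums: "(\<lambda>k. mat_op (matrix_power A k /\<^sub>R fact k)) sums exp (mat_op A)"
    unfolding step by (rule exp_converges)
  then have sums': "(\<lambda>k. matrix_power A k /\<^sub>R fact k) sums op_mat (exp (mat_op A))"
    using bounded_linear.sums[OF bounded_linear_op_mat] by fastforce
  then show 1: "matrix_exp A = op_mat (exp (mat_op A))"
    by (simp add: matrix_exp_def sums_iff)
  show "mat_op (matrix_exp A) = exp (mat_op A)"
    unfolding 1 using sums_unique2[OF mop_sums[OF sums'] sums] .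
qed

lemma matrix_exp_0 [simp]: "matrix_exp (0 :: quat ^ 'n ^ 'n) = mat 1"
  by (simp add: matrix_exp_eq mop_zero) (metis mat_op_1 op_mat_op)

lemma matrix_exp_add_scaleR:
  fixes X :: "quat ^ 'n ^ 'n"
  shows "matrix_exp ((s + t) *\<^sub>R X) = matrix_exp (s *\<^sub>R X) ** matrix_exp (t *\<^sub>R X)"
proof -
  have "exp (mat_op (s *\<^sub>R X) + mat_op (t *\<^sub>R X)) = exp (mat_op (s *\<^sub>R X)) * exp (mat_op (t *\<^sub>R X))"
    by (rule exp_add_commuting) (simp add: mop_scaleR)
  then have "mat_op (matrix_exp ((s + t) *\<^sub>R X)) = mat_op (matrix_exp (s *\<^sub>R X) ** matrix_exp (t *\<^sub>R X))"
    by (simp add: mat_op_mult mat_op_exp mop_add[symmetric] scaleR_add_left)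
  then show ?thesis
    by (simp only: mat_op_inject)
qed

lemma matrix_exp_minus:
  fixes X :: "quat ^ 'n ^ 'n"
  shows "matrix_exp X ** matrix_exp (- X) = mat 1" "matrix_exp (- X) ** matrix_exp X = mat 1"
  using matrix_exp_add_scaleR[of 1 "-1" X] matrix_exp_add_scaleR[of "-1" 1 X] by auto

lemma matrix_exp_power:
  fixes X :: "quat ^ 'n ^ 'n"
  shows "matrix_power (matrix_exp X) m = matrix_exp (real m *\<^sub>R X)"
  by (rule mat_op_inject[THEN iffD1]) (simp only: mat_op_power mat_op_exp mop_scaleR exp_scaleR_power)

lemma matrix_exp_deriv:
  fixes X :: "quat ^ 'n ^ 'n"
  shows "((\<lambda>t. matrix_exp (t *\<^sub>R X)) has_vector_derivative X ** matrix_exp (t *\<^sub>R X)) (at t)"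
proof -
  have "((\<lambda>t. op_mat (exp (t *\<^sub>R mat_op X))) has_vector_derivative op_mat (mat_op X * exp (t *\<^sub>R mat_op X))) (at t)"
    by (rule bounded_linear.has_vector_derivative[OF bounded_linear_op_mat exp_scaleR_has_vector_derivative_left])
  then show ?thesis
    by (simp add: matrix_exp_eq[symmetric] mop_scaleR[symmetric] mat_op_exp[symmetric] mat_op_mult[symmetric])
qed

lemma matrix_exp_unique:
  fixes X :: "quat ^ 'n ^ 'n"
  assumes deriv: "\<And>s. (Z has_vector_derivative X ** Z s) (at s)" and init: "Z 0 = mat 1"
  shows "matrix_exp (s *\<^sub>R X) = Z s"
proof -
  have "exp (s *\<^sub>R mat_op X) = mat_op (Z s)"
    using mop_has_vector_derivative[OF deriv] init
    by (intro exp_scaleR_unique) (simp_all add: mat_op_mult mat_op_1)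
  then show ?thesis
    by (metis mat_op_exp mop_scaleR op_mat_op)
qed

lemma continuous_on_matrix_exp:
  fixes f :: "'b :: topological_space \<Rightarrow> quat ^ 'n ^ 'n"
  assumes "continuous_on A f"
  shows "continuous_on A (\<lambda>x. matrix_exp (f x))"
  unfolding matrix_exp_eq
  by (intro bounded_linear.continuous_on[OF bounded_linear_op_mat] continuous_on_exp_algebra
      mop_continuous_on assms)

lemma tendsto_matrix_inverse:
  fixes g h :: "nat \<Rightarrow> quat ^ 'n ^ 'n"
  assumes lim: "g \<longlonglongrightarrow> a" and inv: "\<And>m. h m ** g m = mat 1" and inva: "a ** b = mat 1"
  shows "h \<longlonglongrightarrow> b"
proof -
  have "(\<lambda>m. mat_op (h m)) \<longlonglongrightarrow> mat_op b"
    using inv inva by (intro tendsto_two_sided_inverse[OF mop_tendsto[OF lim]])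
      (simp_all add: mat_op_mult[symmetric] mat_op_1)
  then show ?thesis
    using bounded_linear.tendsto[OF bounded_linear_op_mat] by fastforce
qed

section \<open>Wedges and edges of matrix semigroups\<close>

definition mwedge :: "(quat ^ 'n ^ 'n) set \<Rightarrow> (quat ^ 'n ^ 'n) set" where
  "mwedge S = {X. \<forall>t\<ge>0. matrix_exp (t *\<^sub>R X) \<in> S}"

definition medge :: "(quat ^ 'n ^ 'n) set \<Rightarrow> (quat ^ 'n ^ 'n) set" where
  "medge S = {X. X \<in> mwedge S \<and> - X \<in> mwedge S}"

locale closed_matrix_semigroup =
  fixes S :: "(quat ^ 'n ^ 'n) set"
  assumes closed: "closed S"
    and mult: "\<lbrakk>x \<in> S; y \<in> S\<rbrakk> \<Longrightarrow> x ** y \<in> S"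
    and one: "mat 1 \<in> S"
begin

lemma op_semigroup: "closed_semigroup (mat_op ` S)"
proof
  \<comment> \<open>The fixed points of \<open>mat_op\<close> after \<open>op_mat\<close> are
    exactly the operators that come from matrices; they form a closed set, which makes closedness
    transferable.\<close>
  have "mat_op ` S = {T. mat_op (op_mat T) = T} \<inter> op_mat -` S"
    by (auto simp: image_iff) metis
  moreover have "closed {T :: (quat ^ 'n) endo. mat_op (op_mat T) = T}"
    by (intro closed_Collect_eq mop_continuous_on bounded_linear.continuous_on[OF bounded_linear_op_mat]
        continuous_on_id)
  moreover have "closed (op_mat -` S)"
    by (intro closed_vimage closed bounded_linear.continuous_on[OF bounded_linear_op_mat] continuous_on_id)
  ultimately show "closed (mat_op ` S)"
    by (simp add: closed_Int)
  show "x * y \<in> mat_op ` S" if "x \<in> mat_op ` S" "y \<in> mat_op ` S" for x y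
    using that mult by (auto simp: mat_op_mult[symmetric])
  show "1 \<in> mat_op ` S"
    using one by (simp add: mat_op_1[symmetric])
qed

sublocale op: closed_semigroup "mat_op ` S"
  by (rule op_semigroup)

lemma mem_op_iff: "mat_op x \<in> mat_op ` S \<longleftrightarrow> x \<in> S"
  by (auto simp: mat_op_inject)

lemma mwedge_op: "X \<in> mwedge S \<longleftrightarrow> mat_op X \<in> lie_wedge (mat_op ` S)"
  by (simp add: mwedge_def lie_wedge_def mop_scaleR[symmetric] mat_op_exp[symmetric] mem_op_iff)

lemma medge_op: "X \<in> medge S \<longleftrightarrow> mat_op X \<in> wedge_edge (mat_op ` S)"
  by (simp add: medge_def wedge_edge_def mwedge_op mop_minus)

lemma mwedge_add: "\<lbrakk>X \<in> mwedge S; Y \<in> mwedge S\<rbrakk> \<Longrightarrow> X + Y \<in> mwedge S"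
  by (simp add: mwedge_op mop_add op.wedge_add)

lemma mwedge_scaleR: "\<lbrakk>X \<in> mwedge S; 0 \<le> c\<rbrakk> \<Longrightarrow> c *\<^sub>R X \<in> mwedge S"
  by (simp add: mwedge_op mop_scaleR op.wedge_scaleR)

lemma mwedge_limit:
  assumes "\<And>m. X m \<in> mwedge S" "X \<longlonglongrightarrow> Y"
  shows "Y \<in> mwedge S"
  using assms closed_sequentially[OF op.wedge_closed _ mop_tendsto[OF assms(2)]] by (simp add: mwedge_op)

lemma mwedge_Ad:
  assumes "g \<in> S" "h \<in> S" "h ** g = mat 1" "g ** h = mat 1" "X \<in> mwedge S"
  shows "g ** X ** h \<in> mwedge S"
proof -
  have "mat_op h * mat_op g = 1" "mat_op g * mat_op h = 1"
    unfolding mat_op_mult[symmetric] assms by (rule mat_op_1)+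
  then have "mat_op g * mat_op X * mat_op h \<in> lie_wedge (mat_op ` S)"
    using assms by (intro op.wedge_Ad) (simp_all add: mwedge_op)
  then show ?thesis
    by (simp add: mwedge_op mat_op_mult)
qed

lemma medge_exp: "X \<in> medge S \<Longrightarrow> matrix_exp (t *\<^sub>R X) \<in> S"
  using op.edge_exp[of "mat_op X" t] mem_op_iff[of "matrix_exp (t *\<^sub>R X)"]
  by (simp add: medge_op mat_op_exp mop_scaleR)

lemma medge_subspace: "subspace (medge S)"
proof (rule subspaceI)
  show "0 \<in> medge S"
    using subspace_0[OF op.edge_subspace] by (simp add: medge_op mop_zero)
  show "X + Y \<in> medge S" if "X \<in> medge S" "Y \<in> medge S" for X Y
    using that subspace_add[OF op.edge_subspace] by (simp add: medge_op mop_add)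
  show "c *\<^sub>R X \<in> medge S" if "X \<in> medge S" for c X
    using that subspace_scale[OF op.edge_subspace] by (simp add: medge_op mop_scaleR)
qed

lemma medge_bracket: "\<lbrakk>X \<in> medge S; Y \<in> medge S\<rbrakk> \<Longrightarrow> X ** Y - Y ** X \<in> medge S"
  by (simp add: medge_op mat_op_mult mop_diff op.edge_bracket)

lemma medge_exp_Ad:
  assumes "X \<in> medge S" "Y \<in> mwedge S"
  shows "matrix_exp (t *\<^sub>R X) ** Y ** matrix_exp (- t *\<^sub>R X) \<in> mwedge S"
  using matrix_exp_minus[of "t *\<^sub>R X"] medge_exp[OF assms(1)] assms(2)
    medge_exp[OF assms(1), of "- t"]
  by (intro mwedge_Ad) simp_all

lemma medgeI: "\<lbrakk>X \<in> mwedge S; - X \<in> mwedge S\<rbrakk> \<Longrightarrow> X \<in> medge S"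
  by (simp add: medge_def)

lemma medgeD: "X \<in> medge S \<Longrightarrow> X \<in> mwedge S"
  by (simp add: medge_def)

end

section \<open>Generation of the general linear group by exponentials\<close>

definition munit :: "'n \<Rightarrow> 'n \<Rightarrow> quat \<Rightarrow> quat ^ 'n ^ 'n" where
  "munit a b x = (\<chi> i j. if i = a \<and> j = b then x else 0)"

definition dmat :: "('n \<Rightarrow> quat) \<Rightarrow> quat ^ 'n ^ 'n" where
  "dmat d = (\<chi> i j. if i = j then d i else 0)"

lemma munit_nth [simp]: "munit a b x $ i $ j = (if i = a \<and> j = b then x else 0)"
  by (simp add: munit_def)

lemma dmat_nth [simp]: "dmat d $ i $ j = (if i = j then d i else 0)"
  by (simp add: dmat_def)

lemma mat_1_dmat: "mat 1 = dmat (\<lambda>_. 1)"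
  by (simp add: vec_eq_iff mat_def)

lemma munit_add: "munit a b (x + y) = munit a b x + munit a b y"
  and munit_diff: "munit a b (x - y) = munit a b x - munit a b y"
  and munit_minus: "munit a b (- x) = - munit a b x"
  and munit_scaleR: "munit a b (r *\<^sub>R x) = r *\<^sub>R munit a b x"
  and munit_0 [simp]: "munit a b 0 = 0"
  by (simp_all add: vec_eq_iff)

lemma munit_times_nth: "(munit a b x ** Y) $ i $ j = (if i = a then x * Y $ b $ j else 0)"
  by (simp add: matrix_matrix_mult_def if_distrib[of "\<lambda>z. z * _"] sum.delta cong: if_cong)

lemma times_munit_nth: "(Y ** munit a b x) $ i $ j = (if j = b then Y $ i $ a * x else 0)"
  by (simp add: matrix_matrix_mult_def if_distrib[of "\<lambda>z. _ * z"] sum.delta cong: if_cong)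

lemma dmat_times_nth: "(dmat d ** Y) $ i $ j = d i * Y $ i $ j"
  by (simp add: matrix_matrix_mult_def if_distrib[of "\<lambda>z. z * _"] sum.delta cong: if_cong)

lemma times_dmat_nth: "(Y ** dmat d) $ i $ j = Y $ i $ j * d j"
  by (simp add: matrix_matrix_mult_def if_distrib[of "\<lambda>z. _ * z"] sum.delta' cong: if_cong)

lemma munit_mult: "munit a b x ** munit c d y = (if b = c then munit a d (x * y) else 0)"
  by (auto simp: vec_eq_iff munit_times_nth)

lemma dmat_munit: "dmat d ** munit a b x = munit a b (d a * x)" "munit a b x ** dmat d = munit a b (x * d b)"
  by (auto simp: vec_eq_iff dmat_times_nth times_dmat_nth)

lemma dmat_mult: "dmat c ** dmat d = dmat (\<lambda>i. c i * d i)"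
  by (auto simp: vec_eq_iff dmat_times_nth)

lemma munit_vector: "munit a b x *v v = axis a (x * v $ b)"
  by (auto simp: vec_eq_iff matrix_vector_mult_def axis_def if_distrib[of "\<lambda>z. z * _"] sum.delta cong: if_cong
      intro!: sum.neutral)

lemma dmat_vector: "dmat d *v v = (\<chi> i. d i * v $ i)"
  by (simp add: vec_eq_iff matrix_vector_mult_def if_distrib[of "\<lambda>z. z * _"] sum.delta cong: if_cong)

lemma matrix_munit_sum: "Y = (\<Sum>i\<in>UNIV. \<Sum>j\<in>UNIV. munit i j (Y $ i $ j))"
proof -
  have "(\<Sum>i\<in>UNIV. \<Sum>j\<in>UNIV. munit i j (Y $ i $ j)) $ a $ b = Y $ a $ b" for a b
  proof -
    have "(\<Sum>i\<in>UNIV. \<Sum>j\<in>UNIV. munit i j (Y $ i $ j)) $ a $ b = (\<Sum>i\<in>UNIV. if i = a then Y $ a $ b else 0)"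
      unfolding sum_component
    proof (rule sum.cong)
      show "(\<Sum>j\<in>UNIV. munit x j (Y $ x $ j) $ a $ b) = (if x = a then Y $ a $ b else 0)" for x
        by (cases "x = a") (simp_all add: sum.delta')
    qed simp
    then show ?thesis by simp
  qed
  then show ?thesis by (simp add: vec_eq_iff)
qed

lemma dmat_sum: "dmat d = (\<Sum>i\<in>UNIV. munit i i (d i))"
proof -
  have "(\<Sum>i\<in>UNIV. munit i i (d i)) $ a $ b = (\<Sum>i\<in>UNIV. if i = a then (if a = b then d a else 0) else 0)" for a b
    unfolding sum_component by (rule sum.cong) auto
  then show ?thesis
    by (simp add: vec_eq_iff)
qed

lemma bounded_linear_munit: "bounded_linear (munit a b)"
  unfolding linear_conv_bounded_linear[symmetric] by (rule linearI) (simp_all add: munit_add munit_scaleR)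

lemma matrix_exp_dmat: "matrix_exp (dmat d) = dmat (\<lambda>i. exp (d i))"
proof -
  have "((\<lambda>s. dmat (\<lambda>i. exp (s *\<^sub>R d i))) has_vector_derivative dmat d ** dmat (\<lambda>i. exp (s *\<^sub>R d i))) (at s)" for s
    unfolding dmat_mult unfolding dmat_sum
    by (intro has_vector_derivative_sum bounded_linear.has_vector_derivative[OF bounded_linear_munit]
        exp_scaleR_has_vector_derivative_left)
  then have "matrix_exp (1 *\<^sub>R dmat d) = dmat (\<lambda>i. exp (1 *\<^sub>R d i))"
    by (rule matrix_exp_unique) (simp add: mat_1_dmat)
  then show ?thesis by simp
qed

lemma matrix_exp_munit:
  assumes "a \<noteq> b"
  shows "matrix_exp (munit a b x) = mat 1 + munit a b x"
proof -
  have "munit a b x ** (mat 1 + s *\<^sub>R munit a b x) = munit a b x" for s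
    using assms by (simp add: matrix_add_ldistrib munit_scaleR[symmetric] munit_mult)
  then have "((\<lambda>s. mat 1 + s *\<^sub>R munit a b x) has_vector_derivative munit a b x ** (mat 1 + s *\<^sub>R munit a b x)) (at s)" for s
    by (auto intro!: derivative_eq_intros simp: has_vector_derivative_def)
  then have "matrix_exp (1 *\<^sub>R munit a b x) = mat 1 + 1 *\<^sub>R munit a b x"
    by (rule matrix_exp_unique) simp
  then show ?thesis by simp
qed

section \<open>Polar form of quaternions\<close>

lemma exp_scaleR_imaginary_unit:
  fixes u :: quat
  assumes "u * u = - 1"
  shows "exp (s *\<^sub>R u) = cos s *\<^sub>R 1 + sin s *\<^sub>R u"
proof (rule exp_scaleR_unique)
  show "((\<lambda>s. cos s *\<^sub>R 1 + sin s *\<^sub>R u) has_vector_derivative u * (cos s *\<^sub>R 1 + sin s *\<^sub>R u)) (at s)" for s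
    by (auto intro!: derivative_eq_intros simp: has_vector_derivative_def algebra_simps assms fun_eq_iff)
qed simp

lemma imaginary_unit_norm:
  fixes u :: quat
  assumes "u * u = - 1"
  shows "qRe u = 0" "norm u = 1"
proof -
  have "norm u * norm u = 1"
    using assms by (metis norm_minus_cancel norm_mult norm_one)
  then show n: "norm u = 1"
    by (metis abs_norm_cancel abs_square_eq_1 power2_eq_square)
  have c: "qRe u * qRe u - qI u * qI u - qJ u * qJ u - qK u * qK u = -1"
    using assms by (simp add: quat_eq_iff)
  have "(norm u)\<^sup>2 = 1" using n by simp
  then have "qRe u * qRe u + qI u * qI u + qJ u * qJ u + qK u * qK u = 1"
    by (simp add: norm_quat_def power2_eq_square)
  then have "qRe u * qRe u = 0" using c by linarith
  then show "qRe u = 0" by simp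
qed

text \<open>Every quaternion lies in a copy of the complex plane spanned by 1 and some
  \<open>u\<close>, the normalised imaginary part. For real \<open>q\<close> any imaginary unit will
  do, and i is taken.\<close>

lemma quat_imaginary_form:
  obtains u r where "u * u = - 1" "q = qRe q *\<^sub>R 1 + r *\<^sub>R u"
proof -
  define v where "v = Quat 0 (qI q) (qJ q) (qK q)"
  define u where "u = (if v = 0 then Quat 0 1 0 0 else v /\<^sub>R norm v)"
  have "u * u = - 1"
  proof (cases "v = 0")
    case False
    have "v * v = - ((norm v)\<^sup>2 *\<^sub>R 1)"
      by (simp add: v_def quat_eq_iff norm_quat_def power2_eq_square)
    moreover have "inverse (norm v) * (inverse (norm v) * (norm v * norm v)) = 1"
      using False by (simp add: field_simps)
    ultimately show ?thesis
      using False by (simp add: u_def power2_eq_square)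
  qed (simp add: u_def quat_eq_iff)
  moreover have "q = qRe q *\<^sub>R 1 + norm v *\<^sub>R u"
    by (simp add: u_def) (simp add: v_def quat_eq_iff)
  ultimately show thesis by (rule that)
qed

lemma norm_imaginary_form:
  fixes u :: quat
  assumes "u * u = - 1"
  shows "(norm (c *\<^sub>R 1 + r *\<^sub>R u))\<^sup>2 = c\<^sup>2 + r\<^sup>2"
proof -
  have "(norm (c *\<^sub>R 1 + r *\<^sub>R u))\<^sup>2 = c\<^sup>2 + r\<^sup>2 * (norm u)\<^sup>2"
    using imaginary_unit_norm(1)[OF assms] by (simp add: norm_quat_def power_mult_distrib algebra_simps)
  then show ?thesis
    using imaginary_unit_norm(2)[OF assms] by simp
qed

text \<open>Within the plane of 1 and \<open>u\<close> this is the complex logarithm: modulus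
  \<open>norm d\<close>, angle \<open>t\<close>.\<close>

lemma exp_quat_surj:
  fixes d :: quat
  assumes "d \<noteq> 0"
  obtains q where "d = exp q"
proof -
  define e where "e = d /\<^sub>R norm d"
  obtain u r where u: "u * u = - 1" and eu: "e = qRe e *\<^sub>R 1 + r *\<^sub>R u"
    using quat_imaginary_form[of e] .
  have "norm e = 1"
    using assms by (simp add: e_def)
  then have "(qRe e)\<^sup>2 + r\<^sup>2 = 1"
    using norm_imaginary_form[OF u, of "qRe e" r] eu by simp
  then obtain t where t: "qRe e = cos t" "r = sin t"
    using sincos_total_2pi by metis
  have e: "e = exp (t *\<^sub>R u)"
    using eu unfolding exp_scaleR_imaginary_unit[OF u] t .
  have "exp (of_real (ln (norm d)) + t *\<^sub>R u) = exp (of_real (ln (norm d))) * exp (t *\<^sub>R u)"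
    by (rule exp_add_commuting) (simp add: of_real_def)
  also have "\<dots> = norm d *\<^sub>R e"
    using assms by (simp add: e exp_of_real scaleR_conv_of_real)
  also have "\<dots> = d"
    using assms by (simp add: e_def)
  finally show thesis
    using that by metis
qed

section \<open>Gaussian elimination over the quaternions\<close>

lemma linear_matrix_vector_left: "linear (\<lambda>M. M *v v)" for v :: "quat ^ 'n"
  by (rule linearI) (simp_all add: matrix_vector_mult_add_rdistrib matrix_vector_scaleR)

locale elementary_semigroup =
  fixes T :: "(quat ^ 'n ^ 'n) set"
  assumes mult: "\<lbrakk>x \<in> T; y \<in> T\<rbrakk> \<Longrightarrow> x ** y \<in> T"
    and one: "mat 1 \<in> T"
    and shear: "a \<noteq> b \<Longrightarrow> mat 1 + munit a b q \<in> T"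
    and dilation: "d \<noteq> 0 \<Longrightarrow> dmat (\<lambda>i. if i = a then d else 1) \<in> T"
begin

lemma column_shear:
  assumes "finite F" "k \<notin> F"
  shows "mat 1 + (\<Sum>i\<in>F. munit i k (c i)) \<in> T"
  using assms
proof (induction F)
  case (insert i F)
  have "(\<Sum>j\<in>F. munit j k (c j)) ** munit i k (c i) = (\<Sum>j\<in>F. munit j k (c j) ** munit i k (c i))"
    by (simp add: mm.sum_left)
  also have "\<dots> = 0"
    using insert by (intro sum.neutral) (auto simp: munit_mult)
  finally have "(mat 1 + (\<Sum>j\<in>F. munit j k (c j))) ** (mat 1 + munit i k (c i))
      = mat 1 + (\<Sum>j\<in>insert i F. munit j k (c j))"
    using insert by (simp add: mm.add_left mm.add_right add.commute add.left_commute)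
  moreover have "(mat 1 + (\<Sum>j\<in>F. munit j k (c j))) ** (mat 1 + munit i k (c i)) \<in> T"
    using insert by (intro mult shear) auto
  ultimately show ?case by simp
qed (simp add: one)

text \<open>The invariant of the elimination: up to a left factor from \<open>T\<close>, the columns
  in \<open>K\<close> are already standard. The left inverse is carried along to guarantee a pivot
  for the next column.\<close>

definition reducible :: "'n set \<Rightarrow> quat ^ 'n ^ 'n \<Rightarrow> bool" where
  "reducible K g \<longleftrightarrow> (\<exists>s\<in>T. \<exists>g'. g = s ** g' \<and> (\<exists>h. h ** g' = mat 1) \<and> (\<forall>l\<in>K. g' *v axis l 1 = axis l 1))"

lemma axis_expand: "v = (\<Sum>i\<in>UNIV. axis i (v $ i))" for v :: "quat ^ 'n"
proof -
  have "(\<Sum>i\<in>UNIV. axis i (v $ i)) $ a = v $ a" for a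
    by (simp add: axis_def sum.delta' cong: if_cong)
  then show ?thesis by (simp add: vec_eq_iff)
qed

lemma matrix_vector_axis_right: "M *v axis l x = (\<chi> i. (M *v axis l 1) $ i * x)" for M :: "quat ^ 'n ^ 'n"
  by (simp add: vec_eq_iff matrix_vector_axis)

text \<open>The matrix \<open>s\<close> sends \<open>axis k 1\<close> to the column \<open>y\<close>
  and fixes the other axes, so dividing by it on the left standardises column \<open>k\<close> and
  keeps those in \<open>K\<close>. Its inverse \<open>s'\<close> is explicit because
  \<open>N ** N = 0\<close>.\<close>

lemma reduce_step:
  assumes left: "h ** g = mat 1" and K: "\<And>l. l \<in> K \<Longrightarrow> g *v axis l 1 = axis l 1" and k: "k \<notin> K"
    and nz: "(g *v axis k 1) $ k \<noteq> 0"
  shows "reducible (insert k K) g"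
proof -
  define y where "y = g *v axis k 1"
  define c where "c i = y $ i * inverse (y $ k)" for i
  define N where "N = (\<Sum>i\<in>UNIV - {k}. munit i k (c i))"
  define D where "D d = dmat (\<lambda>i. if i = k then d else (1::quat))" for d
  have yk: "y $ k \<noteq> 0" using nz by (simp add: y_def)
  have DD: "D (y $ k) ** D (inverse (y $ k)) = mat 1" "D (inverse (y $ k)) ** D (y $ k) = mat 1"
    using yk unfolding D_def dmat_mult mat_1_dmat by (auto simp: vec_eq_iff)
  have NN: "N ** N = 0"
    unfolding N_def mm.sum_left mm.sum_right by (intro sum.neutral ballI) (auto simp: munit_mult)
  have N1: "(mat 1 + N) ** (mat 1 - N) = mat 1" "(mat 1 - N) ** (mat 1 + N) = mat 1"
    by (simp_all add: mm.add_left mm.diff_right mm.diff_left mm.add_right NN)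
  define s where "s = (mat 1 + N) ** D (y $ k)"
  define s' where "s' = D (inverse (y $ k)) ** (mat 1 - N)"
  have "s ** s' = (mat 1 + N) ** (D (y $ k) ** D (inverse (y $ k))) ** (mat 1 - N)"
    unfolding s_def s'_def by (simp only: matrix_mul_assoc)
  then have ss': "s ** s' = mat 1"
    by (simp add: DD N1)
  have "mat 1 + N \<in> T"
    unfolding N_def by (rule column_shear) auto
  then have sT: "s \<in> T"
    unfolding s_def D_def using yk by (intro mult dilation)
  define g' where "g' = s' ** g"
  have g: "g = s ** g'"
    unfolding g'_def matrix_mul_assoc ss' by simp
  have hs: "(h ** s) ** g' = mat 1"
    using left by (simp add: matrix_mul_assoc[symmetric] g[symmetric])
  have Nv: "N *v v = (\<Sum>i\<in>UNIV - {k}. axis i (c i * v $ k))" for v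
  proof -
    have "N *v v = (\<Sum>i\<in>UNIV - {k}. munit i k (c i) *v v)"
      unfolding N_def by (rule linear_sum[OF linear_matrix_vector_left])
    then show ?thesis by (simp add: munit_vector)
  qed
  have l: "g' *v axis l 1 = axis l 1" if "l \<in> K" for l
  proof -
    have "l \<noteq> k" using that k by auto
    have "N *v axis l 1 = 0"
      unfolding Nv using \<open>l \<noteq> k\<close> by (intro sum.neutral) (auto simp: axis_def vec_eq_iff)
    then show ?thesis
      using K[OF that] \<open>l \<noteq> k\<close>
      by (simp add: g'_def s'_def D_def matrix_vector_mul_assoc[symmetric] matrix_vector_mult_diff_rdistrib dmat_vector)
        (auto simp: vec_eq_iff axis_def)
  qed
  have k1: "g' *v axis k 1 = axis k 1"
  proof -
    have "N *v y = (\<Sum>i\<in>UNIV - {k}. axis i (y $ i))"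
      using yk by (simp add: Nv c_def mult.assoc)
    also have "\<dots> = y - axis k (y $ k)"
      using sum.remove[of UNIV k "\<lambda>i. axis i (y $ i)"] axis_expand[of y] by (simp add: algebra_simps)
    finally have "(mat 1 - N) *v y = axis k (y $ k)"
      by (simp add: matrix_vector_mult_diff_rdistrib)
    then have "g' *v axis k 1 = D (inverse (y $ k)) *v axis k (y $ k)"
      by (simp add: g'_def s'_def matrix_vector_mul_assoc[symmetric] y_def)
    also have "\<dots> = axis k 1"
      using yk by (auto simp: D_def dmat_vector vec_eq_iff axis_def)
    finally show ?thesis .
  qed
  show ?thesis
    unfolding reducible_def using sT g hs l k1 by (metis insert_iff)
qed

lemma reducible_all:
  assumes "h ** g = mat 1" "finite K"
  shows "reducible K g"
  using assms(2)
proof (induction K)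
  case empty
  show ?case
    unfolding reducible_def using assms(1) one by (intro bexI[of _ "mat 1"] exI[of _ g]) auto
next
  case (insert k K)
  then obtain s g' h' where s: "s \<in> T" "g = s ** g'" and h': "h' ** g' = mat 1"
    and K: "\<And>l. l \<in> K \<Longrightarrow> g' *v axis l 1 = axis l 1"
    unfolding reducible_def by blast
  define y where "y = g' *v axis k 1"
  have "reducible (insert k K) g'"
  proof (cases "y $ k = 0")
    case False
    then show ?thesis
      using h' K insert by (intro reduce_step) (auto simp: y_def)
  next
    case True
    \<comment> \<open>Otherwise \<open>y\<close> would be a combination of the standard columns in
      \<open>K\<close>, so \<open>g'\<close> would kill the nonzero vector
      \<open>axis k 1 - w\<close>, against the left inverse.\<close>
    have "\<exists>j. j \<notin> K \<and> y $ j \<noteq> 0"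
    proof (rule ccontr)
      assume "\<not> ?thesis"
      then have 0: "y $ j = 0" if "j \<notin> K" for j using that by blast
      define w where "w = (\<Sum>i\<in>K. axis i (y $ i))"
      have "g' *v w = (\<Sum>i\<in>K. g' *v axis i (y $ i))"
        unfolding w_def by (rule linear_sum[OF matrix_vector_mul_linear])
      also have "\<dots> = (\<Sum>i\<in>K. axis i (y $ i))"
      proof (rule sum.cong)
        fix i assume "i \<in> K"
        then show "g' *v axis i (y $ i) = axis i (y $ i)"
          by (simp add: matrix_vector_axis_right[of g' i "y $ i"] K) (simp add: vec_eq_iff axis_def)
      qed simp
      also have "\<dots> = (\<Sum>i\<in>UNIV. axis i (y $ i))"
        by (rule sum.mono_neutral_left) (auto simp: 0)
      also have "\<dots> = y"
        by (rule axis_expand[symmetric])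
      finally have "g' *v (axis k 1 - w) = 0"
        by (simp add: y_def matrix_vector_mult_diff_distrib)
      then have "h' *v (g' *v (axis k 1 - w)) = 0"
        by simp
      then have "axis k 1 = w"
        by (simp add: matrix_vector_mul_assoc h')
      moreover have "w $ k = 0"
        using insert by (simp add: w_def axis_def)
      ultimately show False
        by (metis axis_nth zero_neq_one)
    qed
    then obtain j where j: "j \<notin> K" "y $ j \<noteq> 0" by blast
    have jk: "j \<noteq> k" using True j by auto
    \<comment> \<open>Adding row \<open>j\<close> to row \<open>k\<close> creates the nonzero pivot
      \<open>y $ j\<close> in place \<open>k\<close>; the columns in \<open>K\<close> vanish in row
      \<open>j\<close> and are not disturbed.\<close>
    define e where "e z = mat 1 + munit k j z" for z
    define g2 where "g2 = e 1 ** g'"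
    have ee: "e (- 1) ** e 1 = mat 1" "e 1 ** e (- 1) = mat 1"
      using jk by (simp_all add: e_def mm.add_left mm.add_right mm.diff_left mm.diff_right munit_mult munit_minus)
    have g': "g' = e (- 1) ** g2"
      unfolding g2_def matrix_mul_assoc ee by simp
    have ev: "e 1 *v v = v + axis k (v $ j)" for v
      by (simp add: e_def matrix_vector_mult_add_rdistrib munit_vector)
    have "reducible (insert k K) g2"
    proof (rule reduce_step)
      show "(h' ** e (- 1)) ** g2 = mat 1"
        using h' by (simp add: matrix_mul_assoc[symmetric] g'[symmetric])
      show "g2 *v axis l 1 = axis l 1" if "l \<in> K" for l
      proof -
        have "g2 *v axis l 1 = axis l 1 + axis k (axis l 1 $ j)"
          using K[OF that] by (simp add: g2_def matrix_vector_mul_assoc[symmetric] ev)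
        moreover have "j \<noteq> l" using that j by auto
        ultimately show ?thesis by (simp add: axis_def vec_eq_iff)
      qed
      show "(g2 *v axis k 1) $ k \<noteq> 0"
        using True j by (simp add: g2_def matrix_vector_mul_assoc[symmetric] ev y_def[symmetric])
    qed (use insert in auto)
    then obtain s2 g3 where "s2 \<in> T" "g2 = s2 ** g3" "\<exists>h. h ** g3 = mat 1" "\<forall>l\<in>insert k K. g3 *v axis l 1 = axis l 1"
      unfolding reducible_def by blast
    moreover from this have "g' = (e (- 1) ** s2) ** g3"
      by (simp add: g' matrix_mul_assoc)
    moreover have "e (- 1) ** s2 \<in> T"
      using jk \<open>s2 \<in> T\<close> unfolding e_def by (intro mult shear) auto
    ultimately show ?thesis
      unfolding reducible_def by blast
  qed
  then obtain s2 g3 where "s2 \<in> T" "g' = s2 ** g3" "\<exists>h. h ** g3 = mat 1" "\<forall>l\<in>insert k K. g3 *v axis l 1 = axis l 1"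
    unfolding reducible_def by blast
  moreover from this have "g = (s ** s2) ** g3"
    by (simp add: s matrix_mul_assoc)
  ultimately show ?case
    unfolding reducible_def using s mult by blast
qed

lemma invertible_mem:
  assumes "h ** g = mat 1"
  shows "g \<in> T"
proof -
  obtain s g' where s: "s \<in> T" "g = s ** g'" and g': "\<And>l. g' *v axis l 1 = axis l 1"
    using reducible_all[OF assms, of UNIV] unfolding reducible_def by auto
  have "g' $ i $ l = mat 1 $ i $ l" for i l
  proof -
    have "g' $ i $ l = (g' *v axis l 1) $ i"
      by (simp add: matrix_vector_axis)
    then show ?thesis
      unfolding g' by (simp add: mat_def axis_def)
  qed
  then have "g' = mat 1"
    by (simp add: vec_eq_iff)
  then show ?thesis using s by simp
qed

end

text \<open>Shears are exponentials of nilpotent matrix units, dilations are exponentials because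
  \<open>exp\<close> reaches every nonzero quaternion, and elimination does the rest. It serves both
  the closed semigroup of a good pair and the reachable sets of perturbed pairs.\<close>

lemma semigroup_exp_imp_invertible:
  fixes T :: "(quat ^ 'n ^ 'n) set"
  assumes mult: "\<And>x y. \<lbrakk>x \<in> T; y \<in> T\<rbrakk> \<Longrightarrow> x ** y \<in> T"
    and exp: "\<And>X. matrix_exp X \<in> T"
  shows "{g. invertible g} \<subseteq> T"
proof -
  interpret elementary_semigroup T
  proof
    show "mat 1 \<in> T"
      using exp[of 0] by simp
    show "mat 1 + munit a b x \<in> T" if "a \<noteq> b" for a b :: 'n and x
      using exp[of "munit a b x"] by (simp add: matrix_exp_munit that)
    show "dmat (\<lambda>i. if i = a then d else 1) \<in> T" if d0: "d \<noteq> 0" for a :: 'n and d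
    proof -
      obtain q where "d = exp q"
        by (rule exp_quat_surj[OF d0])
      then have "dmat (\<lambda>i. if i = a then d else 1) = matrix_exp (dmat (\<lambda>i. if i = a then q else 0))"
        unfolding matrix_exp_dmat by (auto simp: vec_eq_iff)
      then show ?thesis using exp by simp
    qed
  qed (rule mult)
  show ?thesis
    using invertible_mem by (auto simp: invertible_def)
qed

section \<open>The determinant of an exponential\<close>

lemma det_deriv_at_one:
  fixes A :: "real \<Rightarrow> real ^ 'm ^ 'm"
  assumes D: "\<And>i j. ((\<lambda>t. A t $ i $ j) has_real_derivative D i j) (at 0)" and A0: "A 0 = mat 1"
  shows "((\<lambda>t. det (A t)) has_real_derivative (\<Sum>i\<in>UNIV. D i i)) (at 0)"
proof -
  let ?P = "{p. p permutes (UNIV :: 'm set)}"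
  define c where "c p = (\<Sum>i\<in>UNIV. D i (p i) * (\<Prod>j\<in>UNIV - {i}. A 0 $ j $ p j))" for p
  have prod: "((\<lambda>t. \<Prod>i\<in>UNIV. A t $ i $ p i) has_real_derivative c p) (at 0)" for p
  proof -
    have "((\<lambda>t. \<Prod>i\<in>UNIV. A t $ i $ p i) has_derivative
        (\<lambda>y. \<Sum>i\<in>UNIV. (D i (p i) * y) * (\<Prod>j\<in>UNIV - {i}. A 0 $ j $ p j))) (at 0)"
      by (rule has_derivative_prod) (use D in \<open>simp add: has_field_derivative_def\<close>)
    moreover have "(\<lambda>y. \<Sum>i\<in>UNIV. (D i (p i) * y) * (\<Prod>j\<in>UNIV - {i}. A 0 $ j $ p j)) = (*) (c p)"
      by (rule ext) (simp add: c_def sum_distrib_left sum_distrib_right mult_ac)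
    ultimately show ?thesis
      by (simp add: has_field_derivative_def)
  qed
  have "((\<lambda>t. det (A t)) has_real_derivative (\<Sum>p\<in>?P. of_int (sign p) * c p)) (at 0)"
    unfolding det_def by (intro DERIV_sum DERIV_cmult prod)
  moreover have "(\<Sum>p\<in>?P. of_int (sign p) * c p) = (\<Sum>p\<in>{id}. of_int (sign p) * c p)"
  proof (rule sum.mono_neutral_right)
    show "\<forall>p\<in>?P - {id}. of_int (sign p) * c p = 0"
    proof
      fix p assume p: "p \<in> ?P - {id}"
      then obtain a where a: "p a \<noteq> a" by (auto simp: fun_eq_iff)
      \<comment> \<open>A permutation other than the identity moves both \<open>a\<close> and
        \<open>p a\<close>, so even with one index left out each product keeps a vanishing
        off-diagonal factor.\<close>
      then have pa: "p (p a) \<noteq> p a"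
        using p by (metis (mono_tags) DiffD1 mem_Collect_eq permutes_inj inj_eq)
      have "(\<Prod>j\<in>UNIV - {i}. A 0 $ j $ p j) = 0" for i
      proof (cases "a = i")
        case True
        then show ?thesis
          using a pa by (intro prod_zero) (auto simp: A0 mat_def intro!: bexI[of _ "p a"])
      next
        case False
        then show ?thesis
          using a by (intro prod_zero) (auto simp: A0 mat_def intro!: bexI[of _ a])
      qed
      then show "of_int (sign p) * c p = 0"
        by (simp only: c_def mult_zero_right sum.neutral_const)
    qed
  qed (auto simp: permutes_id)
  moreover have "(\<Sum>p\<in>{id}. of_int (sign p) * c p) = (\<Sum>i\<in>UNIV. D i i)"
    by (simp add: c_def A0 mat_def sign_id)
  ultimately show ?thesis by simp
qed

section \<open>The real determinant along one-parameter groups\<close>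

definition real_entry :: "'n \<times> 4 \<Rightarrow> 'n \<times> 4 \<Rightarrow> quat ^ 'n ^ 'n \<Rightarrow> real" where
  "real_entry p q g = real_coords (g *v of_real_coords (axis q 1)) $ p"

lemma real_det_entries: "real_det g = det (\<chi> p q. real_entry p q g)"
  by (simp add: real_det_def matrix_def real_entry_def)

lemma bounded_linear_real_entry: "bounded_linear (real_entry p q)"
  unfolding linear_conv_bounded_linear[symmetric] real_entry_def
  by (rule linearI)
    (simp_all add: matrix_vector_mult_add_rdistrib matrix_vector_scaleR
      linear_add[OF linear_real_coords] linear_scale[OF linear_real_coords])

lemma qRe_sum: "qRe (sum f A) = (\<Sum>i\<in>A. qRe (f i))"
  by (induction A rule: infinite_finite_induct) simp_all

text \<open>Left multiplication by a quaternion has, in each of its four real coordinates, the real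
  part as diagonal entry.\<close>

lemma real_entry_trace:
  fixes X :: "quat ^ 'n ^ 'n"
  shows "(\<Sum>p\<in>UNIV. real_entry p p X) = 4 * qRe (trace X)"
proof -
  have ax: "of_real_coords (axis (i, 1) 1) = axis i (Quat 1 0 0 0)" "of_real_coords (axis (i, 2) 1) = axis i (Quat 0 1 0 0)"
    "of_real_coords (axis (i, 3) 1) = axis i (Quat 0 0 1 0)" "of_real_coords (axis (i, 4) 1) = axis i (Quat 0 0 0 1)" for i :: 'n
    by (auto simp: of_real_coords_def vec_eq_iff axis_def quat_eq_iff)
  have ent: "real_entry (i, a) (i, a) X = qRe (X $ i $ i)" for i a
  proof -
    have "a = 1 \<or> a = 2 \<or> a = 3 \<or> a = 4" by (rule exhaust_4)
    then show ?thesis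
      by (elim disjE) (simp_all add: real_entry_def ax matrix_vector_axis)
  qed
  have "(\<Sum>p\<in>UNIV. real_entry p p X) = (\<Sum>i\<in>UNIV. \<Sum>a\<in>(UNIV :: 4 set). real_entry (i, a) (i, a) X)"
    by (simp add: sum.cartesian_product case_prod_unfold UNIV_Times_UNIV[symmetric] del: UNIV_Times_UNIV)
  also have "\<dots> = 4 * (\<Sum>i\<in>UNIV. qRe (X $ i $ i))"
    by (simp add: ent sum_distrib_left)
  also have "(\<Sum>i\<in>UNIV. qRe (X $ i $ i)) = qRe (trace X)"
    by (simp add: trace_def qRe_sum)
  finally show ?thesis .
qed

lemma invertible_matrix_exp: "invertible (matrix_exp X)" for X :: "quat ^ 'n ^ 'n"
  unfolding invertible_def using matrix_exp_minus by blast

text \<open>The function \<open>f\<close> is multiplicative along the one-parameter group and its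
  derivative at 0 is the real trace, here zero. Hence its derivative vanishes everywhere.\<close>

lemma real_det_exp:
  fixes X :: "quat ^ 'n ^ 'n"
  assumes "X \<in> sl_H"
  shows "real_det (matrix_exp X) = 1"
proof -
  define f where "f t = real_det (matrix_exp (t *\<^sub>R X))" for t
  have f_add: "f (s + t) = f s * f t" for s t
    by (simp add: f_def matrix_exp_add_scaleR real_det_mult)
  have "((\<lambda>t. real_entry p q (matrix_exp (t *\<^sub>R X))) has_real_derivative real_entry p q X) (at 0)" for p q
    using bounded_linear.has_vector_derivative[OF bounded_linear_real_entry matrix_exp_deriv[of X 0], of p q]
    by (simp add: has_real_derivative_iff_has_vector_derivative)
  then have "((\<lambda>t. det (\<chi> p q. real_entry p q (matrix_exp (t *\<^sub>R X)))) has_real_derivative (\<Sum>p\<in>UNIV. real_entry p p X)) (at 0)"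
  proof (rule det_deriv_at_one[of "\<lambda>t. \<chi> p q. real_entry p q (matrix_exp (t *\<^sub>R X))", simplified vec_lambda_beta])
    show "(\<chi> p q. real_entry p q (matrix_exp (0 *\<^sub>R X))) = mat 1"
    proof -
      have "real_entry p q (mat 1 :: quat ^ 'n ^ 'n) = mat 1 $ p $ q" for p q
        by (simp add: real_entry_def, simp add: mat_def axis_def)
      then show ?thesis by (simp add: vec_eq_iff)
    qed
  qed
  then have "(f has_real_derivative 0) (at 0)"
    using assms by (simp add: f_def[abs_def] real_det_entries real_entry_trace sl_H_def)
  then have "((\<lambda>h. f h * f s) has_real_derivative 0 * f s) (at 0)" for s
    by (rule DERIV_cmult_right)
  then have "(f has_real_derivative 0) (at s)" for s
    using DERIV_shift[of f 0 0 s] by (simp add: f_add)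
  then have "f 1 = f 0"
    using DERIV_isconst_all[of f 1 0] by blast
  then show ?thesis
    by (simp add: f_def real_det_mat_1)
qed

lemma control_semigroup_subset_SL:
  assumes "A \<in> sl_H" "B \<in> sl_H"
  shows "control_semigroup A B \<subseteq> SL_H"
proof
  fix g assume "g \<in> control_semigroup A B"
  then show "g \<in> SL_H"
  proof induction
    case (generator t u)
    have "t *\<^sub>R (A + u *\<^sub>R B) \<in> sl_H"
      using assms by (simp add: sl_H_def trace_def qRe_sum sum.distrib sum_distrib_left[symmetric])
    then show ?case
      by (simp add: SL_H_def invertible_matrix_exp real_det_exp)
  next
    case (mult g h)
    then obtain g' h' where "g ** g' = mat 1" "g' ** g = mat 1" "h ** h' = mat 1" "h' ** h = mat 1"
      by (auto simp: SL_H_def invertible_def)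
    then have "(g ** h) ** (h' ** g') = mat 1" "(h' ** g') ** (g ** h) = mat 1"
      by (metis matrix_mul_assoc matrix_mul_rid)+
    then show ?case
      using mult by (auto simp: SL_H_def invertible_def real_det_mult)
  qed
qed

lemma real_det_scaleR: "real_det (r *\<^sub>R g) = r ^ (CARD('n) * 4) * real_det g" for g :: "quat ^ 'n ^ 'n"
proof -
  have "real_entry p q (r *\<^sub>R g) = r * real_entry p q g" for p q
    by (simp add: real_entry_def matrix_vector_scaleR linear_scale[OF linear_real_coords])
  then have "(\<chi> p q. real_entry p q (r *\<^sub>R g)) = mat r ** (\<chi> p q. real_entry p q g)"
    by (simp add: vec_eq_iff matrix_matrix_mult_def mat_def if_distrib[of "\<lambda>z. z * _"] sum.delta cong: if_cong)
  moreover have "det (mat r :: real ^ ('n \<times> 4) ^ ('n \<times> 4)) = r ^ CARD('n \<times> 4)"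
    using det_matrix_scaleR[of r, where 'n = "'n \<times> 4"] by (simp add: matrix_scaleR)
  ultimately show ?thesis
    by (simp add: real_det_entries det_mul)
qed

section \<open>Controllability up to closure\<close>

lemma subspace_munit:
  assumes "subspace V"
  shows "subspace {x. munit a b x \<in> V}"
  using assms by (auto simp: subspace_def munit_add munit_scaleR)

text \<open>Using \<open>comm\<close> for the pairs \<open>x\<close>, \<open>y\<close> and
  \<open>y * x\<close>, 1 cancels the block at \<open>b\<close> and leaves a commutator at
  \<open>a\<close>. Commutators of i, j, k span the imaginary quaternions.\<close>

lemma imaginary_munit:
  assumes V: "subspace V" and comm: "\<And>x y. munit a a (x * y) - munit b b (y * x) \<in> V" and c: "qRe c = 0"
  shows "munit a a c \<in> V"
proof -
  have 1: "munit a a (x * y - y * x) \<in> V" for x y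
  proof -
    have "munit a a (x * y - y * x) = (munit a a (x * y) - munit b b (y * x)) - (munit a a (y * x * 1) - munit b b (1 * (y * x)))"
      by (simp add: munit_diff)
    then show ?thesis
      using subspace_diff[OF V comm[of x y] comm[of "y * x" 1]] by simp
  qed
  define i j k where "i = Quat 0 1 0 0" and "j = Quat 0 0 1 0" and "k = Quat 0 0 0 1"
  have "c = (qI c / 2) *\<^sub>R (j * k - k * j) + (qJ c / 2) *\<^sub>R (k * i - i * k) + (qK c / 2) *\<^sub>R (i * j - j * i)"
    using c by (simp add: quat_eq_iff i_def j_def k_def)
  then have "munit a a c = (qI c / 2) *\<^sub>R munit a a (j * k - k * j) + (qJ c / 2) *\<^sub>R munit a a (k * i - i * k)
      + (qK c / 2) *\<^sub>R munit a a (i * j - j * i)"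
    by (simp only: munit_add[symmetric] munit_scaleR[symmetric])
  then show ?thesis
    using V by (simp only:) (intro subspace_add subspace_scale 1)
qed

text \<open>Closing step for both the edge and the tangent space: brackets of off-diagonal units
  give everything with zero real trace, and \<open>mat 1\<close> supplies the remaining
  direction.\<close>

lemma subspace_munits_UNIV:
  fixes V :: "(quat ^ 'n ^ 'n) set"
  assumes V: "subspace V" and card: "CARD('n) \<ge> 2" and off: "\<And>a b x. a \<noteq> b \<Longrightarrow> munit a b x \<in> V"
    and comm: "\<And>a b x y. a \<noteq> b \<Longrightarrow> munit a a (x * y) - munit b b (y * x) \<in> V" and one: "mat 1 \<in> V"
  shows "V = UNIV"
proof -
  have diag: "munit a a x \<in> V" for a x
  proof -
    have "\<exists>b. a \<noteq> b"
    proof (rule ccontr)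
      assume "\<not> (\<exists>b. a \<noteq> b)"
      then have "UNIV = {a}" by auto
      then have "CARD('n) = card {a}" by simp
      then show False using card by simp
    qed
    then obtain b where b: "a \<noteq> b" by blast
    have im: "munit a a c \<in> V" if "qRe c = 0" for c
      using imaginary_munit[OF V comm[OF b] that] .
    have "munit a a 1 \<in> V"
    proof -
      \<comment> \<open>Summing over all \<open>b\<close> cancels \<open>mat 1\<close> and isolates
        a real multiple of \<open>munit a a 1\<close>; the term with \<open>b = a\<close> is
        zero.\<close>
      have "mat 1 + (\<Sum>b\<in>UNIV. munit a a 1 - munit b b 1) = real CARD('n) *\<^sub>R munit a a 1"
        by (simp add: mat_1_dmat dmat_sum sum_subtractf sum_constant_scaleR del: sum_constant)
      moreover have "mat 1 + (\<Sum>b\<in>UNIV. munit a a 1 - munit b b 1) \<in> V"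
      proof (intro subspace_add[OF V one] subspace_sum[OF V])
        show "munit a a 1 - munit b b 1 \<in> V" for b
          using comm[of a b 1 1] subspace_0[OF V] by (cases "a = b") auto
      qed
      ultimately have "inverse (real CARD('n)) *\<^sub>R (real CARD('n) *\<^sub>R munit a a 1) \<in> V"
        using V by (metis subspace_scale)
      then show ?thesis by simp
    qed
    moreover have "munit a a x = qRe x *\<^sub>R munit a a 1 + munit a a (Quat 0 (qI x) (qJ x) (qK x))"
      by (simp only: munit_add[symmetric] munit_scaleR[symmetric]) (simp add: quat_eq_iff vec_eq_iff)
    ultimately show ?thesis
      using im V by (simp add: subspace_add subspace_scale)
  qed
  have "Y \<in> V" for Y
  proof -
    have "(\<Sum>i\<in>UNIV. \<Sum>j\<in>UNIV. munit i j (Y $ i $ j)) \<in> V"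
    proof (intro subspace_sum[OF V])
      show "munit i j (Y $ i $ j) \<in> V" for i j
        using off diag by (cases "i = j") auto
    qed
    then show ?thesis
      using matrix_munit_sum[of Y] by simp
  qed
  then show ?thesis by blast
qed

text \<open>The imaginary part contributes a factor of norm one, so real parts alone decide which
  entry of a conjugated matrix grows fastest.\<close>

lemma norm_exp_quat: "norm (exp q) = exp (qRe q)" for q :: quat
proof -
  obtain u r where u: "u * u = - 1" and q: "q = qRe q *\<^sub>R 1 + r *\<^sub>R u"
    using quat_imaginary_form[of q] .
  have "exp (qRe q *\<^sub>R 1 + r *\<^sub>R u) = exp (qRe q *\<^sub>R 1) * exp (r *\<^sub>R u)"
    by (rule exp_add_commuting) simp
  then have "norm (exp q) = norm (exp (qRe q *\<^sub>R 1 :: quat)) * norm (exp (r *\<^sub>R u))"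
    using q by (metis norm_mult)
  also have "exp (qRe q *\<^sub>R 1 :: quat) = of_real (exp (qRe q))"
    by (metis exp_of_real of_real_def)
  also have "norm (exp (r *\<^sub>R u)) = 1"
  proof -
    have "(norm (exp (r *\<^sub>R u)))\<^sup>2 = 1"
      by (simp add: exp_scaleR_imaginary_unit[OF u] norm_imaginary_form[OF u])
    then show ?thesis
      by (metis abs_norm_cancel abs_square_eq_1)
  qed
  finally show ?thesis by simp
qed

text \<open>For each \<open>l\<close> other than \<open>k\<close>, a real quadratic polynomial in
  the diagonal operator kills coordinate \<open>l\<close> and is injective on coordinate
  \<open>k\<close>; applying these in turn isolates coordinate \<open>k\<close>. The polynomials
  have to be real because \<open>U\<close> is only a real subspace.\<close>

lemma separate_coordinates:
  fixes f :: "'n::finite \<Rightarrow> quat \<Rightarrow> quat"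
  assumes U: "subspace U" and lin: "\<And>l. linear (f l)"
    and inv: "\<And>v. v \<in> U \<Longrightarrow> (\<chi> l. f l (v $ l)) \<in> U"
    and poly: "\<And>l. l \<noteq> k \<Longrightarrow> \<exists>\<alpha> \<beta>. (\<forall>x. f l (f l x) + \<alpha> *\<^sub>R f l x + \<beta> *\<^sub>R x = 0)
      \<and> (\<forall>x. x \<noteq> 0 \<longrightarrow> f k (f k x) + \<alpha> *\<^sub>R f k x + \<beta> *\<^sub>R x \<noteq> 0)"
    and v: "v \<in> U" "v $ k \<noteq> 0"
  obtains c where "c \<noteq> 0" "axis k c \<in> U"
proof -
  have "\<exists>w\<in>U. w $ k \<noteq> 0 \<and> (\<forall>l\<in>L. w $ l = 0)" if "finite L" "k \<notin> L" for L
    using that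
  proof (induction L)
    case empty
    then show ?case using v by blast
  next
    case (insert l L)
    then obtain w where w: "w \<in> U" "w $ k \<noteq> 0" "\<And>m. m \<in> L \<Longrightarrow> w $ m = 0" by auto
    obtain \<alpha> \<beta> where ab: "\<And>x. f l (f l x) + \<alpha> *\<^sub>R f l x + \<beta> *\<^sub>R x = 0"
      "\<And>x. x \<noteq> 0 \<Longrightarrow> f k (f k x) + \<alpha> *\<^sub>R f k x + \<beta> *\<^sub>R x \<noteq> 0"
      using poly[of l] insert by auto
    define T where "T v = (\<chi> l. f l (v $ l))" for v
    define w' where "w' = T (T w) + \<alpha> *\<^sub>R T w + \<beta> *\<^sub>R w"
    have nth: "w' $ m = f m (f m (w $ m)) + \<alpha> *\<^sub>R f m (w $ m) + \<beta> *\<^sub>R w $ m" for m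
      by (simp add: w'_def T_def)
    have "w' \<in> U"
      unfolding w'_def T_def using w(1) by (intro subspace_add[OF U] subspace_scale[OF U] inv)
    moreover have "w' $ k \<noteq> 0"
      unfolding nth using ab(2) w(2) by blast
    moreover have "w' $ m = 0" if "m \<in> insert l L" for m
      using that ab(1) w(3) by (auto simp: nth linear_0[OF lin])
    ultimately show ?case by blast
  qed
  from this[of "UNIV - {k}"] obtain w where w: "w \<in> U" "w $ k \<noteq> 0" "\<And>l. l \<noteq> k \<Longrightarrow> w $ l = 0" by auto
  then have "axis k (w $ k) = w"
    by (auto simp: vec_eq_iff axis_def)
  then show thesis
    using w that by metis
qed

section \<open>Sylvester operators on the quaternions\<close>

definition complex_quat :: "quat \<Rightarrow> bool" where
  "complex_quat x \<longleftrightarrow> qJ x = 0 \<and> qK x = 0"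

lemma complex_quat_annihilator:
  assumes "complex_quat m"
  shows "m * m + (- 2 * qRe m) *\<^sub>R m + ((qRe m)\<^sup>2 + (qI m)\<^sup>2) *\<^sub>R 1 = 0"
  using assms by (simp add: complex_quat_def quat_eq_iff power2_eq_square algebra_simps)

text \<open>The quadratic has the roots \<open>m\<close> and its conjugate, which share the real
  part of \<open>m\<close>.\<close>

lemma complex_quat_separated:
  assumes "complex_quat l" "qRe l \<noteq> qRe m"
  shows "l * l + (- 2 * qRe m) *\<^sub>R l + ((qRe m)\<^sup>2 + (qI m)\<^sup>2) *\<^sub>R 1 \<noteq> 0"
proof
  assume eq: "l * l + (- 2 * qRe m) *\<^sub>R l + ((qRe m)\<^sup>2 + (qI m)\<^sup>2) *\<^sub>R 1 = 0"
  have im: "2 * qI l * (qRe l - qRe m) = 0"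
    using eq assms(1) by (simp add: complex_quat_def quat_eq_iff algebra_simps)
  then have "qI l = 0" using assms(2) by simp
  then have "(qRe l - qRe m)\<^sup>2 + (qI m)\<^sup>2 = 0"
    using eq assms(1) by (simp add: complex_quat_def quat_eq_iff power2_eq_square algebra_simps)
  then show False
    using assms(2) by (simp add: sum_power2_eq_zero_iff)
qed

text \<open>The map \<open>x \<mapsto> \<lambda> x - x \<mu>\<close> acts on \<open>\<complex>\<close> and on \<open>\<complex> j\<close> with the distinct
  frequencies \<open>b - b'\<close> and \<open>b + b'\<close>, so a single generic vector generates all of \<open>\<complex> + \<complex> j\<close>.\<close>

lemma sylvester_orbit_UNIV:
  assumes U: "subspace U" and inv: "\<And>x. x \<in> U \<Longrightarrow> l * x - x * m \<in> U"
    and cx: "complex_quat l" "complex_quat m" and nz: "qI l \<noteq> 0" "qI m \<noteq> 0" "qI l \<noteq> qI m" "qI l \<noteq> - qI m"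
    and x: "x \<in> U" "qRe x \<noteq> 0" "qJ x \<noteq> 0"
  shows "U = UNIV"
proof -
  define b b' where "b = qI l" and "b' = qI m"
  \<comment> \<open>The operator with its real scalar part removed: a multiple of left
    multiplication by i on each of the two planes.\<close>
  define L where "L y = Quat (- (b - b') * qI y) ((b - b') * qRe y) (- (b + b') * qK y) ((b + b') * qJ y)" for y
  have L: "L y \<in> U" if "y \<in> U" for y
  proof -
    have "L y = (l * y - y * m) - (qRe l - qRe m) *\<^sub>R y"
      using cx by (simp add: L_def quat_eq_iff complex_quat_def b_def b'_def algebra_simps)
    then show ?thesis
      using that by (simp add: subspace_diff[OF U] subspace_scale[OF U] inv)
  qed
  have z: "Quat (qRe x) (qI x) 0 0 \<in> U"
  proof -
    \<comment> \<open>The square of \<open>L\<close> is minus the squared frequency on each plane,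
      so this combination kills the second plane and multiplies the first by
      \<open>(b + b')\<^sup>2 - (b - b')\<^sup>2 = 4 * b * b'\<close>.\<close>
    have "Quat (qRe x) (qI x) 0 0 = (1 / (4 * b * b')) *\<^sub>R (L (L x) + (b + b')\<^sup>2 *\<^sub>R x)"
      using nz by (simp add: L_def quat_eq_iff b_def b'_def power2_eq_square field_simps)
    then show ?thesis
      using x L by (simp add: subspace_add[OF U] subspace_scale[OF U])
  qed
  have w: "Quat 0 0 (qJ x) (qK x) \<in> U"
  proof -
    have "Quat 0 0 (qJ x) (qK x) = x - Quat (qRe x) (qI x) 0 0"
      by (simp add: quat_eq_iff)
    then show ?thesis
      using x z by (simp add: subspace_diff[OF U])
  qed
  have "y \<in> U" for y
  proof -
    define N M where "N = (qRe x)\<^sup>2 + (qI x)\<^sup>2" and "M = (qJ x)\<^sup>2 + (qK x)\<^sup>2"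
    have NM: "N \<noteq> 0" "M \<noteq> 0"
      using x by (simp_all add: N_def M_def sum_power2_eq_zero_iff)
    have bb: "b - b' \<noteq> 0" "b + b' \<noteq> 0"
      using nz by (simp_all add: b_def b'_def)
    \<comment> \<open>Complex division: \<open>r\<close> and \<open>s\<close> are the real and
      imaginary part of the quotient of the first-plane components of \<open>y\<close> and
      \<open>x\<close>; \<open>r'\<close> and \<open>s'\<close> do the same in the second
      plane.\<close>
    define r s where "r = (qRe x * qRe y + qI x * qI y) / N" and "s = (qRe x * qI y - qI x * qRe y) / N"
    define r' s' where "r' = (qJ x * qJ y + qK x * qK y) / M" and "s' = (qJ x * qK y - qK x * qJ y) / M"
    have 1: "r * qRe x - s * qI x = qRe y" "r * qI x + s * qRe x = qI y"
      using NM(1) unfolding r_def s_def by (simp_all add: field_simps) (simp_all add: N_def power2_eq_square algebra_simps)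
    have 2: "r' * qJ x - s' * qK x = qJ y" "r' * qK x + s' * qJ x = qK y"
      using NM(2) unfolding r'_def s'_def by (simp_all add: field_simps) (simp_all add: M_def power2_eq_square algebra_simps)
    have "y = r *\<^sub>R Quat (qRe x) (qI x) 0 0 + (s / (b - b')) *\<^sub>R L (Quat (qRe x) (qI x) 0 0)
      + r' *\<^sub>R Quat 0 0 (qJ x) (qK x) + (s' / (b + b')) *\<^sub>R L (Quat 0 0 (qJ x) (qK x))"
    proof -
      have "s / (b - b') * (- (b - b') * t) = - (s * t)" "s / (b - b') * ((b - b') * t) = s * t"
        "s' / (b + b') * (- (b + b') * t) = - (s' * t)" "s' / (b + b') * ((b + b') * t) = s' * t" for t
        using bb by (simp_all add: field_simps)
      then show ?thesis
        using 1 2 by (simp only: quat_eq_iff L_def plus_quat.sel scaleR_quat.sel quat.sel) simp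
    qed
    moreover have "\<dots> \<in> U"
      by (intro subspace_add[OF U] subspace_scale[OF U] L z w)
    ultimately show ?thesis by simp
  qed
  then show ?thesis by blast
qed

text \<open>As \<open>\<zeta>\<close> is 1 or -1, \<open>\<zeta> ^ m\<close> is its own inverse, so
  forward and backward exponentials carry the same sign.\<close>

lemma exp_real_multiple:
  fixes x :: quat
  assumes T: "exp (T *\<^sub>R x) = (\<zeta> * exp (T * qRe x)) *\<^sub>R 1" and z: "\<zeta>\<^sup>2 = 1"
  shows "exp ((real m * T) *\<^sub>R x) = (\<zeta> ^ m * exp (real m * T * qRe x)) *\<^sub>R 1"
    and "exp (- (real m * T) *\<^sub>R x) = (\<zeta> ^ m * exp (- (real m * T * qRe x))) *\<^sub>R 1"
proof -
  define r where "r = \<zeta> ^ m * exp (real m * T * qRe x)"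
  have pow: "(c *\<^sub>R (1::quat)) ^ m = c ^ m *\<^sub>R 1" for c
    by (induction m) simp_all
  have "exp ((real m * T) *\<^sub>R x) = exp (T *\<^sub>R x) ^ m"
    by (simp add: exp_scaleR_power)
  also have "\<dots> = r *\<^sub>R 1"
    unfolding T pow by (simp add: r_def power_mult_distrib exp_of_nat_mult[symmetric] mult.assoc)
  finally show 1: "exp ((real m * T) *\<^sub>R x) = (\<zeta> ^ m * exp (real m * T * qRe x)) *\<^sub>R 1"
    by (simp only: r_def)
  have zz: "\<zeta> ^ m * \<zeta> ^ m = 1"
    using z by (simp add: power_mult_distrib[symmetric] power2_eq_square)
  have inv: "\<zeta> ^ m * exp (- (real m * T * qRe x)) * r = 1"
  proof -
    have "\<zeta> ^ m * exp (- (real m * T * qRe x)) * r = (\<zeta> ^ m * \<zeta> ^ m) * (exp (- (real m * T * qRe x)) * exp (real m * T * qRe x))"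
      by (simp add: r_def)
    then show ?thesis by (simp add: zz exp_add[symmetric])
  qed
  have "r *\<^sub>R exp (- ((real m * T) *\<^sub>R x)) = 1"
    using exp_minus_inverse[of "(real m * T) *\<^sub>R x"] 1 by (simp add: r_def)
  then have "(\<zeta> ^ m * exp (- (real m * T * qRe x)) * r) *\<^sub>R exp (- ((real m * T) *\<^sub>R x)) = (\<zeta> ^ m * exp (- (real m * T * qRe x))) *\<^sub>R 1"
    by (simp only: scaleR_scaleR[symmetric])
  then show "exp (- (real m * T) *\<^sub>R x) = (\<zeta> ^ m * exp (- (real m * T * qRe x))) *\<^sub>R 1"
    unfolding inv by simp
qed

text \<open>By \<open>half_period\<close>, conjugation by the exponential of
  \<open>T *\<^sub>R dmat lam\<close> multiplies the \<open>(p, q)\<close> entry by a negative real.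
  The assumptions \<open>freq\<close> and \<open>entries\<close> are what
  \<open>sylvester_orbit_UNIV\<close> needs at the two corners; \<open>real_parts\<close> serves to
  tell the other coordinates apart.\<close>

locale good_pair = closed_matrix_semigroup S for S :: "(quat ^ 'n ^ 'n) set" +
  fixes A :: "quat ^ 'n ^ 'n" and lam :: "'n \<Rightarrow> quat" and p q :: 'n and T \<eta> :: real
  assumes drift: "A \<in> mwedge S" and control: "dmat lam \<in> medge S" and scalars: "mat 1 \<in> medge S"
    and complex: "\<And>i. complex_quat (lam i)"
    and real_parts: "\<And>i j. i \<noteq> j \<Longrightarrow> qRe (lam i) \<noteq> qRe (lam j)"
    and extremal: "\<And>k. k \<noteq> p \<Longrightarrow> qRe (lam k) < qRe (lam p)" "\<And>k. k \<noteq> q \<Longrightarrow> qRe (lam q) < qRe (lam k)"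
    and pq: "p \<noteq> q"
    and freq: "qI (lam p) \<noteq> 0" "qI (lam q) \<noteq> 0" "qI (lam p) \<noteq> qI (lam q)" "qI (lam p) \<noteq> - qI (lam q)"
    and half_period: "T > 0" "\<eta>\<^sup>2 = 1" "exp (T *\<^sub>R lam p) = (\<eta> * exp (T * qRe (lam p))) *\<^sub>R 1"
      "exp (T *\<^sub>R lam q) = (- \<eta> * exp (T * qRe (lam q))) *\<^sub>R 1"
    and entries: "\<And>j k. j \<noteq> k \<Longrightarrow> qRe (A $ j $ k) \<noteq> 0" "\<And>j k. j \<noteq> k \<Longrightarrow> qJ (A $ j $ k) \<noteq> 0"
begin

section \<open>Corner entries of the drift and their root spaces\<close>

lemma Ad_dmat_nth: "(dmat c ** Y ** dmat d) $ j $ k = c j * Y $ j $ k * d k"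
  by (simp add: times_dmat_nth dmat_times_nth)

lemma medge_diff: "\<lbrakk>X \<in> medge S; Y \<in> medge S\<rbrakk> \<Longrightarrow> X - Y \<in> medge S"
  and medge_minus: "X \<in> medge S \<Longrightarrow> - X \<in> medge S"
  using medge_subspace by (auto intro: subspace_diff subspace_scale subspace_neg)

lemma mwedge_Ad_dmat:
  assumes "dmat d \<in> medge S" "Y \<in> mwedge S" "0 \<le> c"
  shows "c *\<^sub>R (dmat (\<lambda>i. exp (t *\<^sub>R d i)) ** Y ** dmat (\<lambda>i. exp (- t *\<^sub>R d i))) \<in> mwedge S"
proof -
  have "s *\<^sub>R dmat d = dmat (\<lambda>i. s *\<^sub>R d i)" for s
    by (simp add: vec_eq_iff)
  then show ?thesis
    using mwedge_scaleR[OF medge_exp_Ad[OF assms(1,2), of t] assms(3)] by (simp add: matrix_exp_dmat)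
qed

text \<open>Rescaling by the fastest growing entry, \<open>e\<^sup>s\<^sup>B A e\<^sup>-\<^sup>s\<^sup>B\<close> accumulates at both signs of the
  corner entry of \<open>A\<close>.\<close>

lemma corner_mem:
  assumes d: "dmat d \<in> medge S" and ab: "a \<noteq> b"
    and dom: "\<And>j k. (j, k) \<noteq> (a, b) \<Longrightarrow> qRe (d j) - qRe (d k) < qRe (d a) - qRe (d b)"
    and per: "\<xi>\<^sup>2 = 1" "exp (T *\<^sub>R d a) = (\<xi> * exp (T * qRe (d a))) *\<^sub>R 1"
      "exp (T *\<^sub>R d b) = (- \<xi> * exp (T * qRe (d b))) *\<^sub>R 1"
  shows "munit a b (A $ a $ b) \<in> medge S"
proof -
  define r where "r = T * (qRe (d a) - qRe (d b))"
  define X where "X m = exp (- (real m * r)) *\<^sub>R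
    (dmat (\<lambda>i. exp ((real m * T) *\<^sub>R d i)) ** A ** dmat (\<lambda>i. exp (- (real m * T) *\<^sub>R d i)))" for m :: nat
  have X: "X m \<in> mwedge S" for m
    unfolding X_def by (rule mwedge_Ad_dmat[OF d drift]) simp
  have X_nth: "X m $ j $ k = exp (- (real m * r)) *\<^sub>R
    (exp ((real m * T) *\<^sub>R d j) * A $ j $ k * exp (- (real m * T) *\<^sub>R d k))" for m j k
    unfolding X_def by (simp add: Ad_dmat_nth)
  \<comment> \<open>The signs at \<open>a\<close> and \<open>b\<close> combine to
    \<open>\<xi> ^ m * (- \<xi>) ^ m = (- 1) ^ m\<close> and the moduli cancel against
    \<open>exp (- (real m * r))\<close>: up to the alternating sign the corner is constant, not only
    convergent.\<close>
  have corner: "(- 1) ^ m *\<^sub>R X m $ a $ b = A $ a $ b" for m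
  proof -
    have xi: "(- \<xi>)\<^sup>2 = 1" using per(1) by simp
    have "(- 1) ^ m * (\<xi> ^ m * (- \<xi>) ^ m) = 1"
      using per(1) by (simp add: power_mult_distrib[symmetric] power2_eq_square)
    moreover have "exp (- (real m * r)) * (exp (real m * T * qRe (d a)) * exp (- (real m * T * qRe (d b)))) = 1"
      by (simp add: exp_add[symmetric] r_def algebra_simps)
    ultimately have "((- 1) ^ m * (\<xi> ^ m * (- \<xi>) ^ m)) *
        (exp (- (real m * r)) * (exp (real m * T * qRe (d a)) * exp (- (real m * T * qRe (d b))))) = 1"
      by simp
    then have one: "(- 1) ^ m * (exp (- (real m * r)) * ((- \<xi>) ^ m * exp (- (real m * T * qRe (d b))) *
        (\<xi> ^ m * exp (real m * T * qRe (d a))))) = 1"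
      by (simp only: mult_ac)
    have "(- 1) ^ m *\<^sub>R X m $ a $ b = ((- 1) ^ m * (exp (- (real m * r)) * ((- \<xi>) ^ m * exp (- (real m * T * qRe (d b))) *
        (\<xi> ^ m * exp (real m * T * qRe (d a)))))) *\<^sub>R A $ a $ b"
      unfolding X_nth exp_real_multiple(1)[OF per(2,1)] exp_real_multiple(2)[OF per(3) xi]
      by (simp only: mult_scaleR_left mult_scaleR_right mult_1_left mult_1_right scaleR_scaleR)
    then show ?thesis
      unfolding one by simp
  qed
  have "(\<lambda>m. (- 1) ^ m *\<^sub>R X m) \<longlonglongrightarrow> munit a b (A $ a $ b)"
  proof (intro vec_tendstoI)
    fix j k
    show "(\<lambda>m. ((- 1) ^ m *\<^sub>R X m) $ j $ k) \<longlonglongrightarrow> munit a b (A $ a $ b) $ j $ k"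
    proof (cases "(j, k) = (a, b)")
      case True
      then show ?thesis by (simp add: corner)
    next
      case False
      \<comment> \<open>The factor by which entry \<open>(j, k)\<close> shrinks relative to the
        corner in one half period; \<open>dom\<close> makes it less than 1.\<close>
      define c where "c = exp (T * ((qRe (d j) - qRe (d k)) - (qRe (d a) - qRe (d b))))"
      have "c < 1"
        using dom[OF False] half_period(1) by (simp add: c_def mult_pos_neg)
      then have "(\<lambda>m. c ^ m) \<longlonglongrightarrow> 0"
        by (intro LIMSEQ_realpow_zero) (simp add: c_def)
      then have lim: "(\<lambda>m. c ^ m * norm (A $ j $ k)) \<longlonglongrightarrow> 0"
        by (rule tendsto_mult_left_zero)
      have "norm (((- 1) ^ m *\<^sub>R X m) $ j $ k) = c ^ m * norm (A $ j $ k)" for m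
      proof -
        have "norm (((- 1) ^ m *\<^sub>R X m) $ j $ k) = norm (X m $ j $ k)"
          by (simp add: power_abs)
        also have "\<dots> = exp (- (real m * r)) * (exp (real m * T * qRe (d j)) * norm (A $ j $ k) * exp (- (real m * T) * qRe (d k)))"
          unfolding X_nth norm_scaleR norm_mult norm_exp_quat by simp
        also have "\<dots> = (exp (- (real m * r)) * exp (real m * T * qRe (d j)) * exp (- (real m * T) * qRe (d k))) * norm (A $ j $ k)"
          by (simp only: mult_ac)
        also have "exp (- (real m * r)) * exp (real m * T * qRe (d j)) * exp (- (real m * T) * qRe (d k)) = c ^ m"
          unfolding exp_add[symmetric] c_def exp_of_nat_mult[symmetric] by (simp add: r_def algebra_simps)
        finally show ?thesis .
      qed
      then have "(\<lambda>m. ((- 1) ^ m *\<^sub>R X m) $ j $ k) \<longlonglongrightarrow> 0"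
        using lim by (subst tendsto_norm_zero_iff[symmetric]) (simp only:)
      then show ?thesis using False by auto
    qed
  qed
  then have lim: "(\<lambda>m. (- 1) ^ (f m) *\<^sub>R X (f m)) \<longlonglongrightarrow> munit a b (A $ a $ b)" if "strict_mono f" for f
    using LIMSEQ_subseq_LIMSEQ[OF _ that] by (fastforce simp: o_def)
  \<comment> \<open>Even multiples of the half period produce the corner and odd multiples its
    negative; both limits lie in the wedge, which puts the corner into the edge.\<close>
  have "(\<lambda>m. X (2 * m)) \<longlonglongrightarrow> munit a b (A $ a $ b)"
    using lim[of "\<lambda>m. 2 * m"] by (simp add: strict_mono_def)
  then have "munit a b (A $ a $ b) \<in> mwedge S"
    by (rule mwedge_limit[OF X])
  moreover have "(\<lambda>m. - X (2 * m + 1)) \<longlonglongrightarrow> munit a b (A $ a $ b)"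
    using lim[of "\<lambda>m. 2 * m + 1"] by (simp add: strict_mono_def)
  from tendsto_minus[OF this] have "(\<lambda>m. X (2 * m + 1)) \<longlonglongrightarrow> - munit a b (A $ a $ b)"
    by simp
  then have "- munit a b (A $ a $ b) \<in> mwedge S"
    by (rule mwedge_limit[OF X])
  ultimately show ?thesis
    by (rule medgeI)
qed

lemma bracket_dmat_munit: "dmat d ** munit a b x - munit a b x ** dmat d = munit a b (d a * x - x * d b)"
  by (simp add: dmat_munit munit_diff)

text \<open>Extremality makes \<open>(p, q)\<close> the unique fastest growing position. The bracket
  with \<open>dmat lam\<close> acts there by \<open>x \<mapsto> lam p * x - x * lam q\<close>, so
  the single entry of \<open>A\<close> already generates the whole root space.\<close>

lemma corner_pq: "munit p q x \<in> medge S"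
proof -
  have 0: "munit p q (A $ p $ q) \<in> medge S"
  proof (rule corner_mem[OF control pq])
    show "qRe (lam j) - qRe (lam k) < qRe (lam p) - qRe (lam q)" if "(j, k) \<noteq> (p, q)" for j k
      using that extremal(1)[of j] extremal(2)[of k] by (cases "j = p"; cases "k = q") auto
  qed (use half_period in auto)
  have "{x. munit p q x \<in> medge S} = UNIV"
  proof (rule sylvester_orbit_UNIV)
    show "lam p * x - x * lam q \<in> {x. munit p q x \<in> medge S}" if "x \<in> {x. munit p q x \<in> medge S}" for x
      using medge_bracket[OF control, of "munit p q x"] that by (simp add: bracket_dmat_munit)
    show "A $ p $ q \<in> {x. munit p q x \<in> medge S}" using 0 by simp
  qed (use complex freq entries pq subspace_munit[OF medge_subspace] in auto)
  then show ?thesis by auto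
qed

lemma corner_qp: "munit q p x \<in> medge S"
proof -
  have neg: "dmat (\<lambda>i. - lam i) \<in> medge S"
  proof -
    have "dmat (\<lambda>i. - lam i) = - dmat lam" by (simp add: vec_eq_iff)
    then show ?thesis using medge_minus[OF control] by simp
  qed
  have inv: "exp (T *\<^sub>R - x) = (\<zeta> * exp (T * qRe (- x))) *\<^sub>R 1"
    if "exp (T *\<^sub>R x) = (\<zeta> * exp (T * qRe x)) *\<^sub>R 1" "\<zeta>\<^sup>2 = 1" for x \<zeta>
    using exp_real_multiple(2)[OF that, of 1] by simp
  have 0: "munit q p (A $ q $ p) \<in> medge S"
  \<comment> \<open>Reversing the flow makes \<open>q\<close> the dominant index; its half-period
    sign is that of \<open>lam q\<close>, namely \<open>- \<eta>\<close>.\<close>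
  proof (rule corner_mem[OF neg, of _ _ "- \<eta>"])
    show "qRe (- lam j) - qRe (- lam k) < qRe (- lam q) - qRe (- lam p)" if "(j, k) \<noteq> (q, p)" for j k
      using that extremal(1)[of k] extremal(2)[of j] by (cases "j = q"; cases "k = p") auto
  qed (use half_period pq inv[of "lam p" \<eta>] inv[of "lam q" "- \<eta>"] in auto)
  have "{x. munit q p x \<in> medge S} = UNIV"
  proof (rule sylvester_orbit_UNIV)
    show "lam q * x - x * lam p \<in> {x. munit q p x \<in> medge S}" if "x \<in> {x. munit q p x \<in> medge S}" for x
      using medge_bracket[OF control, of "munit q p x"] that by (simp add: bracket_dmat_munit)
    show "A $ q $ p \<in> {x. munit q p x \<in> medge S}" using 0 by simp
  qed (use complex freq entries pq subspace_munit[OF medge_subspace] in auto)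
  then show ?thesis by auto
qed

lemma diagonal_imaginary: "qRe c = 0 \<Longrightarrow> munit p p c \<in> medge S" "qRe c = 0 \<Longrightarrow> munit q q c \<in> medge S"
  "munit p p 1 - munit q q 1 \<in> medge S"
proof -
  have 1: "munit p p (x * y) - munit q q (y * x) \<in> medge S" for x y
    using medge_bracket[OF corner_pq[of x] corner_qp[of y]] by (simp add: munit_mult)
  have 2: "munit q q (x * y) - munit p p (y * x) \<in> medge S" for x y
    using medge_bracket[OF corner_qp[of x] corner_pq[of y]] by (simp add: munit_mult)
  show "qRe c = 0 \<Longrightarrow> munit p p c \<in> medge S" "qRe c = 0 \<Longrightarrow> munit q q c \<in> medge S"
    by (erule imaginary_munit[OF medge_subspace, rotated], rule 1)
      (erule imaginary_munit[OF medge_subspace, rotated], rule 2)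
  show "munit p p 1 - munit q q 1 \<in> medge S"
    using 1[of 1 1] by simp
qed

text \<open>The part of \<open>A\<close> of weight 1 for the bracket with
  \<open>munit p p 1 - munit q q 1\<close>; the only position of weight 2 is
  \<open>(p, q)\<close>.\<close>

definition cross_entries :: "quat ^ 'n ^ 'n" where
  "cross_entries = (\<chi> j k. if (j = p \<and> k \<noteq> p \<and> k \<noteq> q) \<or> (k = q \<and> j \<noteq> p \<and> j \<noteq> q) then A $ j $ k else 0)"

definition row_mat :: "quat ^ 'n \<Rightarrow> quat ^ 'n ^ 'n" where
  "row_mat r = (\<chi> j k. if j = p then r $ k else 0)"

definition col_mat :: "quat ^ 'n \<Rightarrow> quat ^ 'n ^ 'n" where
  "col_mat r = (\<chi> j k. if k = q then r $ j else 0)"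

text \<open>With the weight 2 entry subtracted, which is allowed since it lies in the edge, weight 1
  dominates: conjugating by the exponential of \<open>real m *\<^sub>R dmat d\<close> and dividing
  by \<open>exp (real m)\<close> leaves exactly these entries in the limit.\<close>

lemma cross_entries_mem: "cross_entries \<in> medge S"
proof -
  define h where "h i = (if i = p then 1 else if i = q then - 1 else (0::real))" for i
  define d where "d i = h i *\<^sub>R (1::quat)" for i
  have "dmat d = munit p p 1 - munit q q 1"
    using pq by (auto simp: vec_eq_iff d_def h_def)
  then have d: "dmat d \<in> medge S"
    using diagonal_imaginary(3) by simp
  have A': "A - munit p q (A $ p $ q) \<in> mwedge S" (is "?A' \<in> _")
    using mwedge_add[OF drift medgeD[OF medge_minus[OF corner_pq]]] by simp
  define X where "X m = exp (- real m) *\<^sub>R (dmat (\<lambda>i. exp (real m *\<^sub>R d i)) ** ?A' ** dmat (\<lambda>i. exp (- real m *\<^sub>R d i)))" for m :: nat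
  have X: "X m \<in> mwedge S" for m
    unfolding X_def by (rule mwedge_Ad_dmat[OF d A']) simp
  have ex: "exp (t *\<^sub>R d i) = exp (t * h i) *\<^sub>R 1" for t i
    using exp_of_real[of "t * h i", where 'a = quat] by (simp add: d_def of_real_def)
  have X_nth: "X m $ j $ k = exp (real m * (h j - h k - 1)) *\<^sub>R ?A' $ j $ k" for m j k
    unfolding X_def by (simp only: vector_scaleR_component Ad_dmat_nth ex)
      (simp add: exp_add[symmetric] algebra_simps)
  have "X \<longlonglongrightarrow> cross_entries"
  proof (intro vec_tendstoI)
    fix j k
    have "h j - h k - 1 \<le> 0 \<or> (j, k) = (p, q)"
      by (auto simp: h_def)
    then consider "h j - h k - 1 = 0" | "(j, k) = (p, q)" | "h j - h k - 1 < 0"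
      unfolding le_less by blast
    then show "(\<lambda>m. X m $ j $ k) \<longlonglongrightarrow> cross_entries $ j $ k"
    proof cases
      case 1
      then have "(j = p \<and> k \<noteq> p \<and> k \<noteq> q) \<or> (k = q \<and> j \<noteq> p \<and> j \<noteq> q)"
        using pq by (auto simp: h_def split: if_splits)
      then have "cross_entries $ j $ k = ?A' $ j $ k"
        by (auto simp: cross_entries_def)
      then show ?thesis
        using 1 by (simp add: X_nth)
    next
      case 2
      then show ?thesis using pq by (simp add: X_nth cross_entries_def)
    next
      case 3
      then have "cross_entries $ j $ k = 0"
        using pq by (auto simp: cross_entries_def h_def)
      moreover have "(\<lambda>m. exp (real m * (h j - h k - 1))) \<longlonglongrightarrow> 0"
        using 3 by real_asymp
      ultimately show ?thesis
        unfolding X_nth using tendsto_scaleR[OF _ tendsto_const] by fastforce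
    qed
  qed
  then have cm: "cross_entries \<in> mwedge S"
    by (rule mwedge_limit[OF X])
  \<comment> \<open>The exponential of \<open>dmat e\<close> is -1 at \<open>p\<close> and
    \<open>q\<close> and 1 elsewhere. Conjugation by it negates every entry with exactly one index
    in \<open>{p, q}\<close>, which supplies the opposite sign.\<close>
  define e where "e i = (if i = p \<or> i = q then pi *\<^sub>R Quat 0 1 0 0 else 0)" for i
  have "dmat e = munit p p (pi *\<^sub>R Quat 0 1 0 0) + munit q q (pi *\<^sub>R Quat 0 1 0 0)"
    using pq by (auto simp: vec_eq_iff e_def)
  then have e: "dmat e \<in> medge S"
    using diagonal_imaginary by (simp add: subspace_add[OF medge_subspace])
  have i: "Quat 0 1 0 0 * Quat 0 1 0 0 = - 1"
    by (simp add: quat_eq_iff)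
  have exp_e: "exp (e i) = (if i = p \<or> i = q then - 1 else 1)" "exp (- e i) = (if i = p \<or> i = q then - 1 else 1)" for i
    using exp_scaleR_imaginary_unit[OF i, of pi] exp_scaleR_imaginary_unit[OF i, of "- pi"] by (auto simp: e_def)
  have "dmat (\<lambda>i. exp (1 *\<^sub>R e i)) ** cross_entries ** dmat (\<lambda>i. exp (- 1 *\<^sub>R e i)) = - cross_entries"
    using pq by (auto simp: vec_eq_iff Ad_dmat_nth exp_e cross_entries_def)
  then have "- cross_entries \<in> mwedge S"
    using mwedge_Ad_dmat[OF e cm, of 1 1] by simp
  then show ?thesis
    using cm by (intro medgeI)
qed

section \<open>Row \<open>p\<close> and column \<open>q\<close> of the edge\<close>

lemma row_mat_left: "munit p p c ** row_mat r = row_mat (\<chi> k. c * r $ k)"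
  by (simp add: vec_eq_iff munit_times_nth row_mat_def)

lemma col_mat_right: "col_mat r ** munit q q c = col_mat (\<chi> k. r $ k * c)"
  by (simp add: vec_eq_iff times_munit_nth col_mat_def)

text \<open>The zero at \<open>p\<close> makes \<open>row_mat r ** munit p p c\<close> vanish, so
  the bracket with \<open>munit p p c\<close> is plain left multiplication by \<open>c\<close>. The
  zero at \<open>q\<close> in \<open>cols\<close> does the same on the right.\<close>

definition rows :: "(quat ^ 'n) set" where "rows = {r. r $ p = 0 \<and> row_mat r \<in> medge S}"
definition cols :: "(quat ^ 'n) set" where "cols = {r. r $ q = 0 \<and> col_mat r \<in> medge S}"

lemma row_mat_linear: "row_mat (x + y) = row_mat x + row_mat y" "row_mat (c *\<^sub>R x) = c *\<^sub>R row_mat x" "row_mat 0 = 0"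
  and col_mat_linear: "col_mat (x + y) = col_mat x + col_mat y" "col_mat (c *\<^sub>R x) = c *\<^sub>R col_mat x" "col_mat 0 = 0"
  by (simp_all add: vec_eq_iff row_mat_def col_mat_def)

lemma subspace_rows: "subspace rows" and subspace_cols: "subspace cols"
  using medge_subspace by (auto simp: subspace_def rows_def cols_def row_mat_linear col_mat_linear)

lemma rows_imaginary: "r \<in> rows \<Longrightarrow> qRe c = 0 \<Longrightarrow> (\<chi> k. c * r $ k) \<in> rows"
proof -
  assume r: "r \<in> rows" and c: "qRe c = 0"
  have "row_mat r ** munit p p c = 0"
    using r by (auto simp: vec_eq_iff times_munit_nth row_mat_def rows_def)
  then show ?thesis
    using medge_bracket[OF diagonal_imaginary(1)[OF c], of "row_mat r"] r by (simp add: rows_def row_mat_left)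
qed

lemma cols_imaginary: "r \<in> cols \<Longrightarrow> qRe c = 0 \<Longrightarrow> (\<chi> k. r $ k * c) \<in> cols"
proof -
  assume r: "r \<in> cols" and c: "qRe c = 0"
  have "munit q q c ** col_mat r = 0"
    using r by (auto simp: vec_eq_iff munit_times_nth col_mat_def cols_def)
  then show ?thesis
    using medge_bracket[OF _ diagonal_imaginary(2)[OF c], of "col_mat r"] r by (simp add: cols_def col_mat_right)
qed

text \<open>Real factors come from the subspace structure and imaginary ones from brackets, so
  \<open>rows\<close> is a left quaternionic vector space.\<close>

lemma rows_mult:
  assumes "r \<in> rows" shows "(\<chi> k. c * r $ k) \<in> rows"
proof -
  have "(\<chi> k. c * r $ k) = qRe c *\<^sub>R r + (\<chi> k. Quat 0 (qI c) (qJ c) (qK c) * r $ k)"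
    by (simp add: vec_eq_iff) (simp add: quat_eq_iff algebra_simps)
  then show ?thesis
    using assms rows_imaginary[OF assms, of "Quat 0 (qI c) (qJ c) (qK c)"]
    by (simp add: subspace_add[OF subspace_rows] subspace_scale[OF subspace_rows])
qed

lemma cols_mult:
  assumes "r \<in> cols" shows "(\<chi> k. r $ k * c) \<in> cols"
proof -
  have "(\<chi> k. r $ k * c) = qRe c *\<^sub>R r + (\<chi> k. r $ k * Quat 0 (qI c) (qJ c) (qK c))"
    by (simp add: vec_eq_iff) (simp add: quat_eq_iff algebra_simps)
  then show ?thesis
    using assms cols_imaginary[OF assms, of "Quat 0 (qI c) (qJ c) (qK c)"]
    by (simp add: subspace_add[OF subspace_cols] subspace_scale[OF subspace_cols])
qed

text \<open>The bracket with \<open>dmat lam\<close> is left multiplication by \<open>lam p\<close>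
  minus the wanted map, and left multiplications are already available.\<close>

lemma rows_right_lam:
  assumes "r \<in> rows" shows "(\<chi> k. r $ k * lam k) \<in> rows"
proof -
  have "row_mat (\<chi> k. lam p * r $ k) - (dmat lam ** row_mat r - row_mat r ** dmat lam) = row_mat (\<chi> k. r $ k * lam k)"
    by (simp add: vec_eq_iff dmat_times_nth times_dmat_nth row_mat_def)
  then show ?thesis
    using rows_mult[OF assms, of "lam p"] medge_bracket[OF control, of "row_mat r"] assms
    by (simp add: rows_def) (metis medge_diff)
qed

lemma cols_left_lam:
  assumes "r \<in> cols" shows "(\<chi> k. lam k * r $ k) \<in> cols"
proof -
  have "(dmat lam ** col_mat r - col_mat r ** dmat lam) + col_mat (\<chi> k. r $ k * lam q) = col_mat (\<chi> k. lam k * r $ k)"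
    by (simp add: vec_eq_iff dmat_times_nth times_dmat_nth col_mat_def)
  then show ?thesis
    using cols_mult[OF assms, of "lam q"] medge_bracket[OF control, of "col_mat r"] assms
    by (simp add: cols_def) (metis subspace_add[OF medge_subspace])
qed

text \<open>The bracket with i at \<open>(p, p)\<close> sees only the row part of
  \<open>cross_entries\<close>, and applied twice it gives minus that part. Subtraction leaves the
  column part.\<close>

lemma first_row_col:
  "(\<chi> k. if k \<noteq> p \<and> k \<noteq> q then A $ p $ k else 0) \<in> rows"
  "(\<chi> k. if k \<noteq> p \<and> k \<noteq> q then A $ k $ q else 0) \<in> cols"
proof -
  define r where "r = (\<chi> k. if k \<noteq> p \<and> k \<noteq> q then A $ p $ k else 0)"
  define c where "c = (\<chi> k. if k \<noteq> p \<and> k \<noteq> q then A $ k $ q else 0)"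
  define i where "i = Quat 0 1 0 0"
  have ii: "i * (i * x) = - x" for x
    by (simp add: i_def quat_eq_iff)
  have i: "munit p p i \<in> medge S"
    by (rule diagonal_imaginary) (simp add: i_def)
  have 1: "munit p p i ** cross_entries - cross_entries ** munit p p i = row_mat (\<chi> k. i * r $ k)"
    using pq by (auto simp: vec_eq_iff munit_times_nth times_munit_nth cross_entries_def row_mat_def r_def)
  have 2: "munit p p i ** row_mat (\<chi> k. i * r $ k) - row_mat (\<chi> k. i * r $ k) ** munit p p i = - row_mat r"
    by (auto simp: vec_eq_iff munit_times_nth times_munit_nth row_mat_def r_def ii)
  have "- row_mat r \<in> medge S"
    using medge_bracket[OF i medge_bracket[OF i cross_entries_mem]] unfolding 1 2 .
  then have r: "row_mat r \<in> medge S"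
    using medge_minus by fastforce
  then show "r \<in> rows" by (simp add: rows_def r_def)
  have "cross_entries - row_mat r = col_mat c"
    using pq by (auto simp: vec_eq_iff cross_entries_def row_mat_def col_mat_def r_def c_def)
  then show "c \<in> cols"
    using medge_diff[OF cross_entries_mem r] by (simp add: cols_def c_def)
qed

text \<open>Right multiplication by \<open>lam\<close> separates the coordinates of the row because
  the real parts differ; left multiplication then turns the one nonzero entry into an arbitrary
  one.\<close>

lemma row_p: "p \<noteq> k \<Longrightarrow> munit p k x \<in> medge S"
proof (cases "k = q")
  case False
  assume pk: "p \<noteq> k"
  obtain c where c: "c \<noteq> 0" "axis k c \<in> rows"
  proof (rule separate_coordinates[OF subspace_rows, of "\<lambda>l x. x * lam l" k])
    show "linear (\<lambda>x. x * lam l)" for l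
      by (simp add: bounded_linear.linear bounded_linear_mult_left)
    show "(\<chi> l. v $ l * lam l) \<in> rows" if "v \<in> rows" for v
      using rows_right_lam[OF that] .
    show "\<exists>\<alpha> \<beta>. (\<forall>x. x * lam l * lam l + \<alpha> *\<^sub>R (x * lam l) + \<beta> *\<^sub>R x = 0)
        \<and> (\<forall>x. x \<noteq> 0 \<longrightarrow> x * lam k * lam k + \<alpha> *\<^sub>R (x * lam k) + \<beta> *\<^sub>R x \<noteq> 0)" if "l \<noteq> k" for l
    proof (intro exI conjI allI impI)
      have eq: "x * m * m + \<alpha> *\<^sub>R (x * m) + \<beta> *\<^sub>R x = x * (m * m + \<alpha> *\<^sub>R m + \<beta> *\<^sub>R 1)" for x m :: quat and \<alpha> \<beta>
        by (simp add: algebra_simps)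
      show "x * lam l * lam l + (- 2 * qRe (lam l)) *\<^sub>R (x * lam l) + ((qRe (lam l))\<^sup>2 + (qI (lam l))\<^sup>2) *\<^sub>R x = 0" for x
        unfolding eq complex_quat_annihilator[OF complex] by simp
      show "x * lam k * lam k + (- 2 * qRe (lam l)) *\<^sub>R (x * lam k) + ((qRe (lam l))\<^sup>2 + (qI (lam l))\<^sup>2) *\<^sub>R x \<noteq> 0" if "x \<noteq> 0" for x
        unfolding eq using complex_quat_separated[OF complex, of k "lam l"] real_parts \<open>l \<noteq> k\<close> \<open>x \<noteq> 0\<close> by (metis mult_eq_0_iff)
    qed
    show "(\<chi> k. if k \<noteq> p \<and> k \<noteq> q then A $ p $ k else 0) $ k \<noteq> 0"
      using pk False entries(1)[OF pk] by auto
  qed (rule first_row_col(1))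
  have "row_mat (\<chi> l. (x * inverse c) * axis k c $ l) = munit p k x"
    using c(1) by (auto simp: vec_eq_iff row_mat_def axis_def mult.assoc)
  then show ?thesis
    using rows_mult[OF c(2), of "x * inverse c"] by (simp add: rows_def)
qed (simp add: corner_pq)

lemma col_q: "k \<noteq> q \<Longrightarrow> munit k q x \<in> medge S"
proof (cases "k = p")
  case False
  assume pk: "k \<noteq> q"
  obtain c where c: "c \<noteq> 0" "axis k c \<in> cols"
  proof (rule separate_coordinates[OF subspace_cols, of "\<lambda>l x. lam l * x" k])
    show "linear (\<lambda>x. lam l * x)" for l
      by (simp add: bounded_linear.linear bounded_linear_mult_right)
    show "(\<chi> l. lam l * v $ l) \<in> cols" if "v \<in> cols" for v
      using cols_left_lam[OF that] .
    show "\<exists>\<alpha> \<beta>. (\<forall>x. lam l * (lam l * x) + \<alpha> *\<^sub>R (lam l * x) + \<beta> *\<^sub>R x = 0)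
        \<and> (\<forall>x. x \<noteq> 0 \<longrightarrow> lam k * (lam k * x) + \<alpha> *\<^sub>R (lam k * x) + \<beta> *\<^sub>R x \<noteq> 0)" if "l \<noteq> k" for l
    proof (intro exI conjI allI impI)
      have eq: "m * (m * x) + \<alpha> *\<^sub>R (m * x) + \<beta> *\<^sub>R x = (m * m + \<alpha> *\<^sub>R m + \<beta> *\<^sub>R 1) * x" for x m :: quat and \<alpha> \<beta>
        by (simp add: algebra_simps)
      show "lam l * (lam l * x) + (- 2 * qRe (lam l)) *\<^sub>R (lam l * x) + ((qRe (lam l))\<^sup>2 + (qI (lam l))\<^sup>2) *\<^sub>R x = 0" for x
        unfolding eq complex_quat_annihilator[OF complex] by simp
      show "lam k * (lam k * x) + (- 2 * qRe (lam l)) *\<^sub>R (lam k * x) + ((qRe (lam l))\<^sup>2 + (qI (lam l))\<^sup>2) *\<^sub>R x \<noteq> 0" if "x \<noteq> 0" for x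
        unfolding eq using complex_quat_separated[OF complex, of k "lam l"] real_parts \<open>l \<noteq> k\<close> \<open>x \<noteq> 0\<close> by (metis mult_eq_0_iff)
    qed
    show "(\<chi> k. if k \<noteq> p \<and> k \<noteq> q then A $ k $ q else 0) $ k \<noteq> 0"
      using pk False entries(1)[OF pk] by auto
  qed (rule first_row_col(2))
  have "col_mat (\<chi> l. axis k c $ l * (inverse c * x)) = munit k q x"
    using c(1) by (auto simp: vec_eq_iff col_mat_def axis_def mult.assoc[symmetric])
  then show ?thesis
    using cols_mult[OF c(2), of "inverse c * x"] by (simp add: cols_def)
qed (simp add: corner_pq)

lemma munit_mem:
  assumes "j \<noteq> k"
  shows "munit j k x \<in> medge S"
proof -
  have col_p: "munit j p y \<in> medge S" if "j \<noteq> p" for j y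
  proof (cases "j = q")
    case False
    then show ?thesis
      using medge_bracket[OF col_q[OF False, of y] corner_qp[of 1]] that by (simp add: munit_mult)
  qed (simp add: corner_qp)
  show ?thesis
  proof (cases "j = p \<or> k = p")
    case True
    then show ?thesis using assms col_p row_p by auto
  next
    case False
    then show ?thesis
      using medge_bracket[OF col_p[of j 1] row_p[of k x]] assms by (auto simp: munit_mult)
  qed
qed

lemma medge_UNIV: "medge S = UNIV"
proof (rule subspace_munits_UNIV[OF medge_subspace _ munit_mem _ scalars])
  have "card {p, q} \<le> CARD('n)"
    by (rule card_mono) auto
  then show "2 \<le> CARD('n)"
    using pq by simp
  show "munit a a (x * y) - munit b b (y * x) \<in> medge S" if "a \<noteq> b" for a b x y
    using medge_bracket[OF munit_mem[OF that, of x] munit_mem[OF that[symmetric], of y]] that by (simp add: munit_mult)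
qed

lemma invertible_subset: "{g. invertible g} \<subseteq> S"
proof (rule semigroup_exp_imp_invertible)
  show "matrix_exp X \<in> S" for X
    using medge_exp[of X 1] by (simp add: medge_UNIV)
qed (rule mult)

end

section \<open>Accessibility and stability under perturbation\<close>

text \<open>The last component of a letter adjoins the positive scalars, so that reachable sets can be open
  in the whole matrix space instead of in a hypersurface.\<close>

definition letter :: "quat ^ 'n ^ 'n \<Rightarrow> quat ^ 'n ^ 'n \<Rightarrow> real \<times> real \<times> real \<Rightarrow> quat ^ 'n ^ 'n" where
  "letter A B x = A + fst (snd x) *\<^sub>R B + snd (snd x) *\<^sub>R mat 1"

text \<open>A list element is a triple of duration, control value and rate of the adjoined
  scalar.\<close>

primrec word_val :: "quat ^ 'n ^ 'n \<Rightarrow> quat ^ 'n ^ 'n \<Rightarrow> (real \<times> real \<times> real) list \<Rightarrow> quat ^ 'n ^ 'n" where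
  "word_val A B [] = mat 1"
| "word_val A B (x # w) = matrix_exp (fst x *\<^sub>R letter A B x) ** word_val A B w"

primrec word_inv :: "quat ^ 'n ^ 'n \<Rightarrow> quat ^ 'n ^ 'n \<Rightarrow> (real \<times> real \<times> real) list \<Rightarrow> quat ^ 'n ^ 'n" where
  "word_inv A B [] = mat 1"
| "word_inv A B (x # w) = word_inv A B w ** matrix_exp (- (fst x *\<^sub>R letter A B x))"

text \<open>The derivative of \<open>word_val\<close> when the durations move with velocities
  \<open>c\<close>, translated back to the identity by \<open>word_inv\<close> on the right.
  Velocities are indexed by position, so passing to the tail shifts \<open>c\<close>.\<close>

primrec tangent :: "quat ^ 'n ^ 'n \<Rightarrow> quat ^ 'n ^ 'n \<Rightarrow> (real \<times> real \<times> real) list \<Rightarrow> (nat \<Rightarrow> real) \<Rightarrow> quat ^ 'n ^ 'n" where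
  "tangent A B [] c = 0"
| "tangent A B (x # w) c = c 0 *\<^sub>R letter A B x
    + matrix_exp (fst x *\<^sub>R letter A B x) ** tangent A B w (\<lambda>i. c (Suc i)) ** matrix_exp (- (fst x *\<^sub>R letter A B x))"

primrec shift_times :: "(real \<times> real \<times> real) list \<Rightarrow> (nat \<Rightarrow> real) \<Rightarrow> (real \<times> real \<times> real) list" where
  "shift_times [] c = []"
| "shift_times (x # w) c = (fst x + c 0, snd x) # shift_times w (\<lambda>i. c (Suc i))"

definition positive_word :: "(real \<times> real \<times> real) list \<Rightarrow> bool" where
  "positive_word w \<longleftrightarrow> (\<forall>x\<in>set w. 0 < fst x)"

definition reach :: "quat ^ 'n ^ 'n \<Rightarrow> quat ^ 'n ^ 'n \<Rightarrow> (quat ^ 'n ^ 'n) set" where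
  "reach A B = word_val A B ` {w. positive_word w}"

section \<open>Calculus of words in their durations\<close>

lemma letter_shift [simp]: "letter A B (t, snd x) = letter A B x"
  by (simp add: letter_def)

lemma shift_times_0 [simp]: "shift_times w (\<lambda>_. 0) = w"
  by (induction w) simp_all

lemma word_val_append: "word_val A B (v @ w) = word_val A B v ** word_val A B w"
  by (induction v) (simp_all add: matrix_mul_assoc)

lemma word_val_inv: "word_val A B w ** word_inv A B w = mat 1" "word_inv A B w ** word_val A B w = mat 1"
proof (induction w)
  case (Cons x w)
  define e e' where "e = matrix_exp (fst x *\<^sub>R letter A B x)" and "e' = matrix_exp (- (fst x *\<^sub>R letter A B x))"
  have ee: "e ** e' = mat 1" "e' ** e = mat 1"
    by (simp_all add: e_def e'_def matrix_exp_minus)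
  have "e ** word_val A B w ** (word_inv A B w ** e') = e ** (word_val A B w ** word_inv A B w) ** e'"
    by (simp only: matrix_mul_assoc)
  then show "word_val A B (x # w) ** word_inv A B (x # w) = mat 1"
    by (simp add: e_def[symmetric] e'_def[symmetric] Cons ee)
  have "word_inv A B w ** e' ** (e ** word_val A B w) = word_inv A B w ** (e' ** e) ** word_val A B w"
    by (simp only: matrix_mul_assoc)
  then show "word_inv A B (x # w) ** word_val A B (x # w) = mat 1"
    by (simp add: e_def[symmetric] e'_def[symmetric] Cons ee)
qed simp_all

lemma tangent_add: "tangent A B w (\<lambda>i. c i + d i) = tangent A B w c + tangent A B w d"
  by (induction w arbitrary: c d) (simp_all add: scaleR_add_left mm.add_left mm.add_right)

lemma tangent_scale: "tangent A B w (\<lambda>i. r * c i) = r *\<^sub>R tangent A B w c"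
  by (induction w arbitrary: c) (simp_all add: mm.scaleR_left mm.scaleR_right scaleR_add_right)

lemma tangent_zero [simp]: "tangent A B w (\<lambda>_. 0) = 0"
  by (induction w) simp_all

lemma tangent_sum: "tangent A B w (\<lambda>i. \<Sum>b\<in>F. c b i) = (\<Sum>b\<in>F. tangent A B w (c b))"
  by (induction F rule: infinite_finite_induct) (simp_all add: tangent_add)

lemma tangent_cong: "(\<And>i. i < length w \<Longrightarrow> c i = d i) \<Longrightarrow> tangent A B w c = tangent A B w d"
proof (induction w arbitrary: c d)
  case (Cons x w)
  have "tangent A B w (\<lambda>i. c (Suc i)) = tangent A B w (\<lambda>i. d (Suc i))"
    by (rule Cons.IH) (simp add: Cons.prems)
  then show ?case using Cons.prems[of 0] by simp
qed simp

lemma tangent_append: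
  "tangent A B (v @ w) c = tangent A B v c
    + word_val A B v ** tangent A B w (\<lambda>i. c (length v + i)) ** word_inv A B v"
proof (induction v arbitrary: c)
  case (Cons x v)
  define e e' where "e = matrix_exp (fst x *\<^sub>R letter A B x)" and "e' = matrix_exp (- (fst x *\<^sub>R letter A B x))"
  show ?case
    by (simp add: Cons e_def[symmetric] e'_def[symmetric] mm.add_left mm.add_right matrix_mul_assoc)
qed simp

definition tangents :: "quat ^ 'n ^ 'n \<Rightarrow> quat ^ 'n ^ 'n \<Rightarrow> (real \<times> real \<times> real) list \<Rightarrow> (quat ^ 'n ^ 'n) set" where
  "tangents A B w = range (tangent A B w)"

lemma subspace_tangents: "subspace (tangents A B w)"
proof (rule subspaceI)
  show "0 \<in> tangents A B w"
    unfolding tangents_def by (rule range_eqI[of _ _ "\<lambda>_. 0"]) simp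
  show "X + Y \<in> tangents A B w" if "X \<in> tangents A B w" "Y \<in> tangents A B w" for X Y
    using that by (auto simp: tangents_def tangent_add[symmetric])
  show "r *\<^sub>R X \<in> tangents A B w" if "X \<in> tangents A B w" for r X
    using that by (auto simp: tangents_def tangent_scale[symmetric])
qed

text \<open>Velocities on the two halves of a concatenation are independent; the second half is seen
  through conjugation by the value of the first.\<close>

lemma tangents_append:
  assumes "X \<in> tangents A B v" "Y \<in> tangents A B w"
  shows "X + word_val A B v ** Y ** word_inv A B v \<in> tangents A B (v @ w)"
proof -
  obtain c d where c: "X = tangent A B v c" "Y = tangent A B w d"
    using assms by (auto simp: tangents_def)
  define e where "e i = (if i < length v then c i else d (i - length v))" for i
  have "tangent A B v e = X"
    unfolding c by (rule tangent_cong) (simp add: e_def)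
  moreover have "(\<lambda>i. e (length v + i)) = d"
    by (simp add: e_def)
  ultimately have "tangent A B (v @ w) e = X + word_val A B v ** Y ** word_inv A B v"
    by (simp add: tangent_append c)
  then show ?thesis
    unfolding tangents_def by (intro range_eqI[of _ _ e]) simp
qed

lemma positive_word_append: "positive_word (v @ w) \<longleftrightarrow> positive_word v \<and> positive_word w"
  by (auto simp: positive_word_def)

lemma word_val_has_derivative:
  fixes l :: "'b :: real_normed_vector \<Rightarrow> nat \<Rightarrow> real"
  assumes "\<And>i. bounded_linear (\<lambda>y. l y i)"
  shows "((\<lambda>y. word_val A B (shift_times w (l y))) has_derivative (\<lambda>y. tangent A B w (l y) ** word_val A B w)) (at 0)"
  using assms
proof (induction w arbitrary: l)
  case (Cons x w)
  define X where "X = letter A B x"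
  define e e' where "e = matrix_exp (fst x *\<^sub>R X)" and "e' = matrix_exp (- (fst x *\<^sub>R X))"
  have ee: "e' ** e = mat 1"
    by (simp add: e_def e'_def matrix_exp_minus)
  have l0: "l 0 i = 0" for i
    using linear_0[OF bounded_linear.linear[OF Cons.prems]] .
  have l0': "(\<lambda>i. l 0 (Suc i)) = (\<lambda>_. 0)" by (simp add: l0)
  have tail: "((\<lambda>y. word_val A B (shift_times w (\<lambda>i. l y (Suc i)))) has_derivative
      (\<lambda>y. tangent A B w (\<lambda>i. l y (Suc i)) ** word_val A B w)) (at 0)"
    by (rule Cons.IH) (rule Cons.prems)
  have "((\<lambda>y. fst x + l y 0) has_derivative (\<lambda>y. l y 0)) (at 0)"
    using has_derivative_add[OF has_derivative_const bounded_linear_imp_has_derivative[OF Cons.prems[of 0]], of "fst x"]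
    by simp
  moreover have "((\<lambda>t. matrix_exp (t *\<^sub>R X)) has_derivative (\<lambda>h. h *\<^sub>R (X ** e))) (at (fst x + l 0 0))"
    using matrix_exp_deriv[of X "fst x"] by (simp add: has_vector_derivative_def l0 e_def)
  ultimately have head: "((\<lambda>y. matrix_exp ((fst x + l y 0) *\<^sub>R X)) has_derivative (\<lambda>y. l y 0 *\<^sub>R (X ** e))) (at 0)"
    by (rule has_derivative_compose)
  have fin: "e ** (tangent A B w (\<lambda>i. l y (Suc i)) ** word_val A B w) + (l y 0 *\<^sub>R (X ** e)) ** word_val A B w
      = tangent A B (x # w) (l y) ** word_val A B (x # w)" for y
  proof -
    define M where "M = tangent A B w (\<lambda>i. l y (Suc i))"
    have "e ** M ** e' ** (e ** word_val A B w) = e ** M ** (e' ** e) ** word_val A B w"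
      by (simp only: matrix_mul_assoc)
    also have "\<dots> = e ** (M ** word_val A B w)"
      by (simp add: ee matrix_mul_assoc)
    finally show ?thesis
      unfolding tangent.simps word_val.simps X_def[symmetric] e_def[symmetric] e'_def[symmetric] M_def[symmetric]
      by (simp add: mm.add_left mm.scaleR_left matrix_mul_assoc add.commute)
  qed
  have "((\<lambda>y. matrix_exp ((fst x + l y 0) *\<^sub>R X) ** word_val A B (shift_times w (\<lambda>i. l y (Suc i)))) has_derivative
      (\<lambda>y. e ** (tangent A B w (\<lambda>i. l y (Suc i)) ** word_val A B w) + (l y 0 *\<^sub>R (X ** e)) ** word_val A B w)) (at 0)"
    using mm.FDERIV[OF head tail] by (simp add: l0 l0' e_def)
  then show ?case
    unfolding fin by (simp add: X_def)
qed simp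

lemma continuous_on_word_val:
  assumes "continuous_on S f" "continuous_on S g" "\<And>i. continuous_on S (\<lambda>z. l z i)"
  shows "continuous_on S (\<lambda>z. word_val (f z) (g z) (shift_times w (l z)))"
  using assms
proof (induction w arbitrary: l)
  case (Cons x w)
  have "continuous_on S (\<lambda>z. matrix_exp ((fst x + l z 0) *\<^sub>R letter (f z) (g z) x) ** word_val (f z) (g z) (shift_times w (\<lambda>i. l z (Suc i))))"
    unfolding letter_def
    by (intro mm.continuous_on continuous_on_matrix_exp continuous_intros Cons)
  then show ?case by simp
qed simp

lemma eventually_positive_shift:
  fixes l :: "'b :: real_normed_vector \<Rightarrow> nat \<Rightarrow> real"
  assumes "\<And>i. bounded_linear (\<lambda>y. l y i)" "positive_word w"
  shows "\<forall>\<^sub>F y in nhds 0. positive_word (shift_times w (l y))"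
  using assms
proof (induction w arbitrary: l)
  case (Cons x w)
  have "\<forall>\<^sub>F y in nhds 0. positive_word (shift_times w (\<lambda>i. l y (Suc i)))"
    using Cons.prems by (intro Cons.IH) (auto simp: positive_word_def)
  moreover have "\<forall>\<^sub>F y in nhds 0. 0 < fst x + l y 0"
  proof -
    have "isCont (\<lambda>y. fst x + l y 0) 0"
      by (intro continuous_intros bounded_linear.isCont[OF Cons.prems(1)])
    then have "((\<lambda>y. fst x + l y 0) \<longlongrightarrow> fst x + l 0 0) (nhds 0)"
      unfolding isCont_def by (rule tendsto_at_iff_tendsto_nhds[THEN iffD1])
    then have "((\<lambda>y. fst x + l y 0) \<longlongrightarrow> fst x) (nhds 0)"
      using linear_0[OF bounded_linear.linear[OF Cons.prems(1)[of 0]]] by simp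
    then show ?thesis
      using Cons.prems(2) by (intro order_tendstoD(1)) (auto simp: positive_word_def)
  qed
  ultimately show ?case
    by eventually_elim (auto simp: positive_word_def)
qed (simp add: positive_word_def)

section \<open>Reachable sets and their closures\<close>

lemma reach_mult: "\<lbrakk>g \<in> reach A B; h \<in> reach A B\<rbrakk> \<Longrightarrow> g ** h \<in> reach A B"
  unfolding reach_def by (auto simp: word_val_append[symmetric] positive_word_append)

lemma reach_one: "mat 1 \<in> reach A B"
  unfolding reach_def by (auto simp: positive_word_def intro!: image_eqI[of _ _ "[]"])

lemma reach_letter: "0 < t \<Longrightarrow> matrix_exp (t *\<^sub>R (A + u *\<^sub>R B + v *\<^sub>R mat 1)) \<in> reach A B"
  unfolding reach_def by (auto simp: positive_word_def letter_def intro!: image_eqI[of _ _ "[(t, u, v)]"])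

lemma closure_reach_semigroup: "closed_matrix_semigroup (closure (reach A B))"
proof
  fix x y assume "x \<in> closure (reach A B)" "y \<in> closure (reach A B)"
  then obtain f g where "\<And>n. f n \<in> reach A B" "f \<longlonglongrightarrow> x" "\<And>n. g n \<in> reach A B" "g \<longlonglongrightarrow> y"
    unfolding closure_sequential by blast
  then show "x ** y \<in> closure (reach A B)"
    unfolding closure_sequential by (intro exI[of _ "\<lambda>n. f n ** g n"]) (auto intro: reach_mult mm.tendsto)
qed (use reach_one closure_subset in auto)

lemma isCont_matrix_exp: "isCont matrix_exp (X :: quat ^ 'n ^ 'n)"
proof -
  have "continuous_on UNIV (\<lambda>X :: quat ^ 'n ^ 'n. matrix_exp X)"
    by (intro continuous_on_matrix_exp continuous_on_id)
  then show ?thesis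
    by (simp add: continuous_on_eq_continuous_at)
qed

text \<open>A very large control, and a very large scalar rate, applied for a very short time: the
  drift contributes only \<open>inverse (real (Suc m)) *\<^sub>R A\<close> to the exponent and
  disappears in the limit.\<close>

lemma closure_reach_exp: "matrix_exp (u *\<^sub>R B + v *\<^sub>R mat 1) \<in> closure (reach A B)"
proof -
  define X where "X m = inverse (real (Suc m)) *\<^sub>R (A + (real (Suc m) * u) *\<^sub>R B + (real (Suc m) * v) *\<^sub>R mat 1)" for m
  have X: "X m = inverse (real (Suc m)) *\<^sub>R A + (u *\<^sub>R B + v *\<^sub>R mat 1)" for m
    unfolding X_def by (simp add: scaleR_add_right mult.assoc[symmetric] del: of_nat_Suc)
  have "(\<lambda>m. inverse (real (Suc m)) *\<^sub>R A) \<longlonglongrightarrow> 0 *\<^sub>R A"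
    by (intro tendsto_scaleR LIMSEQ_inverse_real_of_nat tendsto_const)
  then have lim: "X \<longlonglongrightarrow> 0 *\<^sub>R A + (u *\<^sub>R B + v *\<^sub>R mat 1)"
    unfolding X[abs_def] by (intro tendsto_add tendsto_const)
  then have "(\<lambda>m. matrix_exp (X m)) \<longlonglongrightarrow> matrix_exp (u *\<^sub>R B + v *\<^sub>R mat 1)"
    using isCont_tendsto_compose[OF isCont_matrix_exp lim] by simp
  moreover have "matrix_exp (X m) \<in> reach A B" for m
    unfolding X_def by (rule reach_letter) simp
  ultimately show ?thesis
    unfolding closure_sequential by (intro exI[of _ "\<lambda>m. matrix_exp (X m)"]) simp
qed

lemma closure_reach_wedge:
  "A \<in> mwedge (closure (reach A B))" "B \<in> medge (closure (reach A B))" "mat 1 \<in> medge (closure (reach A B))"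
proof -
  have "matrix_exp (t *\<^sub>R A) \<in> reach A B" if "0 \<le> t" for t
    using reach_letter[of t A 0 B 0] reach_one[of A B] that by (cases "t = 0") auto
  then show "A \<in> mwedge (closure (reach A B))"
    unfolding mwedge_def using closure_subset by blast
  show "B \<in> medge (closure (reach A B))"
    using closure_reach_exp[of _ B 0 A] closure_reach_exp[of "- _" B 0 A] by (simp add: medge_def mwedge_def)
  show "mat 1 \<in> medge (closure (reach A B))"
    using closure_reach_exp[of 0 B _ A] closure_reach_exp[of 0 B "- _" A] by (simp add: medge_def mwedge_def)
qed

text \<open>Differentiability at the one parameter \<open>\<theta>\<close> suffices, since Brouwer's
  theorem only asks for a continuous self-map of a ball; for nearby \<open>\<tau>\<close> uniform
  continuity on a compact set takes over.\<close>

lemma uniform_local_surjectivity: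
  fixes f :: "'t :: euclidean_space \<Rightarrow> 'a :: euclidean_space \<Rightarrow> 'a"
  assumes cont: "continuous_on UNIV (\<lambda>z. f (fst z) (snd z))"
    and deriv: "(f \<theta> has_derivative (\<lambda>y. y)) (at 0)" and r: "0 < r"
  shows "\<exists>\<delta>>0. \<forall>\<^sub>F \<tau> in nhds \<theta>. ball (f \<theta> 0) \<delta> \<subseteq> f \<tau> ` ball 0 r"
proof -
  obtain d where d: "d > 0" "\<And>y. norm y < d \<Longrightarrow> norm (f \<theta> y - f \<theta> 0 - y) \<le> 1/4 * norm y"
    using deriv unfolding has_derivative_at_alt by (auto dest!: spec[of _ "1/4::real"])
  define \<rho> where "\<rho> = min d r / 2"
  have \<rho>: "0 < \<rho>" "\<rho> < d" "\<rho> < r"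
    using d(1) r by (auto simp: \<rho>_def min_def)
  have "uniformly_continuous_on (cball \<theta> 1 \<times> cball 0 \<rho>) (\<lambda>z. f (fst z) (snd z))"
    by (intro compact_uniformly_continuous compact_Times compact_cball continuous_on_subset[OF cont]) auto
  then obtain e where e: "e > 0" and unif: "\<And>z z'. \<lbrakk>z \<in> cball \<theta> 1 \<times> cball 0 \<rho>; z' \<in> cball \<theta> 1 \<times> cball 0 \<rho>; dist z' z < e\<rbrakk>
      \<Longrightarrow> dist (f (fst z') (snd z')) (f (fst z) (snd z)) < \<rho> / 4"
    unfolding uniformly_continuous_on_def using \<rho>(1) by (metis zero_less_divide_iff zero_less_numeral)
  have near: "ball (f \<theta> 0) (\<rho>/2) \<subseteq> f \<tau> ` ball 0 r" if \<tau>: "dist \<tau> \<theta> < min e 1" for \<tau>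
  proof
    fix z assume z: "z \<in> ball (f \<theta> 0) (\<rho>/2)"
    \<comment> \<open>Its fixed points solve \<open>f \<tau> y = z\<close>. The radius
      \<open>\<rho>\<close> is shared out as a quarter for the linearisation error, a half for the
      distance of \<open>z\<close> from \<open>f \<theta> 0\<close>, and a quarter for the change
      from \<open>\<theta>\<close> to \<open>\<tau>\<close>.\<close>
    define g where "g y = y + z - f \<tau> y" for y
    have "continuous_on UNIV (f \<tau>)"
      using continuous_on_compose2[OF cont, of UNIV "\<lambda>y. (\<tau>, y)"] by (simp add: continuous_on_Pair)
    then have "continuous_on (cball 0 \<rho>) g"
      unfolding g_def by (intro continuous_intros) (auto intro: continuous_on_subset)
    moreover have "g \<in> cball 0 \<rho> \<rightarrow> cball 0 \<rho>"
    proof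
      fix y assume y: "y \<in> cball (0 :: 'a) \<rho>"
      have "dist (f \<tau> y) (f \<theta> y) < \<rho> / 4"
        using unif[of "(\<theta>, y)" "(\<tau>, y)"] y \<tau> by (auto simp: dist_Pair_Pair dist_commute)
      moreover have "norm (f \<theta> y - f \<theta> 0 - y) \<le> \<rho> / 4"
        using d(2)[of y] y \<rho> by auto
      moreover have "norm (f \<theta> 0 - z) < \<rho> / 2"
        using z by (simp add: dist_norm)
      moreover have "g y = - (f \<theta> y - f \<theta> 0 - y) - (f \<theta> 0 - z) - (f \<tau> y - f \<theta> y)"
        by (simp add: g_def)
      moreover have "norm (g y) \<le> norm (f \<theta> y - f \<theta> 0 - y) + norm (f \<theta> 0 - z) + norm (f \<tau> y - f \<theta> y)"
        unfolding calculation(4) using norm_triangle_ineq4[of "- (f \<theta> y - f \<theta> 0 - y) - (f \<theta> 0 - z)" "f \<tau> y - f \<theta> y"]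
          norm_triangle_ineq4[of "- (f \<theta> y - f \<theta> 0 - y)" "f \<theta> 0 - z"]
        unfolding norm_minus_cancel by linarith
      ultimately have "norm (g y) \<le> \<rho>"
        unfolding dist_norm by linarith
      then show "g y \<in> cball 0 \<rho>" by simp
    qed
    ultimately obtain y where "y \<in> cball 0 \<rho>" "g y = y"
      using brouwer[of "cball 0 \<rho>" g] \<rho>(1) by auto
    then show "z \<in> f \<tau> ` ball 0 r"
      using \<rho>(3) by (intro image_eqI[of _ _ y]) (auto simp: g_def)
  qed
  have "\<forall>\<^sub>F \<tau> in nhds \<theta>. dist \<tau> \<theta> < min e 1"
    using e unfolding eventually_nhds_metric by (intro exI[of _ "min e 1"]) auto
  then have "\<forall>\<^sub>F \<tau> in nhds \<theta>. ball (f \<theta> 0) (\<rho>/2) \<subseteq> f \<tau> ` ball 0 r"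
    by eventually_elim (rule near)
  then show ?thesis
    using \<rho>(1) by (intro exI[of _ "\<rho>/2"]) auto
qed

text \<open>A linear choice \<open>l\<close> of velocities inverts \<open>tangent\<close>, so the
  word with durations shifted by \<open>l y\<close>, divided by its unshifted value at
  \<open>(A, B)\<close>, has the identity as derivative at \<open>y = 0\<close>. Small shifts keep
  all durations positive.\<close>

lemma reach_near_full_rank:
  fixes A B :: "quat ^ 'n ^ 'n"
  assumes pos: "positive_word w" and full: "tangents A B w = UNIV"
  shows "\<exists>\<delta>>0. \<forall>\<^sub>F \<tau> in nhds (A, B). \<forall>z\<in>ball (mat 1) \<delta>. z ** word_val A B w \<in> reach (fst \<tau>) (snd \<tau>)"
proof -
  have "\<exists>c. tangent A B w c = b" for b
    using full unfolding tangents_def by (auto simp: surj_def) (metis surjD)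
  then obtain c where c: "\<And>b. tangent A B w (c b) = b" by metis
  define l where "l y i = (\<Sum>b\<in>Basis. (y \<bullet> b) * c b i)" for y i
  have bl: "bounded_linear (\<lambda>y. l y i)" for i
    unfolding l_def by (intro bounded_linear_sum bounded_linear_mult_const bounded_linear_inner_left)
  have l0: "l 0 = (\<lambda>_. 0)" by (simp add: l_def[abs_def])
  have tl: "tangent A B w (l y) = y" for y
  proof -
    have "tangent A B w (l y) = (\<Sum>b\<in>Basis. (y \<bullet> b) *\<^sub>R b)"
      unfolding l_def[abs_def] by (simp add: tangent_sum tangent_scale c)
    then show ?thesis by (simp add: euclidean_representation)
  qed
  define f where "f \<tau> y = word_val (fst \<tau>) (snd \<tau>) (shift_times w (l y)) ** word_inv A B w" for \<tau> y
  have "continuous_on UNIV (\<lambda>z. f (fst z) (snd z))"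
    unfolding f_def
    by (intro mm.continuous_on continuous_on_word_val continuous_intros
        bounded_linear.continuous_on[OF bl])
  moreover have "(f (A, B) has_derivative (\<lambda>y. y)) (at 0)"
  proof -
    have "((\<lambda>y. word_val A B (shift_times w (l y)) ** word_inv A B w) has_derivative
        (\<lambda>y. (tangent A B w (l y) ** word_val A B w) ** word_inv A B w)) (at 0)"
      by (rule bounded_linear.has_derivative[OF mm.bounded_linear_left word_val_has_derivative[OF bl]])
    then show ?thesis
      by (simp add: f_def[abs_def] tl matrix_mul_assoc[symmetric] word_val_inv)
  qed
  moreover obtain r where r: "r > 0" "\<And>y. y \<in> ball 0 r \<Longrightarrow> positive_word (shift_times w (l y))"
    using eventually_positive_shift[of l w, OF bl pos] unfolding eventually_nhds_metric by (auto simp: dist_commute)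
  moreover have "f (A, B) 0 = mat 1"
    by (simp add: f_def l0 word_val_inv)
  ultimately obtain \<delta> where \<delta>: "\<delta> > 0" "\<forall>\<^sub>F \<tau> in nhds (A, B). ball (mat 1) \<delta> \<subseteq> f \<tau> ` ball 0 r"
    using uniform_local_surjectivity[of f "(A, B)" r] by auto
  have "\<forall>\<^sub>F \<tau> in nhds (A, B). \<forall>z\<in>ball (mat 1) \<delta>. z ** word_val A B w \<in> reach (fst \<tau>) (snd \<tau>)"
    using \<delta>(2)
  proof eventually_elim
    case (elim \<tau>)
    show ?case
    proof
      fix z :: "quat ^ 'n ^ 'n" assume "z \<in> ball (mat 1) \<delta>"
      then obtain y where y: "y \<in> ball 0 r" "z = f \<tau> y"
        using elim by blast
      then have "z ** word_val A B w = word_val (fst \<tau>) (snd \<tau>) (shift_times w (l y))"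
        by (simp add: f_def matrix_mul_assoc[symmetric] word_val_inv)
      then show "z ** word_val A B w \<in> reach (fst \<tau>) (snd \<tau>)"
        using r(2)[OF y(1)] by (auto simp: reach_def)
    qed
  qed
  then show ?thesis using \<delta>(1) by blast
qed

text \<open>A word of maximal tangent dimension has a tangent space that contains the tangent
  space of every other word, because appending a word can only enlarge it.\<close>

lemma maximal_tangents:
  fixes A B :: "quat ^ 'n ^ 'n"
  obtains w where "positive_word w" "\<And>v. positive_word v \<Longrightarrow> tangents A B v \<subseteq> tangents A B w"
    "\<And>v Y. \<lbrakk>positive_word v; Y \<in> tangents A B w\<rbrakk> \<Longrightarrow> word_val A B v ** Y ** word_inv A B v \<in> tangents A B w"
proof -
  have "\<exists>w. positive_word w \<and> (\<forall>v. positive_word v \<longrightarrow> dim (tangents A B v) \<le> dim (tangents A B w))"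
    by (rule ex_has_greatest_nat[of positive_word "[]" "\<lambda>v. dim (tangents A B v)" "Suc DIM(quat ^ 'n ^ 'n)"])
      (auto simp only: positive_word_def list.set ball_empty intro!: le_imp_less_Suc dim_subset_UNIV)
  then obtain w where w: "positive_word w" "\<And>v. positive_word v \<Longrightarrow> dim (tangents A B v) \<le> dim (tangents A B w)" by blast
  define W where "W = tangents A B w"
  define Ad where "Ad Y = word_val A B w ** Y ** word_inv A B w" for Y
  have W: "subspace W" unfolding W_def by (rule subspace_tangents)
  have sub: "tangents A B v \<subseteq> tangents A B (v @ u)" for v u
    using tangents_append[OF _ subspace_0[OF subspace_tangents[of A B u]], of _ v] by auto
  have Ad_v: "Ad Y \<in> W" if "positive_word v" "Y \<in> tangents A B v" for v Y
  proof -
    \<comment> \<open>The longer word has no larger dimension, by maximality of \<open>w\<close>,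
      yet contains \<open>W\<close>.\<close>
    have "W = tangents A B (w @ v)"
      unfolding W_def using w that(1)
      by (intro subspace_dim_equal subspace_tangents sub) (simp add: positive_word_append)
    then show ?thesis
      using tangents_append[OF subspace_0[OF subspace_tangents] that(2), of w] by (simp add: Ad_def)
  qed
  have lin: "linear Ad"
    unfolding Ad_def by (rule linearI) (simp_all add: mm.add_left mm.add_right mm.scaleR_left mm.scaleR_right)
  have undo: "word_inv A B w ** Ad Y ** word_val A B w = Y" for Y
  proof -
    have "word_inv A B w ** Ad Y ** word_val A B w
        = (word_inv A B w ** word_val A B w) ** Y ** (word_inv A B w ** word_val A B w)"
      unfolding Ad_def by (simp only: matrix_mul_assoc)
    then show ?thesis by (simp add: word_val_inv)
  qed
  have inj: "inj Ad"
    by (rule inj_on_inverseI[of _ "\<lambda>Z. word_inv A B w ** Z ** word_val A B w"]) (rule undo)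
  \<comment> \<open>So far only conjugates of the other tangent spaces are known to lie in
    \<open>W\<close>. As \<open>Ad\<close> is injective and maps \<open>W\<close> into itself,
    equality of dimensions permits removing the conjugation.\<close>
  have AdW: "Ad ` W = W"
  proof (rule subspace_dim_equal)
    show "Ad ` W \<subseteq> W"
      using Ad_v[OF w(1)] by (auto simp: W_def)
    show "dim W \<le> dim (Ad ` W)"
      using dim_image_eq[OF lin inj_on_subset[OF inj]] by simp
  qed (auto intro: linear_subspace_image lin W)
  have all: "tangents A B v \<subseteq> W" if "positive_word v" for v
  proof
    fix Y assume "Y \<in> tangents A B v"
    then have "Ad Y \<in> Ad ` W"
      using Ad_v[OF that] AdW by simp
    then show "Y \<in> W"
      using inj by (simp add: inj_image_mem_iff)
  qed
  have "word_val A B v ** Y ** word_inv A B v \<in> W" if "positive_word v" "Y \<in> W" for v Y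
    using tangents_append[OF subspace_0[OF subspace_tangents], of Y A B w v] all[of "v @ w"] w(1) that
    by (auto simp: W_def positive_word_append)
  then show thesis
    using that w(1) all unfolding W_def by blast
qed

text \<open>Conjugation by the shear \<open>mat 1 + munit a b x\<close> is quadratic in
  \<open>x\<close>. Its odd part is the bracket with \<open>munit a b x\<close>; its even part gives
  the sandwich \<open>munit a b x ** Y ** munit a b x\<close>, which turns a nonzero entry at
  \<open>(b, a)\<close> into elements at \<open>(a, b)\<close>.\<close>

lemma Ad_invariant_subspace_UNIV:
  fixes W :: "(quat ^ 'n ^ 'n) set"
  assumes W: "subspace W" and Ad: "\<And>g h Y. \<lbrakk>g ** h = mat 1; h ** g = mat 1; Y \<in> W\<rbrakk> \<Longrightarrow> g ** Y ** h \<in> W"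
    and one: "mat 1 \<in> W" and Y: "Y \<in> W" "Y $ k $ j \<noteq> 0" "k \<noteq> j"
  shows "W = UNIV"
proof -
  have conj: "Y + munit a b x ** Y - Y ** munit a b x - munit a b x ** Y ** munit a b x \<in> W"
    if "Y \<in> W" "a \<noteq> b" for Y a b x
  proof -
    have "(mat 1 + munit a b x) ** (mat 1 - munit a b x) = mat 1" "(mat 1 - munit a b x) ** (mat 1 + munit a b x) = mat 1"
      using that(2) by (simp_all add: mm.add_left mm.add_right mm.diff_left mm.diff_right munit_mult)
    from Ad[OF this that(1)] show ?thesis
      by (simp add: mm.add_left mm.add_right mm.diff_left mm.diff_right algebra_simps)
  qed
  have bracket: "munit a b x ** Y - Y ** munit a b x \<in> W" if "Y \<in> W" "a \<noteq> b" for Y a b x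
  proof -
    have "munit a b x ** Y - Y ** munit a b x = (1/2) *\<^sub>R
        ((Y + munit a b x ** Y - Y ** munit a b x - munit a b x ** Y ** munit a b x)
        - (Y + munit a b (- x) ** Y - Y ** munit a b (- x) - munit a b (- x) ** Y ** munit a b (- x)))"
      by (simp add: munit_minus mm.minus_left mm.minus_right scaleR_2[symmetric] algebra_simps)
    then show ?thesis
      using conj[OF that, of x] conj[OF that, of "- x"] by (simp only: subspace_scale[OF W] subspace_diff[OF W])
  qed
  have sandwich: "munit a b (x * Y $ b $ a * x) \<in> W" if "Y \<in> W" "a \<noteq> b" for Y a b x
  proof -
    have "munit a b x ** Y ** munit a b x = Y + (munit a b x ** Y - Y ** munit a b x)
        - (Y + munit a b x ** Y - Y ** munit a b x - munit a b x ** Y ** munit a b x)"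
      by simp
    moreover have "\<dots> \<in> W"
      by (rule subspace_diff[OF W subspace_add[OF W that(1) bracket[OF that]] conj[OF that]])
    moreover have "munit a b x ** Y ** munit a b x = munit a b (x * Y $ b $ a * x)"
      by (auto simp: vec_eq_iff munit_times_nth times_munit_nth)
    ultimately show ?thesis by simp
  qed
  have swap: "munit a b x \<in> W" if "Y \<in> W" "a \<noteq> b" "Y $ b $ a \<noteq> 0" for Y a b x
  proof -
    define c where "c = Y $ b $ a"
    \<comment> \<open>The map \<open>x \<mapsto> x * c * x\<close> is polarised against
      \<open>inverse c\<close>, which makes the mixed term linear in \<open>x\<close> and equal to
      \<open>2 *\<^sub>R x\<close>.\<close>
    have "munit a b ((x + inverse c) * c * (x + inverse c)) - munit a b (x * c * x) - munit a b (inverse c * c * inverse c) \<in> W"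
      using sandwich[OF that(1,2)] unfolding c_def by (intro subspace_diff[OF W])
    moreover have "(x + inverse c) * c * (x + inverse c) - x * c * x - inverse c * c * inverse c = 2 *\<^sub>R x"
      using that(3) by (simp add: c_def algebra_simps scaleR_2)
    ultimately have "2 *\<^sub>R munit a b x \<in> W"
      by (simp only: munit_diff[symmetric] munit_scaleR[symmetric])
    then have "(1/2) *\<^sub>R (2 *\<^sub>R munit a b x) \<in> W"
      by (rule subspace_scale[OF W])
    then show ?thesis by simp
  qed
  have flip: "munit b a x \<in> W" if "munit a b 1 \<in> W" "a \<noteq> b" for a b x
    using swap[of "munit a b 1" b a x] that by simp
  have jk: "munit j k x \<in> W" for x
    using swap[OF Y(1)] Y by auto
  have col: "munit c k x \<in> W" if "c \<noteq> k" for c x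
    using bracket[OF jk[of x], of c j 1] jk that Y(3) by (cases "c = j") (auto simp: munit_mult)
  have row: "munit k c x \<in> W" if "c \<noteq> k" for c x
    using flip[OF col[OF that]] that by auto
  have off: "munit a b x \<in> W" if "a \<noteq> b" for a b x
  proof (cases "a = k \<or> b = k")
    case True
    then show ?thesis using col row that by auto
  next
    case False
    then show ?thesis
      using bracket[OF row[of b x], of a k 1] that by (auto simp: munit_mult)
  qed
  show ?thesis
  proof (rule subspace_munits_UNIV[OF W _ off _ one])
    have "card {j, k} \<le> CARD('n)"
      by (rule card_mono) auto
    then show "2 \<le> CARD('n)"
      using Y(3) by auto
    show "munit a a (x * y) - munit b b (y * x) \<in> W" if "a \<noteq> b" for a b x y
      using bracket[OF off[of b a y] that, of x] that by (simp add: munit_mult)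
  qed
qed

text \<open>Density enters three times: it makes the maximal tangent space conjugation invariant and
  hence full, it moves the resulting open set onto any given invertible matrix, and it thereby
  supplies a word that undoes \<open>w\<close>. The hypothesis \<open>entry\<close> provides the
  off-diagonal element for the tangent space.\<close>

lemma eventually_reach_invertible:
  fixes P Q A B :: "quat ^ 'n ^ 'n"
  assumes dense: "{g. invertible g} \<subseteq> closure (reach A B)"
    and PQ: "P ** Q = mat 1" "Q ** P = mat 1" and entry: "(Q ** A ** P) $ k $ j \<noteq> 0" "k \<noteq> j"
  shows "\<forall>\<^sub>F \<tau> in nhds (A, B). {g. invertible g} \<subseteq> reach (fst \<tau>) (snd \<tau>)"
proof -
  obtain w where w: "positive_word w" and sub: "\<And>v. positive_word v \<Longrightarrow> tangents A B v \<subseteq> tangents A B w"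
    and inv: "\<And>v Y. \<lbrakk>positive_word v; Y \<in> tangents A B w\<rbrakk> \<Longrightarrow> word_val A B v ** Y ** word_inv A B v \<in> tangents A B w"
    using maximal_tangents[of A B] by blast
  define W where "W = tangents A B w"
  have W: "subspace W" unfolding W_def by (rule subspace_tangents)
  have let_mem: "letter A B (1, u, v) \<in> W" for u v
  proof -
    have "tangent A B [(1, u, v)] (\<lambda>_. 1) \<in> tangents A B [(1, u, v)]"
      unfolding tangents_def by (rule rangeI)
    also have "\<dots> \<subseteq> W"
      unfolding W_def by (rule sub) (simp add: positive_word_def)
    finally show ?thesis by simp
  qed
  have A: "A \<in> W" using let_mem[of 0 0] by (simp add: letter_def)
  have one: "mat 1 \<in> W"
    using subspace_diff[OF W let_mem[of 0 1] let_mem[of 0 0]] by (simp add: letter_def)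
  have seq: "\<exists>s. (\<forall>n. positive_word (s n)) \<and> (\<lambda>n. word_val A B (s n)) \<longlonglongrightarrow> g \<and> (\<lambda>n. word_inv A B (s n)) \<longlonglongrightarrow> h"
    if "g ** h = mat 1" "h ** g = mat 1" for g h
  proof -
    have "g \<in> closure (reach A B)"
      using dense that by (auto simp: invertible_def)
    then obtain x where x: "\<And>n. x n \<in> reach A B" "x \<longlonglongrightarrow> g"
      unfolding closure_sequential by blast
    then obtain s where s: "\<And>n. positive_word (s n)" "\<And>n. x n = word_val A B (s n)"
      unfolding reach_def image_iff by (metis (mono_tags) mem_Collect_eq)
    have lim: "(\<lambda>n. word_val A B (s n)) \<longlonglongrightarrow> g"
    proof -
      have "x = (\<lambda>n. word_val A B (s n))"
        using s(2) by (rule ext)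
      then show ?thesis using x(2) by (simp only:)
    qed
    have "(\<lambda>n. word_inv A B (s n)) \<longlonglongrightarrow> h"
      by (rule tendsto_matrix_inverse[OF lim word_val_inv(2) that(1)])
    then show ?thesis
      using s(1) lim by (intro exI[of _ s] conjI allI)
  qed
  \<comment> \<open>Invariance under conjugation by words passes to limits because \<open>W\<close>
    is closed, and limits of words reach every invertible matrix.\<close>
  have Ad: "g ** Y ** h \<in> W" if gh: "g ** h = mat 1" "h ** g = mat 1" and Y: "Y \<in> W" for g h Y
  proof -
    obtain s where s: "\<And>n. positive_word (s n)" "(\<lambda>n. word_val A B (s n)) \<longlonglongrightarrow> g" "(\<lambda>n. word_inv A B (s n)) \<longlonglongrightarrow> h"
      using seq[OF gh] by blast
    have "(\<lambda>n. word_val A B (s n) ** Y ** word_inv A B (s n)) \<longlonglongrightarrow> g ** Y ** h"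
      by (intro mm.tendsto s tendsto_const)
    moreover have "word_val A B (s n) ** Y ** word_inv A B (s n) \<in> W" for n
      using inv[OF s(1)] Y by (simp add: W_def)
    ultimately show ?thesis
      by (rule closed_sequentially[OF closed_subspace[OF W], rotated])
  qed
  have "Q ** A ** P \<in> W"
    using Ad[OF PQ(2,1) A] .
  then have full: "tangents A B w = UNIV"
    using Ad_invariant_subspace_UNIV[OF W Ad one _ entry] by (simp add: W_def)
  have all: "g \<in> reach A B" if g: "g ** g' = mat 1" "g' ** g = mat 1" for g g'
  proof -
    obtain \<delta> where \<delta>: "\<delta> > 0" "\<And>z. z \<in> ball (mat 1) \<delta> \<Longrightarrow> z ** word_val A B w \<in> reach A B"
      using reach_near_full_rank[OF w full] eventually_nhds_x_imp_x by fastforce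
    \<comment> \<open>A word \<open>s n\<close> close to \<open>a\<close> gives \<open>g\<close> as
      the product of \<open>s n\<close>, a factor \<open>s n\<close> inverse times \<open>a\<close>
      close to \<open>mat 1\<close>, and \<open>w\<close>; the last two together lie in the covered
      neighbourhood.\<close>
    define a b where "a = g ** word_inv A B w" and "b = word_val A B w ** g'"
    have "a ** b = g ** (word_inv A B w ** word_val A B w) ** g'" "b ** a = word_val A B w ** (g' ** g) ** word_inv A B w"
      by (simp_all only: a_def b_def matrix_mul_assoc)
    then have ab: "a ** b = mat 1" "b ** a = mat 1"
      by (simp_all add: word_val_inv g)
    obtain s where s: "\<And>n. positive_word (s n)" "(\<lambda>n. word_inv A B (s n)) \<longlonglongrightarrow> b"
      using seq[OF ab] by blast
    have "(\<lambda>n. word_inv A B (s n) ** a) \<longlonglongrightarrow> b ** a"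
      by (intro mm.tendsto s tendsto_const)
    then have "\<forall>\<^sub>F n in sequentially. dist (word_inv A B (s n) ** a) (mat 1) < \<delta>"
      using \<delta>(1) unfolding ab by (rule tendstoD)
    then obtain n where "dist (word_inv A B (s n) ** a) (mat 1) < \<delta>"
      using eventually_happens'[OF sequentially_bot] by blast
    then have "word_inv A B (s n) ** a ** word_val A B w \<in> reach A B"
      by (intro \<delta>(2)) (simp add: dist_commute)
    then have "word_val A B (s n) ** (word_inv A B (s n) ** a ** word_val A B w) \<in> reach A B"
      by (rule reach_mult[rotated]) (simp add: reach_def s(1))
    moreover have "word_val A B (s n) ** (word_inv A B (s n) ** a ** word_val A B w)
        = (word_val A B (s n) ** word_inv A B (s n)) ** g ** (word_inv A B w ** word_val A B w)"
      unfolding a_def by (simp only: matrix_mul_assoc)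
    ultimately show ?thesis
      by (simp add: word_val_inv)
  qed
  \<comment> \<open>Now that the inverse of \<open>w\<close> is the value of some word
    \<open>v\<close>, the loop \<open>w @ v\<close> returns to \<open>mat 1\<close> and inherits
    full rank from \<open>w\<close>. The covered ball is thereby centred at
    \<open>mat 1\<close>.\<close>
  have "word_inv A B w \<in> reach A B"
    by (rule all[of _ "word_val A B w"]) (simp_all add: word_val_inv)
  then obtain v where v: "positive_word v" "word_inv A B w = word_val A B v"
    by (auto simp: reach_def)
  have "tangents A B w \<subseteq> tangents A B (w @ v)"
    using tangents_append[OF _ subspace_0[OF subspace_tangents[of A B v]], of _ w] by auto
  then have "tangents A B (w @ v) = UNIV"
    using full by auto
  moreover have "word_val A B (w @ v) = mat 1"
    by (simp add: word_val_append v(2)[symmetric] word_val_inv)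
  ultimately obtain \<delta> where \<delta>: "\<delta> > 0" "\<forall>\<^sub>F \<tau> in nhds (A, B). \<forall>z\<in>ball (mat 1) \<delta>. z \<in> reach (fst \<tau>) (snd \<tau>)"
    using reach_near_full_rank[of "w @ v" A B] w v(1) by (auto simp: positive_word_append)
  show ?thesis
    using \<delta>(2)
  proof eventually_elim
    case (elim \<tau>)
    have pow: "matrix_power x m \<in> reach (fst \<tau>) (snd \<tau>)" if "x \<in> reach (fst \<tau>) (snd \<tau>)" for x m
      using that by (induction m) (auto intro: reach_one reach_mult)
    show ?case
    proof (rule semigroup_exp_imp_invertible[OF reach_mult])
      fix X :: "quat ^ 'n ^ 'n"
      \<comment> \<open>Every exponential is a power of one inside the ball about
        \<open>mat 1\<close>, with the same ball for all \<open>\<tau>\<close> near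
        \<open>(A, B)\<close>.\<close>
      have "(\<lambda>m. inverse (real (Suc m)) *\<^sub>R X) \<longlonglongrightarrow> 0 *\<^sub>R X"
        by (intro tendsto_scaleR LIMSEQ_inverse_real_of_nat tendsto_const)
      from isCont_tendsto_compose[OF isCont_matrix_exp this]
      have "(\<lambda>m. matrix_exp (inverse (real (Suc m)) *\<^sub>R X)) \<longlonglongrightarrow> matrix_exp 0"
        by simp
      then have "\<forall>\<^sub>F m in sequentially. dist (matrix_exp (inverse (real (Suc m)) *\<^sub>R X)) (matrix_exp 0) < \<delta>"
        using \<delta>(1) by (rule tendstoD)
      then obtain m where "dist (matrix_exp (inverse (real (Suc m)) *\<^sub>R X)) (mat 1) < \<delta>"
        using eventually_happens'[OF sequentially_bot] unfolding matrix_exp_0 by blast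
      then have "matrix_exp (inverse (real (Suc m)) *\<^sub>R X) \<in> reach (fst \<tau>) (snd \<tau>)"
        using elim by (simp add: dist_commute)
      from pow[OF this, of "Suc m"] show "matrix_exp X \<in> reach (fst \<tau>) (snd \<tau>)"
        unfolding matrix_exp_power by (simp del: of_nat_Suc)
    qed
  qed
qed

section \<open>Similarity, and the way back to the control semigroup\<close>

lemma matrix_exp_conj:
  fixes P Q X :: "quat ^ 'n ^ 'n"
  assumes "P ** Q = mat 1" "Q ** P = mat 1"
  shows "matrix_exp (P ** X ** Q) = P ** matrix_exp X ** Q"
proof -
  have "((\<lambda>s. P ** matrix_exp (s *\<^sub>R X) ** Q) has_vector_derivative P ** X ** Q ** (P ** matrix_exp (s *\<^sub>R X) ** Q)) (at s)" for s
  proof -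
    have "P ** X ** Q ** (P ** matrix_exp (s *\<^sub>R X) ** Q) = P ** X ** (Q ** P) ** matrix_exp (s *\<^sub>R X) ** Q"
      by (simp only: matrix_mul_assoc)
    also have "\<dots> = P ** (X ** matrix_exp (s *\<^sub>R X)) ** Q"
      by (simp add: assms matrix_mul_assoc)
    finally show ?thesis
      using bounded_linear.has_vector_derivative[OF mm.bounded_linear_left
          bounded_linear.has_vector_derivative[OF mm.bounded_linear_right matrix_exp_deriv[of X s]], of P Q] by simp
  qed
  then have "matrix_exp (1 *\<^sub>R (P ** X ** Q)) = P ** matrix_exp (1 *\<^sub>R X) ** Q"
    by (rule matrix_exp_unique) (simp add: assms)
  then show ?thesis by simp
qed

lemma word_val_conj:
  fixes P Q A B :: "quat ^ 'n ^ 'n"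
  assumes PQ: "P ** Q = mat 1" "Q ** P = mat 1"
  shows "word_val (P ** A ** Q) (P ** B ** Q) w = P ** word_val A B w ** Q"
proof (induction w)
  case (Cons x w)
  have "fst x *\<^sub>R letter (P ** A ** Q) (P ** B ** Q) x = P ** (fst x *\<^sub>R letter A B x) ** Q"
    using PQ(1) by (simp add: letter_def mm.add_left mm.add_right mm.scaleR_left mm.scaleR_right)
  then have "word_val (P ** A ** Q) (P ** B ** Q) (x # w)
      = P ** matrix_exp (fst x *\<^sub>R letter A B x) ** Q ** (P ** word_val A B w ** Q)"
    by (simp add: Cons matrix_exp_conj[OF PQ])
  also have "\<dots> = P ** matrix_exp (fst x *\<^sub>R letter A B x) ** (Q ** P) ** word_val A B w ** Q"
    by (simp only: matrix_mul_assoc)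
  finally show ?case
    by (simp add: PQ matrix_mul_assoc)
qed (simp add: PQ)

lemma closure_reach_conj:
  fixes P Q A B :: "quat ^ 'n ^ 'n"
  assumes PQ: "P ** Q = mat 1" "Q ** P = mat 1" and dense: "{g. invertible g} \<subseteq> closure (reach A B)"
  shows "{g. invertible g} \<subseteq> closure (reach (P ** A ** Q) (P ** B ** Q))"
proof
  fix g :: "quat ^ 'n ^ 'n" assume "g \<in> {g. invertible g}"
  then obtain g' where g: "g ** g' = mat 1" "g' ** g = mat 1" by (auto simp: invertible_def)
  have "(Q ** g ** P) ** (Q ** g' ** P) = Q ** g ** (P ** Q) ** g' ** P"
    "(Q ** g' ** P) ** (Q ** g ** P) = Q ** g' ** (P ** Q) ** g ** P"
    by (simp_all only: matrix_mul_assoc)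
  moreover have "Q ** g ** g' ** P = Q ** (g ** g') ** P" "Q ** g' ** g ** P = Q ** (g' ** g) ** P"
    by (simp_all only: matrix_mul_assoc)
  ultimately have "invertible (Q ** g ** P)"
    unfolding invertible_def by (intro exI[of _ "Q ** g' ** P"]) (simp add: PQ g)
  then have "Q ** g ** P \<in> closure (reach A B)"
    using dense by auto
  then obtain x where x: "\<And>n. x n \<in> reach A B" "x \<longlonglongrightarrow> Q ** g ** P"
    unfolding closure_sequential by blast
  have "(\<lambda>n. P ** x n ** Q) \<longlonglongrightarrow> P ** (Q ** g ** P) ** Q"
    by (intro mm.tendsto x tendsto_const)
  moreover have "P ** (Q ** g ** P) ** Q = (P ** Q) ** g ** (P ** Q)"
    by (simp only: matrix_mul_assoc)
  moreover have "P ** x n ** Q \<in> reach (P ** A ** Q) (P ** B ** Q)" for n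
    using x(1)[of n] by (auto simp: reach_def word_val_conj[OF PQ, symmetric])
  ultimately show "g \<in> closure (reach (P ** A ** Q) (P ** B ** Q))"
    unfolding closure_sequential by (intro exI[of _ "\<lambda>n. P ** x n ** Q"]) (simp add: PQ)
qed

lemma matrix_exp_add_scalar: "matrix_exp (X + v *\<^sub>R mat 1) = exp v *\<^sub>R matrix_exp X" for X :: "quat ^ 'n ^ 'n"
proof -
  have "((\<lambda>s. exp (s * v) *\<^sub>R matrix_exp (s *\<^sub>R X)) has_vector_derivative
      (X + v *\<^sub>R mat 1) ** (exp (s * v) *\<^sub>R matrix_exp (s *\<^sub>R X))) (at s)" for s
  proof -
    have "((\<lambda>s. exp (s * v)) has_real_derivative exp (s * v) * v) (at s)"
      by (auto intro!: derivative_eq_intros)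
    from has_vector_derivative_scaleR[OF this matrix_exp_deriv[of X s]] show ?thesis
      by (simp add: mm.add_left mm.scaleR_left mm.scaleR_right scaleR_add_right mult.commute)
  qed
  then have "matrix_exp (1 *\<^sub>R (X + v *\<^sub>R mat 1)) = exp (1 * v) *\<^sub>R matrix_exp (1 *\<^sub>R X)"
    by (rule matrix_exp_unique) simp
  then show ?thesis by simp
qed

lemma reach_control_semigroup:
  assumes "g \<in> reach A B"
  obtains r s where "0 < r" "s \<in> control_semigroup A B" "g = r *\<^sub>R s"
proof -
  have "\<exists>r s. 0 < r \<and> s \<in> control_semigroup A B \<and> word_val A B w = r *\<^sub>R s" if "positive_word w" for w
    using that
  proof (induction w)
    case Nil
    have "mat 1 \<in> control_semigroup A B"
      using control_semigroup.generator[of 0 A 0 B] by simp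
    then show ?case
      by (intro exI[of _ 1] exI[of _ "mat 1"]) simp
  next
    case (Cons x w)
    then obtain r s where rs: "0 < r" "s \<in> control_semigroup A B" "word_val A B w = r *\<^sub>R s"
      by (auto simp: positive_word_def)
    define e where "e = matrix_exp (fst x *\<^sub>R (A + fst (snd x) *\<^sub>R B))"
    have "fst x *\<^sub>R letter A B x = fst x *\<^sub>R (A + fst (snd x) *\<^sub>R B) + (fst x * snd (snd x)) *\<^sub>R mat 1"
      by (simp add: letter_def scaleR_add_right)
    then have "word_val A B (x # w) = (exp (fst x * snd (snd x)) * r) *\<^sub>R (e ** s)"
      by (simp add: rs matrix_exp_add_scalar e_def mm.scaleR_left mm.scaleR_right)
    moreover have "e ** s \<in> control_semigroup A B"
      unfolding e_def using rs Cons.prems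
      by (intro control_semigroup.mult control_semigroup.generator) (auto simp: positive_word_def)
    ultimately show ?case
      using rs(1) by (intro exI[of _ "exp (fst x * snd (snd x)) * r"] exI[of _ "e ** s"]) simp
  qed
  then show thesis
    using assms that by (auto simp: reach_def)
qed

text \<open>An element of \<open>SL_H\<close> is reached up to a positive factor \<open>r\<close> by
  the control semigroup. Both matrices have real determinant 1, so
  \<open>r ^ (CARD('n) * 4) = 1\<close> and \<open>r = 1\<close>.\<close>

lemma controllable_if_reach:
  fixes A B :: "quat ^ 'n ^ 'n"
  assumes sl: "A \<in> sl_H" "B \<in> sl_H" and reach: "{g. invertible g} \<subseteq> reach A B"
  shows "controllable A B"
  unfolding controllable_def
proof
  show sub: "control_semigroup A B \<subseteq> SL_H"
    by (rule control_semigroup_subset_SL[OF sl])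
  show "SL_H \<subseteq> control_semigroup A B"
  proof
    fix g :: "quat ^ 'n ^ 'n" assume g: "g \<in> SL_H"
    then have "g \<in> reach A B"
      using reach by (auto simp: SL_H_def)
    then obtain r s where rs: "0 < r" "s \<in> control_semigroup A B" "g = r *\<^sub>R s"
      by (rule reach_control_semigroup)
    have "real_det s = 1" "real_det g = 1"
      using sub rs(2) g by (auto simp: SL_H_def)
    then have "r ^ (CARD('n) * 4) = 1"
      using real_det_scaleR[of r s] rs(3) by simp
    then have "r = 1"
      using power_eq_1_iff[of r "CARD('n) * 4"] rs(1) by (auto simp: power_eq_1_iff)
    then show "g \<in> control_semigroup A B"
      using rs by simp
  qed
qed

section \<open>Density of diagonalizable matrices\<close>

definition cquat :: "complex \<Rightarrow> quat" where
  "cquat z = Quat (Re z) (Im z) 0 0"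

lemma cquat_simps: "cquat (x + y) = cquat x + cquat y" "cquat (x * y) = cquat x * cquat y"
  "cquat (- x) = - cquat x" "cquat (x - y) = cquat x - cquat y" "cquat 0 = 0" "cquat 1 = 1" "cquat (of_real r) = of_real r"
  "cquat z = 0 \<longleftrightarrow> z = 0"
  by (simp_all add: cquat_def quat_eq_iff complex_eq_iff of_real_def)

lemma complex_cquat [simp]: "complex_quat (cquat z)"
  by (simp add: cquat_def complex_quat_def)

text \<open>Columns form a right quaternionic space, on which matrices act linearly from the left;
  eigenvalues are accordingly right eigenvalues.\<close>

definition rscale :: "quat ^ 'n \<Rightarrow> quat \<Rightarrow> quat ^ 'n" where
  "rscale v x = (\<chi> i. v $ i * x)"

lemma rscale_simps: "rscale (v + w) x = rscale v x + rscale w x" "rscale (v - w) x = rscale v x - rscale w x"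
  "rscale v (x + y) = rscale v x + rscale v y" "rscale v (x - y) = rscale v x - rscale v y"
  "rscale (rscale v x) y = rscale v (x * y)" "rscale v 0 = 0" "rscale 0 x = 0" "rscale v 1 = v"
  "rscale v (of_real r) = r *\<^sub>R v"
  by (simp_all add: rscale_def vec_eq_iff algebra_simps mult.assoc of_real_def)

lemma rscale_sum: "rscale (sum f A) x = (\<Sum>i\<in>A. rscale (f i) x)"
  by (induction A rule: infinite_finite_induct) (simp_all add: rscale_simps)

lemma rscale_eq_0: "x \<noteq> 0 \<Longrightarrow> rscale v x = 0 \<longleftrightarrow> v = 0"
  by (simp add: rscale_def vec_eq_iff)

lemma matrix_rscale: "M *v rscale v x = rscale (M *v v) x"
  by (simp add: rscale_def vec_eq_iff matrix_vector_mult_def sum_distrib_right mult.assoc)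

lemma real_linear_dependence:
  fixes f :: "nat \<Rightarrow> 'a :: euclidean_space"
  obtains c :: "nat \<Rightarrow> real" and n where "\<exists>k\<le>n. c k \<noteq> 0" "(\<Sum>k\<le>n. c k *\<^sub>R f k) = 0"
proof -
  define n where "n = DIM('a)"
  show thesis
  proof (cases "inj_on f {..n}")
    case True
    then have "card (f ` {..n}) = Suc n"
      by (simp add: card_image)
    then have "dependent (f ` {..n})"
      by (intro dependent_biggerset) (auto simp: n_def)
    then obtain u where u: "\<exists>v\<in>f ` {..n}. u v \<noteq> 0" "(\<Sum>v\<in>f ` {..n}. u v *\<^sub>R v) = 0"
      by (auto simp: dependent_finite)
    have "(\<Sum>k\<le>n. u (f k) *\<^sub>R f k) = 0"
      using u(2) by (simp add: sum.reindex[OF True])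
    then show thesis
      using u(1) that[of n "\<lambda>k. u (f k)"] by auto
  next
    case False
    then obtain i j where ij: "i \<le> n" "j \<le> n" "i \<noteq> j" "f i = f j"
      by (auto simp: inj_on_def)
    define c where "c k = (if k = i then 1 else if k = j then - 1 else (0::real))" for k
    have "(\<Sum>k\<le>n. c k *\<^sub>R f k) = (\<Sum>k\<in>{i, j}. c k *\<^sub>R f k)"
      by (rule sum.mono_neutral_right) (use ij in \<open>auto simp: c_def\<close>)
    also have "\<dots> = 0"
      using ij by (simp add: c_def)
    finally have "(\<Sum>k\<le>n. c k *\<^sub>R f k) = 0" .
    moreover have "\<exists>k\<le>n. c k \<noteq> 0"
      using ij(1) by (intro exI[of _ i]) (simp add: c_def)
    ultimately show thesis
      using that by blast
  qed
qed

text \<open>A complex polynomial \<open>p\<close> acts on right vector spaces by \<open>y \<mapsto> \<Sum>k. N\<^sup>k y p\<^sub>k\<close>. If \<open>p\<close> has minimal degree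
  among the nonzero polynomials annihilating some nonzero vector, the cofactor of a linear factor of
  \<open>p\<close> produces an eigenvector.\<close>

lemma eigenvector_exists:
  fixes N :: "quat ^ 'n \<Rightarrow> quat ^ 'n"
  assumes lin: "linear N" and N_rscale: "\<And>v x. N (rscale v x) = rscale (N v) x"
    and Y: "subspace Y" "\<And>v. v \<in> Y \<Longrightarrow> N v \<in> Y" "\<And>v z. v \<in> Y \<Longrightarrow> rscale v (cquat z) \<in> Y"
    and y0: "y0 \<in> Y" "y0 \<noteq> 0"
  obtains y z where "y \<in> Y" "y \<noteq> 0" "N y = rscale y (cquat z)"
proof -
  \<comment> \<open>The cut-off \<open>n\<close> may exceed the degree, which lets a polynomial and
    its cofactor be compared term by term.\<close>
  define ev where "ev p n y = (\<Sum>k<n. (N ^^ k) (rscale y (cquat (coeff p k))))" for p n y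
  define ann where "ann p \<longleftrightarrow> p \<noteq> 0 \<and> (\<exists>y\<in>Y. y \<noteq> 0 \<and> ev p (Suc (degree p)) y = 0)" for p
  have Npow: "linear (N ^^ k)" for k
  proof (induction k)
    case (Suc k)
    then show ?case
      using linear_compose[OF Suc lin] by (simp add: o_def)
  qed (simp add: id_def linear_ident)
  have Npow_rscale: "(N ^^ k) (rscale v x) = rscale ((N ^^ k) v) x" for k v x
    by (induction k) (simp_all add: N_rscale)
  have Npow_Y: "(N ^^ k) v \<in> Y" if "v \<in> Y" for k v
    using that by (induction k) (simp_all add: Y(2))
  have evY: "ev p n y \<in> Y" if "y \<in> Y" for p n y
    unfolding ev_def by (intro subspace_sum[OF Y(1)] Npow_Y Y(3) that)
  have ev_ext: "ev p n y = ev p m y" if "degree p < n" "n \<le> m" for p n m y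
    unfolding ev_def using that
    by (intro sum.mono_neutral_left) (auto simp: coeff_eq_0 cquat_simps rscale_simps linear_0[OF Npow])
  \<comment> \<open>The iterates of \<open>y0\<close> are dependent over the reals in a
    finite-dimensional space; the coefficients of a dependence form an annihilating
    polynomial.\<close>
  have "\<exists>p. ann p"
  proof -
    obtain c n where c: "\<exists>k\<le>n. c k \<noteq> 0" "(\<Sum>k\<le>n. c k *\<^sub>R (N ^^ k) y0) = 0"
      using real_linear_dependence[of "\<lambda>k. (N ^^ k) y0"] by blast
    define p where "p = (\<Sum>k\<le>n. monom (complex_of_real (c k)) k)"
    have coeff: "coeff p k = (if k \<le> n then complex_of_real (c k) else 0)" for k
      unfolding p_def coeff_sum by (simp add: if_distrib sum.delta cong: if_cong)
    have "p \<noteq> 0"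
    proof
      assume "p = 0"
      then have "coeff p k = 0" for k by simp
      then show False using c(1) unfolding coeff by (metis of_real_eq_0_iff)
    qed
    moreover have "degree p \<le> n"
      by (rule degree_le) (simp add: coeff)
    then have "ev p (Suc (degree p)) y0 = ev p (Suc n) y0"
      by (intro ev_ext) auto
    moreover have "ev p (Suc n) y0 = (\<Sum>k\<le>n. c k *\<^sub>R (N ^^ k) y0)"
      unfolding ev_def lessThan_Suc_atMost
      by (rule sum.cong) (simp_all add: coeff cquat_simps rscale_simps linear_scale[OF Npow])
    ultimately show ?thesis
      using c(2) y0 by (auto simp: ann_def)
  qed
  then obtain p where p: "ann p" and min: "\<And>q. degree q < degree p \<Longrightarrow> \<not> ann q"
    using exists_least_iff[of "\<lambda>d. \<exists>p. ann p \<and> degree p = d"] by metis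
  then obtain y where y: "y \<in> Y" "y \<noteq> 0" "ev p (Suc (degree p)) y = 0" and "p \<noteq> 0"
    by (auto simp: ann_def)
  have "degree p \<noteq> 0"
  proof
    assume "degree p = 0"
    then have "rscale y (cquat (coeff p 0)) = 0"
      using y(3) by (simp add: ev_def)
    moreover have "coeff p 0 \<noteq> 0"
      using \<open>p \<noteq> 0\<close> \<open>degree p = 0\<close> by (metis leading_coeff_0_iff)
    ultimately show False
      using y(2) by (simp add: rscale_eq_0 cquat_simps)
  qed
  then have "\<not> constant (poly p)"
    by (simp add: constant_degree)
  then obtain z where "poly p z = 0"
    using fundamental_theorem_of_algebra by blast
  then obtain q where q: "p = [:- z, 1:] * q"
    by (auto simp: poly_eq_0_iff_dvd)
  have q0: "q \<noteq> 0" using q \<open>p \<noteq> 0\<close> by auto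
  have deg: "degree p = Suc (degree q)"
    unfolding q using q0 by (subst degree_mult_eq) auto
  define n where "n = Suc (degree q)"
  define w where "w = ev q n y"
  have "w \<in> Y" unfolding w_def by (rule evY[OF y(1)])
  \<comment> \<open>Otherwise the cofactor \<open>q\<close>, of smaller degree, would annihilate the
    nonzero vector \<open>y\<close>.\<close>
  have "w \<noteq> 0"
    using min[of q] deg y(1,2) q0 by (auto simp: ann_def w_def n_def)
  have c0: "coeff p 0 = - (z * coeff q 0)"
    unfolding q by (simp add: coeff_mult)
  have cS: "coeff p (Suc k) = coeff q k - z * coeff q (Suc k)" for k
    unfolding q by simp
  have "ev p (Suc n) y = N w - rscale w (cquat z)"
  proof -
    have Nw: "N w = (\<Sum>k<n. (N ^^ Suc k) (rscale y (cquat (coeff q k))))"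
      unfolding w_def ev_def by (simp add: linear_sum[OF lin])
    have wz: "rscale w (cquat z) = (\<Sum>k<Suc n. (N ^^ k) (rscale y (cquat (z * coeff q k))))"
    proof -
      have "w = ev q (Suc n) y"
        unfolding w_def by (rule ev_ext) (simp_all add: n_def)
      then show ?thesis
        by (simp add: ev_def rscale_sum Npow_rscale[symmetric] rscale_simps(5) cquat_simps(2)[symmetric] mult.commute del: sum.lessThan_Suc)
    qed
    have 1: "(N ^^ Suc k) (rscale y (cquat (coeff p (Suc k)))) = (N ^^ Suc k) (rscale y (cquat (coeff q k)))
        - (N ^^ Suc k) (rscale y (cquat (z * coeff q (Suc k))))" for k
      unfolding cS cquat_simps(4) rscale_simps(4) by (rule linear_diff[OF Npow])
    have 2: "(N ^^ 0) (rscale y (cquat (coeff p 0))) = - (N ^^ 0) (rscale y (cquat (z * coeff q 0)))"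
      unfolding c0 cquat_simps(3) by (simp add: rscale_def vec_eq_iff)
    show ?thesis
      unfolding ev_def wz sum.lessThan_Suc_shift 1 2 Nw by (simp add: sum_subtractf)
  qed
  then have "N w = rscale w (cquat z)"
    using y(3) by (simp add: deg n_def)
  then show thesis
    using that \<open>w \<in> Y\<close> \<open>w \<noteq> 0\<close> by blast
qed

section \<open>Diagonalization after a small perturbation\<close>

lemma qRe_mult_commute: "qRe (x * y) = qRe (y * x)"
  by simp

text \<open>A nonzero kernel element would conjugate \<open>m\<close> into \<open>l\<close> and
  force equal real parts; an injective linear endomorphism in finite dimension is onto.\<close>

lemma sylvester_solvable:
  assumes "qRe l \<noteq> qRe m"
  obtains x :: quat where "x * m - l * x = c"
proof -
  define f where "f x = x * m - l * x" for x
  have lin: "linear f"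
    unfolding f_def by (rule linearI) (simp_all add: algebra_simps)
  have "f x \<noteq> 0" if "x \<noteq> 0" for x
  proof
    assume "f x = 0"
    then have "l * x = x * m" by (simp add: f_def)
    then have "l = x * m * inverse x"
      using that by (metis mult.assoc mult.right_neutral right_inverse)
    moreover have "qRe (x * m * inverse x) = qRe (inverse x * (x * m))"
      by (rule qRe_mult_commute)
    then have "qRe (x * m * inverse x) = qRe m"
      using that by (simp add: mult.assoc[symmetric])
    ultimately show False using assms by simp
  qed
  then have "inj f"
    using linear_injective_0[OF lin] by blast
  then have "surj f"
    by (rule linear_inj_imp_surj[OF lin])
  then show thesis
    using that unfolding f_def surj_def by metis
qed

lemma small_nonmember:
  assumes "finite F" "0 < e"
  obtains d :: real where "0 < d" "d < e" "d \<notin> F"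
proof -
  have "infinite ({0<..<e} - F)"
    using assms by (simp add: infinite_Ioo)
  then obtain d where "d \<in> {0<..<e} - F"
    by (metis all_not_in_conv finite.emptyI)
  then show thesis using that by auto
qed

definition col_at :: "'n \<Rightarrow> quat ^ 'n \<Rightarrow> quat ^ 'n ^ 'n" where
  "col_at j u = (\<chi> a b. if b = j then u $ a else 0)"

lemma col_at_vector: "col_at j u *v w = rscale u (w $ j)"
  by (simp add: vec_eq_iff col_at_def rscale_def matrix_vector_mult_def if_distrib[of "\<lambda>z. z * _"] sum.delta cong: if_cong)

lemma linear_matrix_vector: "linear ((*v) M)" for M :: "quat ^ 'n ^ 'n"
  by (rule matrix_vector_mul_linear)

lemma rscale_axis: "rscale (axis i x) y = axis i (x * y)"
  by (simp add: vec_eq_iff rscale_def axis_def)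

text \<open>An eigenvector \<open>y\<close> of the compression \<open>N\<close>, that is, modulo the
  axes in \<open>K\<close>, is found first. A rank one perturbation moves its eigenvalue away from
  the real parts already used, and this gap makes the Sylvester equations solvable that correct
  \<open>y\<close> to a true eigenvector \<open>v\<close>.\<close>

lemma diagonalize_step:
  fixes B P Q :: "quat ^ 'n ^ 'n"
  assumes PQ: "P ** Q = mat 1" "Q ** P = mat 1" and K: "K \<noteq> UNIV"
    and eig: "\<And>i. i \<in> K \<Longrightarrow> (Q ** B ** P) *v axis i 1 = axis i (lam i)"
    and lam: "\<And>i. i \<in> K \<Longrightarrow> complex_quat (lam i)" "inj_on (\<lambda>i. qRe (lam i)) K" and e: "0 < e"
  obtains B' P' Q' lam' j where "j \<notin> K" "dist B' B < e" "P' ** Q' = mat 1" "Q' ** P' = mat 1"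
    "\<And>i. i \<in> insert j K \<Longrightarrow> (Q' ** B' ** P') *v axis i 1 = axis i (lam' i)"
    "\<And>i. i \<in> insert j K \<Longrightarrow> complex_quat (lam' i)" "inj_on (\<lambda>i. qRe (lam' i)) (insert j K)"
proof -
  define M where "M = Q ** B ** P"
  define Y where "Y = {v :: quat ^ 'n. \<forall>i\<in>K. v $ i = 0}"
  define N where "N v = (\<chi> i. if i \<in> K then 0 else (M *v v) $ i)" for v
  obtain k where k: "k \<notin> K" using K by blast
  obtain y z where y: "y \<in> Y" "y \<noteq> 0" "N y = rscale y (cquat z)"
  proof (rule eigenvector_exists[of N Y "axis k 1"])
    show "linear N"
      by (rule linearI) (simp_all add: N_def vec_eq_iff linear_add[OF linear_matrix_vector] linear_scale[OF linear_matrix_vector])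
    show "N (rscale v x) = rscale (N v) x" for v x
      unfolding N_def matrix_rscale by (simp add: rscale_def vec_eq_iff)
    show "subspace Y"
      by (auto simp: Y_def subspace_def)
    show "axis k 1 \<noteq> (0 :: quat ^ 'n)"
      by (metis axis_nth zero_index zero_neq_one)
    show "axis k 1 \<in> Y"
      using k by (auto simp: Y_def axis_def)
  qed (auto simp: Y_def N_def rscale_def)
  obtain j where j: "y $ j \<noteq> 0" using y(2) by (auto simp: vec_eq_iff)
  have jK: "j \<notin> K" using j y(1) by (auto simp: Y_def)
  \<comment> \<open>Chosen so that \<open>E\<close> fixes \<open>y\<close> and kills every axis
    other than \<open>j\<close>; adding \<open>d *\<^sub>R E\<close> shifts the eigenvalue of
    \<open>y\<close> by \<open>d\<close> and leaves the eigenvectors in \<open>K\<close>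
    alone.\<close>
  define E where "E = col_at j (rscale y (inverse (y $ j)))"
  define C where "C = norm (P ** E ** Q)"
  have C: "0 \<le> C" by (simp add: C_def)
  obtain d where d: "0 < d" "d < e / (C + 1)" "d \<notin> (\<lambda>i. qRe (lam i) - Re z) ` K"
    using small_nonmember[of "(\<lambda>i. qRe (lam i) - Re z) ` K" "e / (C + 1)"] C e by auto
  define m where "m = cquat (z + of_real d)"
  have m: "complex_quat m" "qRe m = Re z + d"
    by (simp_all add: m_def) (simp add: cquat_def)
  have sep: "qRe (lam i) \<noteq> qRe m" if "i \<in> K" for i
    using d(3) that by (auto simp: m(2) image_iff algebra_simps)
  define M' where "M' = M + d *\<^sub>R E"
  define B' where "B' = B + d *\<^sub>R (P ** E ** Q)"
  have QBP: "Q ** B' ** P = M'"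
  proof -
    have "Q ** (P ** E ** Q) ** P = (Q ** P) ** E ** (Q ** P)"
      by (simp only: matrix_mul_assoc)
    then show ?thesis
      by (simp add: B'_def M'_def M_def mm.add_left mm.add_right mm.scaleR_left mm.scaleR_right PQ)
  qed
  have near: "dist B' B < e"
  proof -
    have "dist B' B = d * C"
      using d(1) by (simp add: B'_def dist_norm C_def)
    also have "\<dots> \<le> d * (C + 1)"
      using d(1) by simp
    also have "\<dots> < e"
      using d(2) C by (simp add: field_simps)
    finally show ?thesis .
  qed
  have M'v: "M' *v v = M *v v + d *\<^sub>R rscale (rscale y (inverse (y $ j))) (v $ j)" for v
    by (simp add: M'_def E_def matrix_vector_mult_add_rdistrib matrix_vector_scaleR col_at_vector)
  have M'K: "M' *v axis i 1 = axis i (lam i)" if "i \<in> K" for i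
  proof -
    have "i \<noteq> j" using that jK by auto
    then have "(axis i 1 :: quat ^ 'n) $ j = 0" by (simp add: axis_def)
    then show ?thesis
      unfolding M'v using eig[OF that] by (simp add: M_def rscale_simps)
  qed
  have M'y: "M' *v y = M *v y + d *\<^sub>R y"
    unfolding M'v using j by (simp add: rscale_simps)
  have "\<exists>x. x * m - lam i * x = (M *v y) $ i" if "i \<in> K" for i
    using sylvester_solvable[OF sep[OF that]] by metis
  \<comment> \<open>The components in \<open>K\<close> that must be added to \<open>y\<close> so
    that \<open>M'\<close> acts on the sum as right multiplication by \<open>m\<close>.\<close>
  then obtain x where x: "\<And>i. i \<in> K \<Longrightarrow> x i * m - lam i * x i = (M *v y) $ i" by metis
  define v where "v = y + (\<Sum>i\<in>K. axis i (x i))"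
  have sum_nth: "(\<Sum>i\<in>K. axis i (g i)) $ a = (if a \<in> K then g a else 0)" for g :: "'n \<Rightarrow> quat" and a
    by (simp add: axis_def sum.delta' cong: if_cong)
  have vj: "v $ j = y $ j"
    using jK by (simp only: v_def vector_add_component sum_nth) simp
  have M'v_eq: "M' *v v = rscale v m"
  proof -
    have "M' *v axis i (x i) = axis i (lam i * x i)" if "i \<in> K" for i
      using M'K[OF that] matrix_rscale[of M' "axis i 1" "x i"] by (simp add: rscale_axis)
    then have "M' *v (\<Sum>i\<in>K. axis i (x i)) = (\<Sum>i\<in>K. axis i (lam i * x i))"
      by (simp add: linear_sum[OF linear_matrix_vector])
    then have M'v': "M' *v v = M *v y + d *\<^sub>R y + (\<Sum>i\<in>K. axis i (lam i * x i))"
      unfolding v_def by (simp add: linear_add[OF linear_matrix_vector] M'y)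
    have "(M' *v v) $ a = rscale v m $ a" for a
    proof (cases "a \<in> K")
      case True
      then have "y $ a = 0" using y(1) by (simp add: Y_def)
      moreover have "(M *v y) $ a + lam a * x a = x a * m"
        using x[OF True] by (simp add: diff_eq_eq)
      ultimately show ?thesis
        using True unfolding M'v'
        by (simp only: v_def rscale_def vec_lambda_beta vector_add_component sum_nth) simp
    next
      case False
      then have "(M *v y) $ a = y $ a * cquat z"
        using y(3) by (simp add: N_def rscale_def vec_eq_iff) metis
      then show ?thesis
        using False unfolding M'v'
        by (simp only: v_def rscale_def vec_lambda_beta vector_add_component sum_nth)
          (simp only: m_def cquat_simps distrib_left, simp add: of_real_def)
    qed
    then show ?thesis by (simp add: vec_eq_iff)
  qed
  \<comment> \<open>Change of basis: \<open>R\<close> sends \<open>axis j 1\<close> to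
    \<open>v\<close> and fixes the other axes, and \<open>S\<close> is its inverse because
    \<open>v $ j\<close> is nonzero.\<close>
  define a where "a = v - axis j 1"
  define b where "b = - rscale a (inverse (v $ j))"
  define R where "R = mat 1 + col_at j a"
  define S where "S = mat 1 + col_at j b"
  have Rw: "R *v w = w + rscale a (w $ j)" and Sw: "S *v w = w + rscale b (w $ j)" for w
    by (simp_all add: R_def S_def matrix_vector_mult_add_rdistrib col_at_vector)
  have vj0: "v $ j \<noteq> 0" using vj j by simp
  have nth: "rscale a t $ j = (v $ j - 1) * t" "rscale b t $ j = - ((v $ j - 1) * inverse (v $ j)) * t" for t
    by (simp_all add: a_def b_def rscale_def)
  have b_rscale: "rscale b t = - rscale a (inverse (v $ j) * t)" for t
    by (simp add: b_def rscale_def vec_eq_iff mult.assoc)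
  have RS: "R ** S = mat 1" "S ** R = mat 1"
  proof -
    have "R *v (S *v w) = w" for w
    proof -
      have "(w + rscale b (w $ j)) $ j = inverse (v $ j) * w $ j"
        using vj0 by (simp add: nth algebra_simps)
      then show ?thesis
        unfolding Rw Sw by (simp add: b_rscale)
    qed
    then show "R ** S = mat 1"
      by (simp add: matrix_eq matrix_vector_mul_assoc[symmetric])
    have "S *v (R *v w) = w" for w
    proof -
      have "(w + rscale a (w $ j)) $ j = v $ j * w $ j"
        by (simp add: nth algebra_simps)
      then show ?thesis
        unfolding Rw Sw using vj0 by (simp add: b_rscale mult.assoc[symmetric])
    qed
    then show "S ** R = mat 1"
      by (simp add: matrix_eq matrix_vector_mul_assoc[symmetric])
  qed
  define P' where "P' = P ** R"
  define Q' where "Q' = S ** Q"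
  define lam' where "lam' = lam(j := m)"
  have "P' ** Q' = P ** (R ** S) ** Q" "Q' ** P' = S ** (Q ** P) ** R"
    by (simp_all only: P'_def Q'_def matrix_mul_assoc)
  then have PQ': "P' ** Q' = mat 1" "Q' ** P' = mat 1"
    by (simp_all add: RS PQ)
  have conj: "Q' ** B' ** P' = S ** M' ** R"
  proof -
    have "Q' ** B' ** P' = S ** (Q ** B' ** P) ** R"
      by (simp only: P'_def Q'_def matrix_mul_assoc)
    then show ?thesis by (simp only: QBP)
  qed
  have "(Q' ** B' ** P') *v axis i 1 = axis i (lam' i)" if "i \<in> insert j K" for i
  proof (cases "i = j")
    case True
    have Rj: "R *v axis j 1 = v"
      by (simp add: Rw a_def rscale_simps)
    have "S *v v = axis j 1"
      using RS(2) unfolding Rj[symmetric] by (simp add: matrix_vector_mul_assoc)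
    then have "S *v (M' *v (R *v axis j 1)) = axis j m"
      by (simp add: Rj M'v_eq matrix_rscale rscale_axis)
    then show ?thesis
      unfolding conj using True by (simp add: lam'_def matrix_vector_mul_assoc[symmetric])
  next
    case False
    then have iK: "i \<in> K" using that by auto
    have 0: "axis i t $ j = 0" for t :: quat
      using False by (simp add: axis_def)
    have "S *v (M' *v (R *v axis i 1)) = axis i (lam i)"
      by (simp add: Rw Sw 0 M'K[OF iK] rscale_simps)
    then show ?thesis
      unfolding conj using False by (simp add: lam'_def matrix_vector_mul_assoc[symmetric])
  qed
  moreover have "complex_quat (lam' i)" if "i \<in> insert j K" for i
    using that lam(1) m(1) by (auto simp: lam'_def)
  moreover have "inj_on (\<lambda>i. qRe (lam' i)) (insert j K)"
  proof (rule inj_onI)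
    fix i i' assume "i \<in> insert j K" "i' \<in> insert j K" "qRe (lam' i) = qRe (lam' i')"
    then show "i = i'"
      using sep[of i] sep[of i'] inj_onD[OF lam(2), of i i'] by (auto simp: lam'_def split: if_splits)
  qed
  ultimately show thesis
    using that[OF jK near PQ'] by blast
qed

lemma diagonalizable_dense:
  fixes B0 :: "quat ^ 'n ^ 'n"
  assumes e: "0 < e"
  obtains B P Q :: "quat ^ 'n ^ 'n" and lam where "dist B B0 < e" "P ** Q = mat 1" "Q ** P = mat 1" "B = P ** dmat lam ** Q"
    "\<And>i. complex_quat (lam i)" "\<And>i j. i \<noteq> j \<Longrightarrow> qRe (lam i) \<noteq> qRe (lam j)"
proof -
  have "\<exists>(K :: 'n set) B (P :: quat ^ 'n ^ 'n) (Q :: quat ^ 'n ^ 'n) lam. card K = n \<and> dist B B0 < e \<and> P ** Q = mat 1 \<and> Q ** P = mat 1 \<and>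
      (\<forall>i\<in>K. (Q ** B ** P) *v axis i 1 = axis i (lam i)) \<and> (\<forall>i\<in>K. complex_quat (lam i)) \<and> inj_on (\<lambda>i. qRe (lam i)) K"
    if "n \<le> CARD('n)" for n
    using that
  proof (induction n)
    case 0
    show ?case
      by (rule exI[of _ "{}"], rule exI[of _ B0], rule exI[of _ "mat 1"], rule exI[of _ "mat 1"]) (simp add: e)
  next
    case (Suc n)
    then obtain K :: "'n set" and B P Q lam where K: "card K = n" and B: "dist B B0 < e" and PQ: "P ** Q = mat 1" "Q ** P = mat 1"
      and eig: "\<And>i. i \<in> K \<Longrightarrow> (Q ** B ** P) *v axis i 1 = axis i (lam i)"
      and lam: "\<And>i. i \<in> K \<Longrightarrow> complex_quat (lam i)" "inj_on (\<lambda>i. qRe (lam i)) K"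
      by (metis Suc_leD)
    have ne: "K \<noteq> UNIV" using K Suc.prems by auto
    \<comment> \<open>Each step may use only what is left of the allowed distance.\<close>
    obtain B' P' Q' lam' j where j: "j \<notin> K" "dist B' B < e - dist B B0" "P' ** Q' = mat 1" "Q' ** P' = mat 1"
      "\<And>i. i \<in> insert j K \<Longrightarrow> (Q' ** B' ** P') *v axis i 1 = axis i (lam' i)"
      "\<And>i. i \<in> insert j K \<Longrightarrow> complex_quat (lam' i)" "inj_on (\<lambda>i. qRe (lam' i)) (insert j K)"
      using diagonalize_step[OF PQ ne eig lam, of "e - dist B B0"] B by (metis diff_gt_0_iff_gt)
    have "card (insert j K) = Suc n"
      using j(1) K by simp
    moreover have "dist B' B0 < e"
      using j(2) dist_triangle[of B' B0 B] by linarith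
    ultimately show ?case
      using j(3-7) by blast
  qed
  from this[OF order_refl] obtain K :: "'n set" and B P Q lam where K: "card K = CARD('n)" and B: "dist B B0 < e"
    and PQ: "P ** Q = mat 1" "Q ** P = mat 1"
    and eig: "\<forall>i\<in>K. (Q ** B ** P) *v axis i 1 = axis i (lam i)"
    and lam: "\<forall>i\<in>K. complex_quat (lam i)" "inj_on (\<lambda>i. qRe (lam i)) K"
    by blast
  have U: "K = UNIV"
    using K by (intro card_subset_eq) auto
  have "(Q ** B ** P) $ a $ i = dmat lam $ a $ i" for a i
  proof -
    have "(Q ** B ** P) $ a $ i = ((Q ** B ** P) *v axis i 1) $ a"
      by (simp add: matrix_vector_axis)
    also have "\<dots> = axis i (lam i) $ a"
      using eig U by simp
    finally show ?thesis by (simp add: axis_def)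
  qed
  then have diag: "Q ** B ** P = dmat lam"
    by (simp add: vec_eq_iff)
  have "P ** (Q ** B ** P) ** Q = (P ** Q) ** B ** (P ** Q)"
    by (simp only: matrix_mul_assoc)
  then have "B = P ** dmat lam ** Q"
    by (simp add: diag PQ)
  then show thesis
    using that[OF B PQ] lam U by (auto simp: inj_on_def)
qed

text \<open>Quaternions commute only under the real part of a product, so cyclicity is available for
  the real part of the trace, which is what defines \<open>sl_H\<close>.\<close>

lemma qRe_trace_commute: "qRe (trace (X ** Y)) = qRe (trace (Y ** X))" for X Y :: "quat ^ 'n ^ 'n"
proof -
  have "(\<Sum>i\<in>UNIV. \<Sum>k\<in>UNIV. qRe (X $ i $ k * Y $ k $ i)) = (\<Sum>k\<in>UNIV. \<Sum>i\<in>UNIV. qRe (Y $ k $ i * X $ i $ k))"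
    by (subst sum.swap) (simp only: qRe_mult_commute)
  then show ?thesis
    by (simp only: trace_def matrix_matrix_mult_def vec_lambda_beta qRe_sum)
qed

lemma qRe_trace_conj:
  fixes P Q X :: "quat ^ 'n ^ 'n"
  assumes "Q ** P = mat 1"
  shows "qRe (trace (P ** X ** Q)) = qRe (trace X)"
proof -
  have "qRe (trace (P ** X ** Q)) = qRe (trace (Q ** (P ** X)))"
    by (rule qRe_trace_commute)
  then show ?thesis
    by (simp add: matrix_mul_assoc assms)
qed

section \<open>Good pairs are dense\<close>

lemma qRe_trace_linear: "linear (\<lambda>X :: quat ^ 'n ^ 'n. qRe (trace X))"
  by (rule linearI) (simp_all add: trace_def qRe_sum sum.distrib sum_distrib_left)

lemma dmat_add: "dmat (\<lambda>i. c i + d i) = dmat c + dmat d" and dmat_scaleR: "dmat (\<lambda>i. r *\<^sub>R c i) = r *\<^sub>R dmat c"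
  and dmat_const: "dmat (\<lambda>_. r *\<^sub>R 1) = r *\<^sub>R mat 1"
  by (simp_all add: vec_eq_iff mat_def)

text \<open>Frequencies in an odd and an even multiple of a small \<open>\<beta>\<close> give the half period
  \<open>\<pi> / \<beta>\<close> required in \<open>good_pair\<close>.\<close>

lemma odd_even_multiples:
  fixes b b' \<epsilon> :: real
  assumes "0 < \<epsilon>"
  obtains \<beta> k k' where "0 < \<beta>" "\<bar>\<beta> * (2 * of_int k + 1) - b\<bar> < \<epsilon>" "\<bar>\<beta> * (2 * of_int k') - b'\<bar> < \<epsilon>" "k' \<noteq> 0"
proof -
  \<comment> \<open>Rounding to a grid of width \<open>2 * \<beta>\<close> costs at most
    \<open>2 * \<beta>\<close>, which is below \<open>\<epsilon>\<close>.\<close>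
  define \<beta> where "\<beta> = \<epsilon> / 3"
  have \<beta>: "0 < \<beta>" "3 * \<beta> = \<epsilon>" using assms by (simp_all add: \<beta>_def)
  define k where "k = \<lfloor>b / (2 * \<beta>)\<rfloor>"
  define l where "l = \<lfloor>b' / (2 * \<beta>)\<rfloor>"
  have fl: "2 * \<beta> * of_int \<lfloor>x / (2 * \<beta>)\<rfloor> \<le> x" "x < 2 * \<beta> * of_int \<lfloor>x / (2 * \<beta>)\<rfloor> + 2 * \<beta>" for x
  proof -
    define y where "y = x / (2 * \<beta>)"
    have x: "x = 2 * \<beta> * y" using \<beta>(1) by (simp add: y_def)
    have "2 * \<beta> * of_int \<lfloor>y\<rfloor> \<le> 2 * \<beta> * y" "2 * \<beta> * y < 2 * \<beta> * (of_int \<lfloor>y\<rfloor> + 1)"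
      using \<beta>(1) by (auto intro!: mult_left_mono mult_strict_left_mono)
    then show "2 * \<beta> * of_int \<lfloor>x / (2 * \<beta>)\<rfloor> \<le> x" "x < 2 * \<beta> * of_int \<lfloor>x / (2 * \<beta>)\<rfloor> + 2 * \<beta>"
      unfolding y_def[symmetric] x[symmetric] by (simp_all add: distrib_left)
  qed
  have 1: "\<bar>\<beta> * (2 * of_int k + 1) - b\<bar> < \<epsilon>"
    using fl[of b] \<beta> unfolding k_def by (simp add: algebra_simps abs_less_iff)
  \<comment> \<open>Rounding down could give 0, which \<open>freq\<close> forbids; the next grid
    point is still within \<open>2 * \<beta>\<close>.\<close>
  have 2: "\<bar>\<beta> * (2 * of_int (if l = 0 then 1 else l)) - b'\<bar> < \<epsilon>"
    using fl[of b'] \<beta> unfolding l_def[symmetric] by (auto simp: algebra_simps abs_less_iff)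
  show thesis
    by (rule that[OF \<beta>(1) 1 2]) simp
qed

lemma exp_quat_complex:
  "exp (Quat a b 0 0) = (exp a * cos b) *\<^sub>R 1 + (exp a * sin b) *\<^sub>R Quat 0 1 0 0"
proof -
  have i: "Quat 0 1 0 0 * Quat 0 1 0 0 = - 1" by (simp add: quat_eq_iff)
  have "exp (of_real a + b *\<^sub>R Quat 0 1 0 0) = exp (of_real a) * exp (b *\<^sub>R Quat 0 1 0 0)"
    by (rule exp_add_commuting) (simp add: of_real_def)
  moreover have "of_real a + b *\<^sub>R Quat 0 1 0 0 = Quat a b 0 0"
    by (simp add: of_real_def quat_eq_iff)
  moreover have "exp (of_real a) = exp a *\<^sub>R (1 :: quat)"
    by (metis exp_of_real of_real_def)
  ultimately show ?thesis
    by (simp add: exp_scaleR_imaginary_unit[OF i] scaleR_add_right)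
qed

lemma cos_int_pi: "cos (pi * (2 * of_int k + 1)) = - 1" "cos (pi * (2 * of_int k)) = 1"
  "sin (pi * (2 * of_int k + 1)) = 0" "sin (pi * (2 * of_int k)) = 0"
proof -
  show 1: "cos (pi * (2 * of_int k)) = 1" "sin (pi * (2 * of_int k)) = 0"
    using cos_int_2pin[of k] sin_int_2pin[of k] by (simp_all add: mult_ac)
  show "cos (pi * (2 * of_int k + 1)) = - 1" "sin (pi * (2 * of_int k + 1)) = 0"
    unfolding distrib_left cos_add sin_add 1 by simp_all
qed

text \<open>\<open>B0\<close> is made diagonalizable, brought back to zero real trace, and then has
  its two extreme frequencies tuned; \<open>A0\<close> is changed in the eigenbasis so that no
  relevant entry vanishes. The result is a good pair in that basis, and density is carried back by
  similarity.\<close>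

lemma good_pair_dense:
  fixes A0 B0 :: "quat ^ 'n ^ 'n"
  assumes card: "CARD('n) \<ge> 2" and A0: "A0 \<in> sl_H" and B0: "B0 \<in> sl_H" and e: "0 < e"
  obtains A B where "A \<in> sl_H" "B \<in> sl_H" "dist A A0 < e" "dist B B0 < e"
    "\<forall>\<^sub>F \<tau> in nhds (A, B). {g. invertible g} \<subseteq> reach (fst \<tau>) (snd \<tau>)"
proof -
  define F where "F X = X - (qRe (trace X) / real CARD('n)) *\<^sub>R mat 1" for X :: "quat ^ 'n ^ 'n"
  have "bounded_linear (\<lambda>X :: quat ^ 'n ^ 'n. qRe (trace X))"
    using qRe_trace_linear by (simp add: linear_conv_bounded_linear)
  then have "isCont F B0"
    unfolding F_def by (intro continuous_intros bounded_linear.isCont[of "\<lambda>X. qRe (trace X)"]) auto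
  moreover have FB0: "F B0 = B0"
    using B0 by (simp add: F_def sl_H_def)
  ultimately obtain d where d: "0 < d" "\<And>X. dist X B0 < d \<Longrightarrow> dist (F X) B0 < e / 2"
    using e unfolding continuous_at_eps_delta by (metis half_gt_zero)
  obtain B1 and P Q :: "quat ^ 'n ^ 'n" and lam where B1: "dist B1 B0 < d" and PQ: "P ** Q = mat 1" "Q ** P = mat 1"
    and diag: "B1 = P ** dmat lam ** Q" and lam: "\<And>i. complex_quat (lam i)" "\<And>i j. i \<noteq> j \<Longrightarrow> qRe (lam i) \<noteq> qRe (lam j)"
    using diagonalizable_dense[OF d(1), of B0] by metis
  define r where "r = qRe (trace B1) / real CARD('n)"
  define a where "a i = qRe (lam i) - r" for i
  have a_inj: "i \<noteq> j \<Longrightarrow> a i \<noteq> a j" for i j using lam(2) by (simp add: a_def)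
  have "Max (range a) \<in> range a" "Min (range a) \<in> range a"
    by (simp_all only: Max_in Min_in finite image_is_empty UNIV_not_empty finite_imageI not_False_eq_True)
  then obtain p q where pq_eq: "Max (range a) = a p" "Min (range a) = a q" by (elim rangeE)
  have p: "a k \<le> a p" and q: "a q \<le> a k" for k
    unfolding pq_eq[symmetric] by simp_all
  have p': "a k < a p" if "k \<noteq> p" for k using p[of k] a_inj[OF that] by simp
  have q': "a q < a k" if "k \<noteq> q" for k using q[of k] a_inj[OF that] by simp
  have pq: "p \<noteq> q"
  proof
    assume "p = q"
    then have "k = p" for k using p'[of k] q[of k] by fastforce
    then have "UNIV = {p}" by auto
    then have "CARD('n) = card {p}" by simp
    then show False using card by simp
  qed
  \<comment> \<open>Only the imaginary parts at \<open>p\<close> and \<open>q\<close> are variable,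
    so tuning them affects neither the real trace nor the order of the real parts.\<close>
  define mu where "mu s t i = Quat (a i) (if i = p then s else if i = q then t else qI (lam i)) 0 0" for s t i
  define G where "G z = P ** dmat (mu (fst z) (snd z)) ** Q" for z
  have G0: "G (qI (lam p), qI (lam q)) = F B1"
  proof -
    have "mu (qI (lam p)) (qI (lam q)) = (\<lambda>i. lam i + (- r) *\<^sub>R 1)"
      using lam(1) by (auto simp: mu_def a_def quat_eq_iff complex_quat_def)
    then have "dmat (mu (qI (lam p)) (qI (lam q))) = dmat lam + (- r) *\<^sub>R mat 1"
      by (simp only: dmat_add dmat_const)
    then have "P ** dmat (mu (qI (lam p)) (qI (lam q))) ** Q = B1 + (- r) *\<^sub>R mat 1"
      by (simp add: mm.add_left mm.add_right mm.scaleR_left mm.scaleR_right mm.diff_left mm.diff_right PQ diag)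
    then show ?thesis by (simp add: G_def F_def r_def)
  qed
  have "isCont G (qI (lam p), qI (lam q))"
  proof -
    have eq: "dmat (mu (fst z) (snd z)) = dmat (mu 0 0) + fst z *\<^sub>R munit p p (Quat 0 1 0 0) + snd z *\<^sub>R munit q q (Quat 0 1 0 0)" for z
      using pq by (auto simp: vec_eq_iff mu_def quat_eq_iff)
    have "continuous_on UNIV G"
      unfolding G_def eq by (intro mm.continuous_on continuous_intros)
    then show ?thesis by (simp add: continuous_on_eq_continuous_at)
  qed
  then obtain h where h: "0 < h" "\<And>z. dist z (qI (lam p), qI (lam q)) < h \<Longrightarrow> dist (G z) (F B1) < e / 2"
    using e unfolding continuous_at_eps_delta G0 by (metis half_gt_zero)
  obtain \<beta> k k' where \<beta>: "0 < \<beta>" "\<bar>\<beta> * (2 * of_int k + 1) - qI (lam p)\<bar> < h / 2"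
    "\<bar>\<beta> * (2 * of_int k') - qI (lam q)\<bar> < h / 2" "k' \<noteq> 0"
    using odd_even_multiples[of "h / 2" "qI (lam p)" "qI (lam q)"] h(1) by auto
  define s where "s = \<beta> * (2 * of_int k + 1)"
  define t where "t = \<beta> * (2 * of_int k')"
  define B where "B = G (s, t)"
  have "dist (s, t) (qI (lam p), qI (lam q)) \<le> dist s (qI (lam p)) + dist t (qI (lam q))"
    unfolding dist_Pair_Pair by (rule sqrt_sum_squares_le_sum) auto
  also have "\<dots> < h"
    using \<beta> by (simp add: s_def t_def dist_real_def)
  finally have "dist B (F B1) < e / 2"
    unfolding B_def by (rule h(2))
  then have B_near: "dist B B0 < e"
    using d(2)[OF B1] dist_triangle[of B B0 "F B1"] by linarith
  have B_sl: "B \<in> sl_H"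
  proof -
    have "qRe (trace B) = (\<Sum>i\<in>UNIV. a i)"
      by (simp add: B_def G_def qRe_trace_conj[OF PQ(2)]) (simp add: trace_def qRe_sum mu_def)
    also have "\<dots> = (\<Sum>i\<in>UNIV. qRe (lam i)) - real CARD('n) * r"
      by (simp add: a_def sum_subtractf)
    also have "(\<Sum>i\<in>UNIV. qRe (lam i)) = qRe (trace B1)"
      by (simp add: diag qRe_trace_conj[OF PQ(2)]) (simp add: trace_def qRe_sum)
    finally show ?thesis by (simp add: sl_H_def r_def)
  qed
  define A1 where "A1 = Q ** A0 ** P"
  \<comment> \<open>The entries 1 + j shift the real part and the j-part of every off-diagonal entry
    at once; the zero diagonal keeps the trace.\<close>
  define J :: "quat ^ 'n ^ 'n" where "J = (\<chi> j k. if j = k then 0 else Quat 1 0 1 0)"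
  define C where "C = norm (P ** J ** Q)"
  have C: "0 \<le> C" by (simp add: C_def)
  have "finite (range (\<lambda>(j, k). - qRe (A1 $ j $ k)) \<union> range (\<lambda>(j, k). - qJ (A1 $ j $ k)))" (is "finite ?X")
    by simp
  then obtain c where c: "0 < c" "c < e / (C + 1)" "c \<notin> ?X"
    using small_nonmember[of ?X "e / (C + 1)"] C e by auto
  define A2 where "A2 = A1 + c *\<^sub>R J"
  have entries: "qRe (A2 $ j $ k) \<noteq> 0" "qJ (A2 $ j $ k) \<noteq> 0" if "j \<noteq> k" for j k
  proof -
    have "c \<noteq> - qRe (A1 $ j $ k)" "c \<noteq> - qJ (A1 $ j $ k)"
      using c(3) by auto
    then show "qRe (A2 $ j $ k) \<noteq> 0" "qJ (A2 $ j $ k) \<noteq> 0"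
      using that by (auto simp: A2_def J_def)
  qed
  define A where "A = P ** A2 ** Q"
  have A_eq: "A = A0 + c *\<^sub>R (P ** J ** Q)"
  proof -
    have "P ** A1 ** Q = (P ** Q) ** A0 ** (P ** Q)"
      unfolding A1_def by (simp only: matrix_mul_assoc)
    then show ?thesis
      by (simp add: A_def A2_def mm.add_left mm.add_right mm.scaleR_left mm.scaleR_right PQ)
  qed
  have A_near: "dist A A0 < e"
  proof -
    have "dist A A0 = c * C"
      using c(1) by (simp add: A_eq dist_norm C_def)
    also have "\<dots> \<le> c * (C + 1)"
      using c(1) by simp
    also have "\<dots> < e"
      using c(2) C by (simp add: field_simps)
    finally show ?thesis .
  qed
  have A_sl: "A \<in> sl_H"
  proof -
    have "qRe (trace A) = qRe (trace A0) + c * qRe (trace (P ** J ** Q))"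
      unfolding A_eq by (simp add: linear_add[OF qRe_trace_linear] linear_scale[OF qRe_trace_linear])
    also have "qRe (trace (P ** J ** Q)) = 0"
      unfolding qRe_trace_conj[OF PQ(2)] by (simp add: trace_def J_def)
    finally show ?thesis using A0 by (simp add: sl_H_def)
  qed
  define nu where "nu = mu s t"
  interpret cl: closed_matrix_semigroup "closure (reach A2 (dmat nu))"
    by (rule closure_reach_semigroup)
  interpret good_pair "closure (reach A2 (dmat nu))" A2 nu p q "pi / \<beta>" "- 1"
  proof
    show "A2 \<in> mwedge (closure (reach A2 (dmat nu)))" "dmat nu \<in> medge (closure (reach A2 (dmat nu)))"
      "mat 1 \<in> medge (closure (reach A2 (dmat nu)))"
      by (rule closure_reach_wedge)+
    show "complex_quat (nu i)" for i
      by (simp add: nu_def mu_def complex_quat_def)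
    show "qRe (nu i) \<noteq> qRe (nu j)" if "i \<noteq> j" for i j
      using a_inj[OF that] by (simp add: nu_def mu_def)
    show "qRe (nu k) < qRe (nu p)" if "k \<noteq> p" for k
      using p'[OF that] by (simp add: nu_def mu_def)
    show "qRe (nu q) < qRe (nu k)" if "k \<noteq> q" for k
      using q'[OF that] by (simp add: nu_def mu_def)
    have nu_pq: "nu p = Quat (a p) s 0 0" "nu q = Quat (a q) t 0 0"
      using pq by (simp_all add: nu_def mu_def)
    have int: "2 * k + 1 \<noteq> 0" "2 * k + 1 \<noteq> 2 * k'" "2 * k + 1 \<noteq> - (2 * k')"
      by presburger+
    have real: "2 * real_of_int k + 1 = of_int (2 * k + 1)" "2 * real_of_int k' = of_int (2 * k')" by simp_all
    show "qI (nu p) \<noteq> 0" "qI (nu q) \<noteq> 0" "qI (nu p) \<noteq> qI (nu q)" "qI (nu p) \<noteq> - qI (nu q)"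
    proof -
      show "qI (nu p) \<noteq> 0" "qI (nu q) \<noteq> 0" "qI (nu p) \<noteq> qI (nu q)"
        unfolding nu_pq quat.sel s_def t_def real using \<beta>(1,4) int
        by (simp_all only: mult_cancel_left mult_eq_0_iff of_int_eq_0_iff of_int_eq_iff) auto
      have "\<beta> * of_int (2 * k + 1) \<noteq> \<beta> * of_int (- (2 * k'))"
        using \<beta>(1) int(3) by (simp only: mult_cancel_left of_int_eq_iff) auto
      then show "qI (nu p) \<noteq> - qI (nu q)"
        unfolding nu_pq quat.sel s_def t_def real by simp
    qed
    have st: "pi / \<beta> * s = pi * (2 * of_int k + 1)" "pi / \<beta> * t = pi * (2 * of_int k')"
      using \<beta>(1) by (simp_all add: s_def t_def)
    have scale: "(pi / \<beta>) *\<^sub>R Quat x y 0 0 = Quat (pi / \<beta> * x) (pi / \<beta> * y) 0 0" for x y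
      by (simp add: quat_eq_iff)
    show "exp ((pi / \<beta>) *\<^sub>R nu p) = (- 1 * exp (pi / \<beta> * qRe (nu p))) *\<^sub>R 1"
      "exp ((pi / \<beta>) *\<^sub>R nu q) = (- (- 1) * exp (pi / \<beta> * qRe (nu q))) *\<^sub>R 1"
      unfolding nu_pq scale exp_quat_complex st cos_int_pi by simp_all
    show "0 < pi / \<beta>" using \<beta>(1) by simp
    show "p \<noteq> q" by (rule pq)
    show "(- 1 :: real)\<^sup>2 = 1" by simp
    show "qRe (A2 $ j $ k) \<noteq> 0" "qJ (A2 $ j $ k) \<noteq> 0" if "j \<noteq> k" for j k
      using entries[OF that] .
  qed
  have "{g. invertible g} \<subseteq> closure (reach A B)"
    using closure_reach_conj[OF PQ invertible_subset] by (simp add: A_def B_def G_def nu_def)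
  moreover have "(Q ** A ** P) $ p $ q \<noteq> 0"
  proof -
    have "Q ** A ** P = (Q ** P) ** A2 ** (Q ** P)"
      unfolding A_def by (simp only: matrix_mul_assoc)
    then show ?thesis
      using entries(1)[OF pq] by (auto simp: PQ)
  qed
  ultimately have "\<forall>\<^sub>F \<tau> in nhds (A, B). {g. invertible g} \<subseteq> reach (fst \<tau>) (snd \<tau>)"
    by (rule eventually_reach_invertible[OF _ PQ _ pq])
  then show thesis
    using that A_sl B_sl A_near B_near by blast
qed

theorem theorem5p4:
  assumes "CARD('n::finite) \<ge> 2"
  shows "\<exists>C :: ((quat ^ 'n ^ 'n) \<times> (quat ^ 'n ^ 'n)) set.
           C \<subseteq> sl_H \<times> sl_H \<and>
           openin (top_of_set (sl_H \<times> sl_H)) C \<and>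
           sl_H \<times> sl_H \<subseteq> closure C \<and>
           (\<forall>(A, B) \<in> C. controllable A B)"
proof -
  define R where "R = {\<tau> :: (quat ^ 'n ^ 'n) \<times> (quat ^ 'n ^ 'n). {g. invertible g} \<subseteq> reach (fst \<tau>) (snd \<tau>)}"
  \<comment> \<open>The interior is taken among all pairs of matrices, where the reachable sets with
    scalars live; the restriction to \<open>sl_H\<close> brings the determinant back in.\<close>
  define C where "C = (sl_H \<times> sl_H) \<inter> interior R"
  have "openin (top_of_set (sl_H \<times> sl_H)) C"
    unfolding C_def by (rule openin_open_Int) simp
  moreover have "sl_H \<times> sl_H \<subseteq> closure C"
  proof
    fix \<tau> :: "(quat ^ 'n ^ 'n) \<times> (quat ^ 'n ^ 'n)"
    assume \<tau>: "\<tau> \<in> sl_H \<times> sl_H"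
    show "\<tau> \<in> closure C"
      unfolding closure_approachable
    proof (intro allI impI)
      fix e :: real assume e: "0 < e"
      obtain A B where AB: "A \<in> sl_H" "B \<in> sl_H" "dist A (fst \<tau>) < e / 2" "dist B (snd \<tau>) < e / 2"
        and ev: "\<forall>\<^sub>F \<sigma> in nhds (A, B). {g. invertible g} \<subseteq> reach (fst \<sigma>) (snd \<sigma>)"
        by (rule good_pair_dense[OF assms, of "fst \<tau>" "snd \<tau>" "e / 2"]) (use \<tau> e in auto)
      have "(A, B) \<in> interior R"
        using ev unfolding interior_def eventually_nhds R_def by blast
      then have "(A, B) \<in> C"
        using AB by (simp add: C_def)
      moreover have "dist (A, B) \<tau> < e"
        using AB(3,4) sqrt_sum_squares_le_sum[of "dist A (fst \<tau>)" "dist B (snd \<tau>)"]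
        by (cases \<tau>) (simp add: dist_Pair_Pair)
      ultimately show "\<exists>y\<in>C. dist y \<tau> < e" by blast
    qed
  qed
  moreover have "controllable A B" if "(A, B) \<in> C" for A B
  proof (rule controllable_if_reach)
    have "(A, B) \<in> R"
      using that interior_subset[of R] by (auto simp: C_def)
    then show "{g. invertible g} \<subseteq> reach A B"
      by (simp add: R_def)
  qed (use that in \<open>auto simp: C_def\<close>)
  ultimately show ?thesis
    by (intro exI[of _ C]) (auto simp: C_def)
qed

end
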